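(* Let $d\ge 2$ be an integer such that $$7\Big(\frac{2}{d+1}+\Big(1-\frac{2}{d+1}\Big)\,q(d-1)\Big)<1 ,$$ where $q(\nu)$ denotes the return probability to the origin of simple random walk on $\mathbb{Z}^\nu$. Then the disconnection time $T_N$ of the discrete cylinder $E=(\mathbb{Z}/N\mathbb{Z})^d\times\mathbb{Z}$ by simple random walk satisfies $$\lim_{\gamma\to 0}\ \liminf_{N\to\infty}\ P_0\big[\gamma N^{2d}\le T_N\big]=1 ,$$ i.e. the laws of $N^{2d}/T_N$, $N\ge 2$, are tight.
   Context: For $N\ge1$, $E=(\mathbb{Z}/N\mathbb{Z})^d\times\mathbb{Z}$ is endowed with its natural graph structure (nearest neighbors, as the quotient of $\mathbb{Z}^{d+1}$). $P_x$, $x\in E$, is the law on $E^{\mathbb{N}}$ of simple random walk on $E$ started at $x$, and $(X_n)_{n\ge0}$ is the canonical process; $X_{[0,n]}=\{X_0,\dots,X_n\}$; $0$ denotes the origin of $E$. A finite subset $S\subseteq E$ is said to disconnect $E$ if for large $M$, $(\mathbb{Z}/N\mathbb{Z})^d\times[M,\infty)$ and $(\mathbb{Z}/N\mathbb{Z})^d\times(-\infty,-M]$ are contained in distinct connected components of $E\setminus S$. The disconnection time is $T_N=\inf\{n\ge0:\ X_{[0,n]}\text{ disconnects }E\}$. For an integer $\nu\ge1$, $q(\nu)$ is the probability that simple random walk on $\mathbb{Z}^\nu$ started at the origin returns to the origin at some time $n\ge1$. *)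

theory Defs
  imports "HOL-Probability.Probability"
begin

text \<open>
  A locally finite graph is given by the function \<open>nb\<close> sending a vertex to its set of
  neighbours. The law of simple random walk started at \<open>x\<close> is the measure on trajectories
  obtained by the Ionescu-Tulcea construction from the transition kernels \<open>srw_kernel nb x\<close>.
\<close>

definition srw_kernel :: "('a \<Rightarrow> 'a set) \<Rightarrow> 'a \<Rightarrow> nat \<Rightarrow> (nat \<Rightarrow> 'a) \<Rightarrow> 'a measure" where
  "srw_kernel nb x n \<omega> =
     measure_pmf (case n of 0 \<Rightarrow> return_pmf x | Suc m \<Rightarrow> pmf_of_set (nb (\<omega> m)))"

definition srw :: "('a \<Rightarrow> 'a set) \<Rightarrow> 'a \<Rightarrow> (nat \<Rightarrow> 'a) measure" where
  "srw nb x = projective_family.lim UNIV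
     (Ionescu_Tulcea.CI (srw_kernel nb x) (\<lambda>_. count_space UNIV)) (\<lambda>_. count_space UNIV)"

lemma Ionescu_Tulcea_srw: "Ionescu_Tulcea (srw_kernel nb x) (\<lambda>_. count_space UNIV)"
proof (rule Ionescu_Tulcea.intro)
  fix i :: nat
  show "srw_kernel nb x i \<in> measurable (PiM {0..<i} (\<lambda>_. count_space UNIV)) (subprob_algebra (count_space UNIV))"
  proof (cases i)
    case 0
    then show ?thesis
      by (simp add: srw_kernel_def[abs_def] measure_pmf_in_subprob_algebra)
  next
    case (Suc m)
    have "(\<lambda>\<omega>. \<omega> m) \<in> measurable (PiM {0..<i} (\<lambda>_. count_space UNIV)) (count_space UNIV)"
      by (rule measurable_component_singleton) (simp add: Suc)
    moreover have "(\<lambda>v. measure_pmf (pmf_of_set (nb v))) \<in> measurable (count_space UNIV) (subprob_algebra (count_space UNIV))"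
      by (simp add: measure_pmf_in_subprob_algebra)
    ultimately show ?thesis
      unfolding srw_kernel_def[abs_def] Suc nat.case
      by (rule measurable_compose)
  qed
next
  fix i :: nat and \<omega>
  show "prob_space (srw_kernel nb x i \<omega>)"
    unfolding srw_kernel_def by (rule measure_pmf.prob_space_axioms)
qed

lemma sets_srw: "sets (srw nb x) = sets (PiM UNIV (\<lambda>_. count_space UNIV))"
proof -
  interpret Ionescu_Tulcea "srw_kernel nb x" "\<lambda>_. count_space UNIV"
    by (rule Ionescu_Tulcea_srw)
  show ?thesis
    unfolding srw_def by simp
qed

lemma prob_space_srw: "prob_space (srw nb x)"
proof -
  interpret Ionescu_Tulcea "srw_kernel nb x" "\<lambda>_. count_space UNIV"
    by (rule Ionescu_Tulcea_srw)
  interpret CI: prob_space "CI {}"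
    by (rule PF.prob_space_P) simp_all
  let ?X = "space (PiM {} (\<lambda>_::nat. count_space (UNIV :: 'a set)))"
  have "emeasure PF.lim (PF.emb UNIV {} ?X) = emeasure (CI {}) ?X"
    by (rule lim) (simp, rule sets.top)
  moreover have "?X = space (CI {})"
    by (simp add: PF.space_P)
  ultimately have "emeasure PF.lim (PF.emb UNIV {} ?X) = 1"
    by (simp only: CI.emeasure_space_1)
  moreover have "PF.emb UNIV {} ?X = space PF.lim"
    by (auto simp: prod_emb_def space_PiM)
  ultimately show ?thesis
    unfolding srw_def by (intro prob_spaceI) simp
qed

text \<open>The finite-dimensional distributions, which determine \<open>srw nb x\<close>.\<close>

lemma measure_srw_path:
  "measure (srw nb x) {\<omega>. \<forall>i\<le>n. \<omega> i = p i} =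
     (if p 0 = x then \<Prod>i<n. pmf (pmf_of_set (nb (p i))) (p (Suc i)) else 0)"
proof -
  interpret Ionescu_Tulcea "srw_kernel nb x" "\<lambda>_. count_space UNIV"
    by (rule Ionescu_Tulcea_srw)
  let ?M = "\<lambda>_::nat. count_space (UNIV :: 'a set)"
  let ?u = "\<lambda>_::nat. undefined :: 'a"
  let ?k = "\<lambda>n. case n of 0 \<Rightarrow> return_pmf x | Suc m \<Rightarrow> pmf_of_set (nb (p m))"
  have u: "?u \<in> space (PiM {0..<0} ?M)"
    by (simp add: space_PiM)
  have single: "{restrict p {0..<n}} \<in> sets (PiM {0..<n} ?M)" for n
  proof -
    have "{restrict p {0..<n}} = PiE {0..<n} (\<lambda>i. {p i})"
      by (auto simp: PiE_iff extensional_def restrict_def fun_eq_iff)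
    then show ?thesis
      by (simp add: sets_PiM_I_finite)
  qed
  have step: "emeasure (eP n \<omega>) {restrict p {0..<Suc n}} =
      indicator {restrict p {0..<n}} \<omega> * ennreal (pmf (?k n) (p n))"
    if \<omega>: "\<omega> \<in> space (PiM {0..<n} ?M)" for n \<omega>
  proof -
    have undef: "\<omega> i = undefined" if "\<not> i < n" for i
      using \<omega> that by (auto simp: space_PiM PiE_iff extensional_def)
    have eq: "emeasure (eP n \<omega>) {restrict p {0..<Suc n}} =
        emeasure (srw_kernel nb x n \<omega>) {y. fun_upd \<omega> n y = restrict p {0..<Suc n}}"
      by (subst emeasure_eP[OF \<omega> single]) (auto intro!: arg_cong2[where f=emeasure])
    show ?thesis
    proof (cases "\<omega> = restrict p {0..<n}")
      case True
      have "{y. fun_upd \<omega> n y = restrict p {0..<Suc n}} = {p n}"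
        by (auto simp: True fun_eq_iff restrict_def less_Suc_eq)
      moreover have "srw_kernel nb x n \<omega> = measure_pmf (?k n)"
        by (cases n) (auto simp: srw_kernel_def True)
      ultimately show ?thesis
        using eq True by (simp add: emeasure_pmf_single)
    next
      case False
      then obtain i where i: "\<omega> i \<noteq> restrict p {0..<n} i"
        by (meson ext)
      with undef have "i < n"
        by (cases "i < n") auto
      have "{y. fun_upd \<omega> n y = restrict p {0..<Suc n}} = {}"
      proof safe
        fix y
        assume "fun_upd \<omega> n y = restrict p {0..<Suc n}"
        then have "fun_upd \<omega> n y i = restrict p {0..<Suc n} i"
          by (rule fun_cong)
        with i \<open>i < n\<close> show "y \<in> {}"
          by simp
      qed
      with eq False show ?thesis
        by simp
    qed
  qed
  have C: "emeasure (C 0 n ?u) {restrict p {0..<n}} = (\<Prod>i<n. ennreal (pmf (?k i) (p i)))" for n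
  proof (induction n)
    case 0
    have "{restrict p {0..<0}} \<in> sets (PiM {0..<0} ?M)"
      by (rule single)
    then show ?case
      by (simp add: restrict_def)
  next
    case (Suc n)
    have ne: "space (C 0 n ?u) \<noteq> {}"
      using prob_space_C[OF u, of n] by (rule prob_space.not_empty)
    have sets: "sets (C 0 n ?u) = sets (PiM {0..<n} ?M)"
      using sets_C[OF u, of n] by simp
    have meas: "eP n \<in> measurable (C 0 n ?u) (subprob_algebra (PiM {0..<Suc n} ?M))"
      using measurable_eP[of n] unfolding measurable_cong_sets[OF sets refl] .
    have "emeasure (C 0 (Suc n) ?u) {restrict p {0..<Suc n}} =
        (\<integral>\<^sup>+\<omega>. emeasure (eP n \<omega>) {restrict p {0..<Suc n}} \<partial>C 0 n ?u)"
      unfolding C.simps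
      using meas by (subst emeasure_bind[OF ne _ single]) simp_all
    also have "\<dots> = (\<integral>\<^sup>+\<omega>. indicator {restrict p {0..<n}} \<omega> * ennreal (pmf (?k n) (p n)) \<partial>C 0 n ?u)"
      by (intro nn_integral_cong step) (simp add: space_C[OF u])
    also have "\<dots> = emeasure (C 0 n ?u) {restrict p {0..<n}} * ennreal (pmf (?k n) (p n))"
      by (subst nn_integral_multc) (use single[of n] sets in \<open>simp_all add: borel_measurable_indicator\<close>)
    finally show ?case
      unfolding Suc prod.lessThan_Suc .
  qed
  have emb: "PF.emb UNIV {0..<Suc n} {restrict p {0..<Suc n}} = {\<omega>. \<forall>i\<le>n. \<omega> i = p i}"
  proof safe
    fix \<omega> i
    assume "\<omega> \<in> PF.emb UNIV {0..<Suc n} {restrict p {0..<Suc n}}" "i \<le> n"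
    then have "restrict \<omega> {0..<Suc n} i = restrict p {0..<Suc n} i"
      by (simp add: prod_emb_def)
    with \<open>i \<le> n\<close> show "\<omega> i = p i"
      by simp
  next
    fix \<omega>
    assume "\<forall>i\<le>n. \<omega> i = p i"
    then have "restrict \<omega> {0..<Suc n} = restrict p {0..<Suc n}"
      by (intro restrict_ext) simp
    then show "\<omega> \<in> PF.emb UNIV {0..<Suc n} {restrict p {0..<Suc n}}"
      by (simp add: prod_emb_def space_PiM del: restrict_apply)
  qed
  have "emeasure (srw nb x) {\<omega>. \<forall>i\<le>n. \<omega> i = p i} = emeasure (CI {0..<Suc n}) {restrict p {0..<Suc n}}"
    unfolding srw_def emb[symmetric] by (rule lim[OF _ single]) simp
  also have "\<dots> = emeasure (C 0 (Suc n) ?u) (PF.emb {0..<Suc n} {0..<Suc n} {restrict p {0..<Suc n}})"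
    by (rule emeasure_CI[OF order_refl single])
  also have "PF.emb {0..<Suc n} {0..<Suc n} {restrict p {0..<Suc n}} = {restrict p {0..<Suc n}}"
    using single[of "Suc n", THEN sets.sets_into_space]
    by (intro prod_emb_id) (auto simp: space_PiM)
  also have "emeasure (C 0 (Suc n) ?u) {restrict p {0..<Suc n}} = (\<Prod>i<Suc n. ennreal (pmf (?k i) (p i)))"
    by (rule C)
  also have "\<dots> = ennreal (\<Prod>i<Suc n. pmf (?k i) (p i))"
    by (rule prod_ennreal) simp
  finally have "measure (srw nb x) {\<omega>. \<forall>i\<le>n. \<omega> i = p i} = (\<Prod>i<Suc n. pmf (?k i) (p i))"
    unfolding measure_def by (simp add: prod_nonneg del: prod.lessThan_Suc)
  then show ?thesis
    unfolding prod.lessThan_Suc_shift by (simp add: pmf_return)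
qed

text \<open>Points of \<open>\<int>\<^sup>\<nu>\<close> are the integer lists of length \<open>\<nu>\<close>.\<close>

definition lattice_nbrs :: "int list \<Rightarrow> int list set" where
  "lattice_nbrs x = {y. length y = length x \<and> (\<Sum>i<length x. \<bar>y ! i - x ! i\<bar>) = 1}"

definition return_prob :: "nat \<Rightarrow> real" where
  "return_prob \<nu> = measure (srw lattice_nbrs (replicate \<nu> 0))
     {\<omega>. \<exists>n\<ge>1. \<omega> n = replicate \<nu> 0}"

text \<open>
  A point of the cylinder \<open>(\<int>/N\<int>)\<^sup>d \<times> \<int>\<close> is represented by the list of length \<open>d + 1\<close> whose first
  \<open>d\<close> entries are reduced modulo \<open>N\<close>, i.e. by a canonical lift to \<open>\<int>\<^bsup>d+1\<^esup>\<close>. The neighbours in the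
  quotient graph are the projections of the neighbours of this (equivalently, any) lift.
\<close>

definition cyl_proj :: "nat \<Rightarrow> int list \<Rightarrow> int list" where
  "cyl_proj N x = map (\<lambda>a. a mod int N) (butlast x) @ [last x]"

definition cylinder :: "nat \<Rightarrow> nat \<Rightarrow> int list set" where
  "cylinder d N = cyl_proj N ` {x. length x = d + 1}"

definition cyl_nbrs :: "nat \<Rightarrow> int list \<Rightarrow> int list set" where
  "cyl_nbrs N x = cyl_proj N ` lattice_nbrs x"

definition cyl_origin :: "nat \<Rightarrow> int list" where
  "cyl_origin d = replicate (d + 1) 0"

definition components_within :: "('a \<Rightarrow> 'a set) \<Rightarrow> 'a set \<Rightarrow> 'a set set" where
  "components_within nb V = V // Restr ((Restr {(x, y). y \<in> nb x} V)\<^sup>*) V"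

definition disconnects :: "nat \<Rightarrow> nat \<Rightarrow> int list set \<Rightarrow> bool" where
  "disconnects d N S \<longleftrightarrow> finite S \<and> S \<subseteq> cylinder d N \<and>
     (\<forall>\<^sub>F M :: int in at_top.
        \<exists>C \<in> components_within (cyl_nbrs N) (cylinder d N - S).
        \<exists>D \<in> components_within (cyl_nbrs N) (cylinder d N - S).
          C \<noteq> D \<and> {x \<in> cylinder d N. M \<le> last x} \<subseteq> C \<and> {x \<in> cylinder d N. last x \<le> - M} \<subseteq> D)"

text \<open>The infimum of the empty set is \<open>\<infinity>\<close>.\<close>

definition disconnection_time :: "nat \<Rightarrow> nat \<Rightarrow> (nat \<Rightarrow> int list) \<Rightarrow> enat" where
  "disconnection_time d N \<omega> = Inf {enat n |n. disconnects d N (\<omega> ` {0..n})}"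

text \<open>The law \<open>P\<^sub>0\<close> of simple random walk on the cylinder started at the origin.\<close>

definition cyl_walk :: "nat \<Rightarrow> nat \<Rightarrow> (nat \<Rightarrow> int list) measure" where
  "cyl_walk d N = srw (cyl_nbrs N) (cyl_origin d)"

text \<open>
  The ratio \<open>N\<^bsup>2d\<^esup> / T\<^sub>N\<close>, with value \<open>0\<close> when \<open>T\<^sub>N = \<infinity>\<close>. For \<open>d \<ge> 1\<close> and \<open>N \<ge> 2\<close> a single point
  does not disconnect the cylinder, so \<open>T\<^sub>N \<ge> 1\<close> on trajectories.
\<close>

definition time_ratio :: "nat \<Rightarrow> nat \<Rightarrow> (nat \<Rightarrow> int list) \<Rightarrow> real" where
  "time_ratio d N \<omega> = (case disconnection_time d N \<omega> of
     enat t \<Rightarrow> real N ^ (2 * d) / real t | \<infinity> \<Rightarrow> 0)"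

end

theory Submission
  imports Defs
begin

text \<open>
  Let \<open>F\<close> be the vertical plane of the cylinder on which the horizontal coordinates
  \<open>1, \<dots>, d - 1\<close> vanish. A set that disconnects the cylinder disconnects \<open>F\<close>. Cut \<open>F\<close> open into the
  strip \<open>{0..<N} \<times> \<int>\<close>. By planar duality (\<open>crossing_or_open_path\<close>) the walk has then visited all
  points of a self-avoiding king path (each step leads to one of the eight surrounding points)
  that crosses the strip, hence of one with \<open>N\<close> points that starts in column \<open>0\<close>. After its first
  step such a path has at most \<open>7\<close> continuations, so up to height \<open>n\<close> there are at most
  \<open>(2 n + 1) * 8 * 7 ^ N\<close> of them. It remains to find \<open>\<theta> > 7\<close> such that a given set \<open>A\<close> of \<open>N\<close>
  points of \<open>F\<close> is covered before time \<open>\<gamma> N\<^bsup>2d\<^esup>\<close> with probability about \<open>\<theta> ^ (- N)\<close>, outside an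
  event of small probability that is the same for all \<open>A\<close>.

  Seen from a point of \<open>A\<close>, the walk returns to \<open>A\<close> within a bounded time with probability at most
  \<open>q\<^sub>0 = 2 / (d + 1) + (1 - 2 / (d + 1)) q(d - 1)\<close>, the probability that simple random walk on
  \<open>\<int>\<^bsup>d+1\<^esup>\<close> returns to a coordinate plane: either the first step stays in the plane, or the \<open>d - 1\<close>
  transversal coordinates perform a walk that has to come back to \<open>0\<close> (\<open>return_to_plane\<close>). Much
  later, when the horizontal position is spread over the torus, a walk at height \<open>z\<close> is in \<open>A\<close> with
  probability of order \<open>N\<^bsup>-d\<^esup> a(z)\<close>, where \<open>a(z)\<close> is the number of points of \<open>A\<close> at height \<open>z\<close>. This
  is compensated if every step at height \<open>z\<close> is discounted by \<open>exp (- C N\<^bsup>-d\<^esup> a(z))\<close> with \<open>C\<close>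
  large: the discounted return probability to \<open>A\<close> is then at most \<open>q\<^sub>0 + \<epsilon>\<close>
  (\<open>return_prob_small\<close>). Since \<open>7 q\<^sub>0 < 1\<close> there is room for \<open>\<theta> > 7\<close> with \<open>\<theta> (q\<^sub>0 + \<epsilon>) < 1\<close>, and a
  geometric series shows that the discounted expectation of \<open>\<theta>\<close> to the number of visits to \<open>A\<close>
  stays bounded (\<open>feynman_kac_reward_bound\<close>). If no height has been visited more than \<open>\<delta> N\<^sup>d\<close>
  times, then the total discount is at least \<open>exp (- C \<delta> N)\<close>, whatever the shape of \<open>A\<close>, so that
  \<open>A\<close> is covered with probability at most a constant times \<open>(exp (C \<delta>) / \<theta>) ^ N\<close>
  (\<open>cover_prob\<close>). For small \<open>\<delta>\<close> this beats the number of paths.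

  The exceptional event is that some height is visited more than \<open>\<delta> N\<^sup>d\<close> times before time
  \<open>\<gamma> N\<^bsup>2d\<^esup>\<close>. An exponential supermartingale compares the local times at two heights, chaining over
  dyadic heights turns this into a bound on the largest local time, and the event has small
  probability when \<open>\<gamma>\<close> is small compared with \<open>\<delta>\<^sup>2\<close> (\<open>max_visits_tight\<close>).

  All estimates concern finite trajectories of the walk on \<open>\<int>\<^bsup>d+1\<^esup>\<close> (points are functions
  \<open>nat \<Rightarrow> int\<close>), of which the walk on the cylinder is a projection (\<open>cyl_walk_prob\<close>), and are proved
  by induction on the number of steps from recursions for Feynman-Kac expectations.
\<close>

section \<open>Planar duality in a vertical strip\<close>

definition king_adj :: "int \<times> int \<Rightarrow> int \<times> int \<Rightarrow> bool" where
  "king_adj p q \<longleftrightarrow> \<bar>fst q - fst p\<bar> \<le> 1 \<and> \<bar>snd q - snd p\<bar> \<le> 1 \<and> p \<noteq> q"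

definition rook_adj :: "int \<times> int \<Rightarrow> int \<times> int \<Rightarrow> bool" where
  "rook_adj p q \<longleftrightarrow> \<bar>fst q - fst p\<bar> + \<bar>snd q - snd p\<bar> = 1"

text \<open>Column \<open>0\<close> and column \<open>N - 1\<close> are neighbours in the plane of the cylinder but not in the strip:
  cutting the plane open removes edges, so a set that separates top from bottom in the plane does
  so in the strip.\<close>

definition strip :: "nat \<Rightarrow> (int \<times> int) set" where
  "strip N = {0..<int N} \<times> UNIV"

definition crossed :: "nat \<Rightarrow> (int \<times> int) set \<Rightarrow> bool" where
  "crossed N S \<longleftrightarrow> (\<exists>p q. fst p = 0 \<and> fst q = int N - 1 \<and> p \<in> S \<inter> strip N \<and>
     (p, q) \<in> {(x, y). king_adj x y \<and> x \<in> S \<inter> strip N \<and> y \<in> S \<inter> strip N}\<^sup>*)"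

text \<open>Rotation by a quarter turn counterclockwise.\<close>

definition turn :: "int \<times> int \<Rightarrow> int \<times> int" where
  "turn e = (- snd e, fst e)"

text \<open>A crack is the unit edge between the cell \<open>p\<close> and the cell \<open>p + e\<close>, recorded as \<open>(p, e)\<close>. It is
  followed in the direction \<open>turn e\<close>, with \<open>p\<close> on the left and \<open>p + e\<close> on the right.\<close>

type_synonym crack = "(int \<times> int) \<times> (int \<times> int)"

text \<open>The boundary of a region \<open>In\<close> is followed so that left cells stay inside and right cells outside.
  At a corner where cells of the region touch only diagonally they count as connected, so left
  cells move by king steps and right cells by rook steps.\<close>

definition crack_next :: "(int \<times> int) set \<Rightarrow> crack \<Rightarrow> crack" where
  "crack_next In s = (let p = fst s; e = snd s; t = turn e in
     if p + e + t \<in> In then (p + e + t, - t)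
     else if p + t \<in> In then (p + t, e)
     else (p, t))"

definition crack_prev :: "(int \<times> int) set \<Rightarrow> crack \<Rightarrow> crack" where
  "crack_prev In s = (let p = fst s; e = snd s; t = turn e in
     if p + e - t \<in> In then (p + e - t, t)
     else if p - t \<in> In then (p - t, e)
     else (p, - t))"

lemma turn_simps [simp]: "turn (turn e) = - e" "turn (- e) = - turn e"
  by (auto simp: turn_def prod_eq_iff)

lemma crack_prev_next:
  assumes "fst s \<in> In" "fst s + snd s \<notin> In"
  shows "crack_prev In (crack_next In s) = s"
proof -
  obtain p e where s: "s = (p, e)" by (cases s)
  show ?thesis
    using assms unfolding s crack_next_def crack_prev_def Let_def
    by (auto simp: algebra_simps)
qed

text \<open>Let \<open>In\<close> consist of everything to the left of the strip and of the closed points that a king path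
  of closed points joins to column \<open>0\<close>. Without a crossing, \<open>In\<close> stays away from the last column,
  and the points outside \<open>In\<close> met along its boundary are open. Follow this boundary upwards from
  far below. The step map has a left inverse, so an orbit that repeats itself returns to its start.
  This one does not: it never goes below height \<open>- M\<close>, whereas its start is preceded by a crack below
  that height. Hence it leaves the finite set of cracks between \<open>- M\<close> and \<open>M\<close>, at the top.\<close>

lemma crossing_or_open_path:
  fixes S :: "(int \<times> int) set" and M :: int
  assumes M: "\<And>p. p \<in> S \<Longrightarrow> \<bar>snd p\<bar> < M" and "N \<ge> 1" and nc: "\<not> crossed N S"
  obtains q where "snd q \<ge> M" "q \<in> strip N - S" "(0, - M) \<in> strip N - S"
    "((0, - M), q) \<in> {(x, y). rook_adj x y \<and> x \<in> strip N - S \<and> y \<in> strip N - S}\<^sup>*"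
proof -
  define R where "R = {(x, y). king_adj x y \<and> x \<in> S \<inter> strip N \<and> y \<in> S \<inter> strip N}"
  define Q where "Q = {(x, y). rook_adj x y \<and> x \<in> strip N - S \<and> y \<in> strip N - S}"
  define L where "L = {q. \<exists>p. fst p = 0 \<and> p \<in> S \<inter> strip N \<and> (p, q) \<in> R\<^sup>*}"
  \<comment> \<open>Everything left of the strip belongs to \<open>In\<close>, so that its boundary far above and far
    below is the left edge of the strip.\<close>
  define In where "In = {p. fst p < 0} \<union> L"
  have LS: "q \<in> S \<inter> strip N" if "q \<in> L" for q
  proof -
    from that obtain p where p: "p \<in> S \<inter> strip N" "(p, q) \<in> R\<^sup>*" by (auto simp: L_def)
    from p(2,1) show ?thesis by (induction) (auto simp: R_def)
  qed
  have Lcol: "fst q \<le> int N - 2" if "q \<in> L" for q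
  proof -
    have "fst q \<noteq> int N - 1" using that nc unfolding L_def crossed_def R_def by blast
    moreover have "fst q < int N" using LS[OF that] by (auto simp: strip_def)
    ultimately show ?thesis by linarith
  qed
  have Incol: "fst q \<le> int N - 2" if "q \<in> In" for q
    using that Lcol \<open>N \<ge> 1\<close> unfolding In_def by (cases "q \<in> L") auto
  have out: "q \<in> strip N - S" if "p \<in> In" "king_adj p q" "q \<notin> In" for p q
  proof -
    have "fst q \<ge> 0" using that(3) by (auto simp: In_def)
    moreover have "fst q \<le> int N - 1" using Incol[OF that(1)] that(2) by (auto simp: king_adj_def)
    ultimately have st: "q \<in> strip N" by (cases q) (auto simp: strip_def)
    have "q \<notin> S"
    proof
      assume "q \<in> S"
      show False
      proof (cases "fst p < 0")
        case True
        then have "fst q = 0" using \<open>fst q \<ge> 0\<close> that(2) by (auto simp: king_adj_def)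
        then have "q \<in> L" using st \<open>q \<in> S\<close> unfolding L_def by blast
        then show False using that(3) by (auto simp: In_def)
      next
        case False
        then have "p \<in> L" using that(1) by (auto simp: In_def)
        moreover from this have "(p, q) \<in> R" using LS \<open>q \<in> S\<close> st that(2) by (auto simp: R_def)
        ultimately have "q \<in> L" unfolding L_def by (auto intro: rtrancl_into_rtrancl)
        then show False using that(3) by (auto simp: In_def)
      qed
    qed
    with st show ?thesis by blast
  qed
  define dirs :: "(int \<times> int) set" where "dirs = {(1,0),(0,1),(-1,0),(0,-1)}"
  define f where "f = crack_next In"
  define s0 :: crack where "s0 = ((-1, - M), (1, 0))"
  \<comment> \<open>The right cell of the crack is reached from below by an open path.\<close>
  define inv where "inv s \<longleftrightarrow> snd s \<in> dirs \<and> fst s \<in> In \<and> fst s + snd s \<notin> In \<and>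
     snd (fst s) \<ge> - M \<and> snd (fst s + snd s) \<ge> - M \<and> ((0, - M), fst s + snd s) \<in> Q\<^sup>*" for s :: crack
  have far: "p \<notin> In" if "fst p \<ge> 0" "\<bar>snd p\<bar> \<ge> M" for p
    using that LS[of p] M[of p] by (auto simp: In_def)
  have inv0: "inv s0"
    using far[of "(0, -M)"] by (auto simp: inv_def s0_def dirs_def In_def)
  have king: "king_adj p (p + e)" "king_adj p (p + turn e)" "king_adj p (p + e + turn e)"
    if "e \<in> dirs" for p e
    using that by (auto simp: dirs_def king_adj_def turn_def prod_eq_iff)
  have rook: "rook_adj (p + e) (p + e + turn e)" "rook_adj (p + e + turn e) (p + turn e)"
    if "e \<in> dirs" for p e
    using that by (auto simp: dirs_def rook_adj_def turn_def)
  have step: "inv (f s)" if "inv s" for s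
  proof -
    obtain p e where s: "s = (p, e)" by (cases s)
    have i: "e \<in> dirs" "p \<in> In" "p + e \<notin> In" "snd p \<ge> - M" "snd (p + e) \<ge> - M"
      "((0, - M), p + e) \<in> Q\<^sup>*"
      using that by (auto simp: inv_def s)
    have te: "turn e \<in> dirs" "- turn e \<in> dirs" using i(1) by (auto simp: dirs_def turn_def)
    have rows: "snd (p + turn e) \<ge> - M \<and> snd (p + e + turn e) \<ge> - M"
    proof (cases "e = (-1, 0)")
      case True
      have "fst (p + e) \<ge> 0" using i(3) by (auto simp: In_def)
      then have "p \<in> L" using i(2) True by (auto simp: In_def)
      then have "snd p > - M" using LS M[of p] by fastforce
      then show ?thesis by (simp add: True turn_def)
    next
      case False
      then show ?thesis using i(1,4,5) by (auto simp: dirs_def turn_def)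
    qed
    have o1: "p + e \<in> strip N - S" using out[OF i(2) king(1)[OF i(1)] i(3)] .
    show ?thesis
    proof (cases "p + e + turn e \<in> In")
      case True
      then have fs: "f s = (p + e + turn e, - turn e)" by (simp add: f_def crack_next_def Let_def s)
      show ?thesis using True i te rows unfolding inv_def fs by (simp del: snd_add)
    next
      case q: False
      have o2: "p + e + turn e \<in> strip N - S" using out[OF i(2) king(3)[OF i(1)] q] .
      have "(p + e, p + e + turn e) \<in> Q" using o1 o2 rook(1)[OF i(1)] by (auto simp: Q_def)
      then have r2: "((0, - M), p + e + turn e) \<in> Q\<^sup>*" using i(6) by (rule rtrancl_into_rtrancl[rotated])
      show ?thesis
      proof (cases "p + turn e \<in> In")
        case True
        then have fs: "f s = (p + turn e, e)" using q by (simp add: f_def crack_next_def Let_def s)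
        have eq: "p + turn e + e = p + e + turn e" by simp
        show ?thesis using True q i te rows r2 unfolding inv_def fs fst_conv snd_conv eq by blast
      next
        case False
        then have fs: "f s = (p, turn e)" using q by (simp add: f_def crack_next_def Let_def s)
        have o3: "p + turn e \<in> strip N - S" using out[OF i(2) king(2)[OF i(1)] False] .
        have "(p + e + turn e, p + turn e) \<in> Q" using o2 o3 rook(2)[OF i(1)] by (auto simp: Q_def)
        then have r3: "((0, - M), p + turn e) \<in> Q\<^sup>*" using r2 by (rule rtrancl_into_rtrancl[rotated])
        show ?thesis using False i te rows r3 unfolding inv_def fs fst_conv snd_conv by blast
      qed
    qed
  qed
  have orbit: "inv ((f ^^ k) s0)" for k by (induction k) (auto simp: inv0 step)
  have "\<exists>k. snd (fst ((f ^^ k) s0) + snd ((f ^^ k) s0)) \<ge> M"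
  proof (rule ccontr)
    assume a: "\<not> ?thesis"
    define B :: "crack set" where "B = ({-1..int N} \<times> {-M..M}) \<times> dirs"
    have finB: "finite B" by (auto simp: B_def dirs_def)
    have inB: "(f ^^ k) s0 \<in> B" for k
    proof -
      obtain p e where s: "(f ^^ k) s0 = (p, e)" by (rule prod.exhaust)
      have i: "e \<in> dirs" "p \<in> In" "p + e \<notin> In" "snd p \<ge> - M" using orbit[of k] by (auto simp: inv_def s)
      have "\<not> snd (fst ((f ^^ k) s0) + snd ((f ^^ k) s0)) \<ge> M" using a by blast
      then have "snd (p + e) < M" unfolding s by simp
      then have "snd p \<le> M" using i(1) by (auto simp: dirs_def)
      moreover have "fst (p + e) \<ge> 0" using i(3) by (auto simp: In_def)
      then have "fst p \<ge> -1" using i(1) by (auto simp: dirs_def)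
      moreover have "fst p \<le> int N" using Incol[OF i(2)] by simp
      ultimately show ?thesis unfolding s B_def using i by (cases p) auto
    qed
    have "\<not> inj (\<lambda>k. (f ^^ k) s0)"
      using finB inB finite_subset[of "range (\<lambda>k. (f ^^ k) s0)" B] range_inj_infinite by blast
    then obtain i j where ij: "i < j" "(f ^^ i) s0 = (f ^^ j) s0"
      unfolding inj_def by (metis linorder_neqE_nat)
    have "(f ^^ (i - l)) s0 = (f ^^ (j - l)) s0" if "l \<le> i" for l
      using that
    proof (induction l)
      case 0
      then show ?case using ij by simp
    next
      case (Suc l)
      have "i - l = Suc (i - Suc l)" "j - l = Suc (j - Suc l)" using Suc ij by auto
      then have "f ((f ^^ (i - Suc l)) s0) = f ((f ^^ (j - Suc l)) s0)" using Suc by simp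
      then have "crack_prev In (f ((f ^^ (i - Suc l)) s0)) = crack_prev In (f ((f ^^ (j - Suc l)) s0))" by simp
      then show ?case
        using crack_prev_next[of _ In] orbit[unfolded inv_def] unfolding f_def by metis
    qed
    from this[of i] have "s0 = (f ^^ (j - i)) s0" by simp
    also have "\<dots> = f ((f ^^ (j - i - 1)) s0)" using ij by (cases "j - i") auto
    finally have "crack_prev In s0 = (f ^^ (j - i - 1)) s0"
      using crack_prev_next[of _ In] orbit[unfolded inv_def] unfolding f_def by metis
    \<comment> \<open>On a periodic orbit the start would have a predecessor above height \<open>- M\<close>, but the
      predecessor is the crack just below it.\<close>
    moreover have "crack_prev In s0 = ((-1, - M - 1), (1, 0))"
      using far[of "(0, - M - 1)"] M by (auto simp: crack_prev_def s0_def turn_def In_def)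
    ultimately have e: "(f ^^ (j - i - 1)) s0 = ((-1, - M - 1), (1, 0))" by simp
    show False using orbit[of "j - i - 1"] unfolding e by (simp add: inv_def)
  qed
  then obtain k where k: "snd (fst ((f ^^ k) s0) + snd ((f ^^ k) s0)) \<ge> M" by blast
  obtain p e where s: "(f ^^ k) s0 = (p, e)" by (rule prod.exhaust)
  have i: "e \<in> dirs" "p \<in> In" "p + e \<notin> In" "((0, - M), p + e) \<in> Q\<^sup>*" using orbit[of k] by (auto simp: inv_def s)
  have "p + e \<in> strip N - S" using out[OF i(2) king(1)[OF i(1)] i(3)] .
  moreover have "(0, - M) \<in> strip N - S" using \<open>N \<ge> 1\<close> M[of "(0, -M)"] by (auto simp: strip_def)
  ultimately show thesis using that[of "p + e"] k i(4) s unfolding Q_def by simp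
qed

text \<open>Loops are erased one by one; paths are listed from their end to their start.\<close>

lemma simple_path_of_rtrancl:
  assumes "(p, q) \<in> {(x, y). r x y \<and> x \<in> S \<and> y \<in> S}\<^sup>*" "p \<in> S"
  shows "\<exists>xs. xs \<noteq> [] \<and> hd xs = q \<and> last xs = p \<and> distinct xs \<and> set xs \<subseteq> S \<and> successively (\<lambda>a b. r b a) xs"
  using assms
proof (induction rule: rtrancl_induct)
  case base
  then show ?case by (intro exI[of _ "[p]"]) auto
next
  case (step y z)
  then obtain xs where xs: "xs \<noteq> []" "hd xs = y" "last xs = p" "distinct xs" "set xs \<subseteq> S" "successively (\<lambda>a b. r b a) xs" by blast
  show ?case
  proof (cases "z \<in> set xs")
    case True
    then obtain as bs where "xs = as @ z # bs" by (meson split_list)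
    then show ?thesis using xs by (intro exI[of _ "z # bs"]) (auto simp: successively_append_iff)
  next
    case False
    then show ?thesis using xs step by (intro exI[of _ "z # xs"]) (auto simp: successively_Cons)
  qed
qed

lemma king_path_columns:
  assumes "successively (\<lambda>a b. king_adj b a) xs" "xs \<noteq> []"
  shows "\<bar>fst (hd xs) - fst (last xs)\<bar> < int (length xs)"
  using assms
proof (induction xs)
  case (Cons x xs)
  show ?case
  proof (cases "xs = []")
    case False
    then have "king_adj (hd xs) x" "\<bar>fst (hd xs) - fst (last xs)\<bar> < int (length xs)" 
      using Cons by (auto simp: successively_Cons)
    then show ?thesis using False by (auto simp: king_adj_def)
  qed simp
qed simp

definition king_paths :: "nat \<Rightarrow> nat \<Rightarrow> (int \<times> int) list set" where
  "king_paths N n = {xs. length xs = N \<and> distinct xs \<and> set xs \<subseteq> strip N \<and> successively king_adj xs \<and> xs \<noteq> [] \<and>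
     fst (last xs) = 0 \<and> \<bar>snd (last xs)\<bar> \<le> int n}"

text \<open>A crossing moves by at most one column per step, so after loop erasure it still has \<open>N\<close> points. Its
  first \<open>N\<close> points are kept, which fixes the length of the paths that have to be counted.\<close>

lemma king_path_of_crossed:
  assumes "crossed N S" "\<And>p. p \<in> S \<Longrightarrow> \<bar>snd p\<bar> \<le> int n"  "N \<ge> 1"
  shows "\<exists>xs \<in> king_paths N n. set xs \<subseteq> S"
proof -
  obtain p q where pq: "fst p = 0" "fst q = int N - 1" "p \<in> S \<inter> strip N"
     "(p, q) \<in> {(x, y). king_adj x y \<and> x \<in> S \<inter> strip N \<and> y \<in> S \<inter> strip N}\<^sup>*"
    using assms(1) unfolding crossed_def by blast
  obtain xs where xs: "xs \<noteq> []" "hd xs = q" "last xs = p" "distinct xs" "set xs \<subseteq> S \<inter> strip N"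
     "successively (\<lambda>a b. king_adj b a) xs"
    using simple_path_of_rtrancl[OF pq(4,3)] by blast
  have len: "length xs \<ge> N" using king_path_columns[OF xs(6,1)] xs pq by auto
  \<comment> \<open>The list runs backwards, so its last entries are the first points of the crossing.\<close>
  define ys where "ys = drop (length xs - N) xs"
  have ys: "length ys = N" "ys \<noteq> []" "last ys = p" "distinct ys" "set ys \<subseteq> S \<inter> strip N"
    using len assms(3) xs set_drop_subset[of "length xs - N" xs] by (auto simp: ys_def)
  have "xs = take (length xs - N) xs @ ys" by (simp add: ys_def)
  then have "successively (\<lambda>a b. king_adj b a) ys" using xs(6) by (metis successively_append_iff)
  then have "successively king_adj ys" by (rule successively_mono) (auto simp: king_adj_def)
  then show ?thesis using ys pq assms(2)[of p] by (intro bexI[of _ ys]) (auto simp: king_paths_def)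
qed

lemma king_ngh: "{q. king_adj p q} = (\<lambda>e. p + e) ` ({-1,0,1} \<times> {-1,0,1} - {(0,0)})"
proof -
  have "q \<in> (\<lambda>e. p + e) ` ({-1,0,1} \<times> {-1,0,1} - {(0,0)})" if "king_adj p q" for q
  proof -
    obtain a b c d where pq: "p = (a, b)" "q = (c, d)" by (cases p, cases q)
    have "c - a \<in> {-1,0,1}" "d - b \<in> {-1,0,1}" "(c - a, d - b) \<noteq> (0, 0)"
      using that by (auto simp: king_adj_def pq)
    then show ?thesis unfolding pq by (intro image_eqI[of _ _ "(c - a, d - b)"]) auto
  qed
  then show ?thesis by (auto simp: king_adj_def)
qed

lemma card_king: "finite {q. king_adj p q}" "card {q. king_adj p q} = 8"
proof -
  show "finite {q. king_adj p q}" unfolding king_ngh by simp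
  have "card {q. king_adj p q} = card ({-1,0,1::int} \<times> {-1,0,1::int} - {(0,0)})"
    unfolding king_ngh by (rule card_image) (auto simp: inj_on_def)
  also have "\<dots> = 8" by (simp add: card_Diff_singleton)
  finally show "card {q. king_adj p q} = 8" .
qed

text \<open>Without the restriction to the strip, paths can be extended by one point at their head, which is
  what the counting argument needs.\<close>

definition king_walks :: "nat \<Rightarrow> nat \<Rightarrow> (int \<times> int) list set" where
  "king_walks n k = {xs. length xs = Suc k \<and> distinct xs \<and> successively king_adj xs \<and>
     fst (last xs) = 0 \<and> \<bar>snd (last xs)\<bar> \<le> int n}"

text \<open>The first step has \<open>8\<close> directions. Every later one has at most \<open>7\<close>, because the previous point is
  among the \<open>8\<close> surrounding points and must not be visited again.\<close>

lemma card_king_walks: "finite (king_walks n k) \<and> card (king_walks n k) \<le> (2 * n + 1) * 8 ^ (if k = 0 then 0 else 1) * 7 ^ (k - 1)"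
proof (induction k)
  case 0
  have "xs \<in> (\<lambda>y. [(0,y)]) ` {- int n..int n}" if "xs \<in> king_walks n 0" for xs
  proof -
    have "length xs = Suc 0" using that by (simp add: king_walks_def)
    then obtain a where a: "xs = [a]" by (metis length_0_conv length_Suc_conv)
    have "fst a = 0 \<and> \<bar>snd a\<bar> \<le> int n" using that unfolding a king_walks_def by simp
    then show ?thesis unfolding a by (intro image_eqI[of _ _ "snd a"]) (auto simp: prod_eq_iff)
  qed
  moreover have "(\<lambda>y. [(0,y)]) ` {- int n..int n} \<subseteq> king_walks n 0" unfolding king_walks_def by auto
  ultimately have "king_walks n 0 = (\<lambda>y. [(0,y)]) ` {- int n..int n}" by blast
  moreover have "card ((\<lambda>y. [(0::int,y)]) ` {- int n..int n}) = 2 * n + 1"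
    by (subst card_image) (auto simp: inj_on_def)
  ultimately show ?case by simp
next
  case (Suc k)
  define c :: nat where "c = (if k = 0 then 8 else 7)"
  define Nx where "Nx xs = {q. king_adj q (hd xs) \<and> q \<notin> set xs}" for xs :: "(int\<times>int) list"
  have ks: "king_adj p q = king_adj q p" for p q by (auto simp: king_adj_def)
  have fin: "finite (Nx xs)" for xs
    using card_king(1)[of "hd xs"] by (rule rev_finite_subset) (auto simp: Nx_def ks)
  have cNx: "card (Nx xs) \<le> c" if xs: "xs \<in> king_walks n k" for xs
  proof (cases "k = 0")
    case True
    have "card (Nx xs) \<le> card {q. king_adj (hd xs) q}"
      using card_king(1) by (rule card_mono) (auto simp: Nx_def ks)
    then show ?thesis using True card_king(2) by (simp add: c_def)
  next
    case False
    then obtain k' where k': "k = Suc k'" using not0_implies_Suc by blast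
    have "length xs = Suc (Suc k')" using xs by (simp add: king_walks_def k')
    then obtain a ys where a: "xs = a # ys" "length ys = Suc k'" by (auto simp: length_Suc_conv)
    then obtain b zs where x: "xs = a # b # zs" by (auto simp: length_Suc_conv)
    have ab: "king_adj a b" using xs unfolding king_walks_def x by simp
    have "card (Nx xs) \<le> card ({q. king_adj a q} - {b})"
      using card_king(1)[of a] by (intro card_mono) (auto simp: Nx_def ks x)
    also have "\<dots> = 7" using card_king[of a] ab by (simp add: card_Diff_singleton)
    finally show ?thesis using False by (simp add: c_def)
  qed
  have sub: "king_walks n (Suc k) \<subseteq> (\<lambda>(xs, q). q # xs) ` (SIGMA xs:king_walks n k. Nx xs)"
  proof
    fix ys assume ys: "ys \<in> king_walks n (Suc k)"
    then have "length ys = Suc (Suc k)" by (simp add: king_walks_def)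
    then obtain q xs where y: "ys = q # xs" "length xs = Suc k" by (metis length_Suc_conv)
    then have "xs \<noteq> []" by auto
    then show "ys \<in> (\<lambda>(xs, q). q # xs) ` (SIGMA xs:king_walks n k. Nx xs)"
      using ys y unfolding king_walks_def Nx_def by (intro image_eqI[of _ _ "(xs, q)"]) (auto simp: successively_Cons)
  qed
  have f2: "finite (SIGMA xs:king_walks n k. Nx xs)" using Suc fin by auto
  have "card (king_walks n (Suc k)) \<le> card (SIGMA xs:king_walks n k. Nx xs)"
    using surj_card_le[OF f2 sub] .
  also have "\<dots> = (\<Sum>xs\<in>king_walks n k. card (Nx xs))" using Suc fin by (subst card_SigmaI) auto
  also have "\<dots> \<le> card (king_walks n k) * c" using sum_bounded_above[of "king_walks n k" "\<lambda>xs. card (Nx xs)" c] cNx by simp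
  also have "\<dots> \<le> (2 * n + 1) * 8 ^ (if k = 0 then 0 else 1) * 7 ^ (k - 1) * c" using Suc by simp
  also have "\<dots> = (2 * n + 1) * 8 ^ (if Suc k = 0 then 0 else 1) * 7 ^ (Suc k - 1)"
    by (cases k) (auto simp: c_def)
  finally show ?case using finite_subset[OF sub] f2 by blast
qed

lemma card_king_paths:
  assumes "N \<ge> 1"
  shows "finite (king_paths N n)" "card (king_paths N n) \<le> (2 * n + 1) * 8 * 7 ^ N"
proof -
  obtain k where k: "N = Suc k" using assms by (cases N) auto
  have sub: "king_paths N n \<subseteq> king_walks n k" by (auto simp: king_paths_def king_walks_def k)
  show "finite (king_paths N n)" using finite_subset[OF sub] card_king_walks[of n k] by blast
  have "card (king_paths N n) \<le> card (king_walks n k)" using card_king_walks[of n k] by (intro card_mono sub) blast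
  also have "\<dots> \<le> (2 * n + 1) * 8 ^ (if k = 0 then 0 else 1) * 7 ^ (k - 1)" using card_king_walks[of n k] by blast
  also have "\<dots> \<le> (2 * n + 1) * 8 * 7 ^ N" unfolding k by (intro mult_mono power_increasing) auto
  finally show "card (king_paths N n) \<le> (2 * n + 1) * 8 * 7 ^ N" .
qed

section \<open>Heat kernel of the cycle\<close>

text \<open>The probability that simple random walk on \<open>\<int>\<close> started at \<open>j\<close> is at a multiple of \<open>N\<close> after \<open>n\<close>
  steps, i.e. the transition probability from \<open>j\<close> to \<open>0\<close> on \<open>\<int>/N\<int>\<close>.\<close>

primrec cycle_kernel :: "nat \<Rightarrow> nat \<Rightarrow> int \<Rightarrow> real" where
  "cycle_kernel N 0 j = (if int N dvd j then 1 else 0)"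
| "cycle_kernel N (Suc n) j = (cycle_kernel N n (j + 1) + cycle_kernel N n (j - 1)) / 2"

lemma cycle_kernel_nonneg: "0 \<le> cycle_kernel N n j" by (induction n arbitrary: j) auto
lemma cycle_kernel_le_1: "cycle_kernel N n j \<le> 1"
proof (induction n arbitrary: j)
  case (Suc n)
  show ?case using Suc[of "j+1"] Suc[of "j-1"] by simp
qed auto

lemma cycle_kernel_binomial:
  "cycle_kernel N n j = (\<Sum>i\<le>n. real (n choose i) * (if int N dvd j + 2 * int i - int n then 1 else 0)) / 2 ^ n"
proof (induction n arbitrary: j)
  case (Suc n)
  define c where "c i = (if int N dvd j + 2 * int i - int (Suc n) then 1 else 0 :: real)" for i
  have a: "(if int N dvd (j - 1) + 2 * int i - int n then 1 else 0) = c i" for i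
    unfolding c_def by (simp add: algebra_simps)
  have b: "(if int N dvd (j + 1) + 2 * int i - int n then 1 else 0) = c (Suc i)" for i
    unfolding c_def by (simp add: algebra_simps)
  have "cycle_kernel N (Suc n) j = ((\<Sum>i\<le>n. real (n choose i) * c (Suc i)) + (\<Sum>i\<le>n. real (n choose i) * c i)) / 2 ^ Suc n"
    unfolding cycle_kernel.simps Suc a b by (simp add: add_divide_distrib)
  also have "(\<Sum>i\<le>n. real (n choose i) * c i) = real (n choose 0) * c 0 + (\<Sum>i\<le>n. real (n choose Suc i) * c (Suc i))"
    using sum.atMost_Suc_shift[of "\<lambda>i. real (n choose i) * c i" n] by (simp add: binomial_eq_0)
  also have "(\<Sum>i\<le>n. real (n choose i) * c (Suc i)) + (real (n choose 0) * c 0 + (\<Sum>i\<le>n. real (n choose Suc i) * c (Suc i)))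
    = (\<Sum>i\<le>Suc n. real (Suc n choose i) * c i)"
    unfolding sum.atMost_Suc_shift by (simp add: sum.distrib algebra_simps)
  finally show ?case unfolding c_def .
qed simp

text \<open>For a weight that increases up to \<open>m\<close>, the value at \<open>i\<close> is at most the average over the window of
  length \<open>g\<close> starting at \<open>i\<close>. The windows of separated indices are disjoint, and at most one of them
  reaches beyond \<open>m\<close>.\<close>

lemma sum_sparse_mono:
  fixes b :: "nat \<Rightarrow> real"
  assumes b: "\<And>i. 0 \<le> b i" and mono: "\<And>i j. i \<le> j \<Longrightarrow> j \<le> m \<Longrightarrow> b i \<le> b j"
    and I: "I \<subseteq> {..m}" and g: "g \<ge> 1" and sep: "\<And>i j. i \<in> I \<Longrightarrow> j \<in> I \<Longrightarrow> i < j \<Longrightarrow> i + g \<le> j"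
  shows "real g * sum b I \<le> real g * b m + (\<Sum>i\<le>m. b i)"
proof -
  have fin: "finite I" using I finite_subset by blast
  define J where "J = {i \<in> I. i + g \<le> m}"
  have card: "card (I - J) \<le> 1"
  proof -
    have "i = j" if "i \<in> I - J" "j \<in> I - J" for i j
      using that sep[of i j] sep[of j i] I by (cases i j rule: linorder_cases) (auto simp: J_def subset_iff)
    then show ?thesis using fin by (simp add: card_le_Suc0_iff_eq)
  qed
  have "sum b (I - J) \<le> real (card (I - J)) * b m"
    using I mono by (intro sum_bounded_above) auto
  also have "\<dots> \<le> b m" using card b[of m] by (intro mult_left_le_one_le) auto
  finally have 1: "sum b (I - J) \<le> b m" .
  have disj: "disjoint_family_on (\<lambda>i. {i..<i+g}) J"
  proof (unfold disjoint_family_on_def, intro ballI impI)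
    fix i j assume "i \<in> J" "j \<in> J" "i \<noteq> j"
    then show "{i..<i+g} \<inter> {j..<j+g} = {}"
      using sep[of i j] sep[of j i] by (cases i j rule: linorder_cases) (auto simp: J_def)
  qed
  have "real g * sum b J = (\<Sum>i\<in>J. \<Sum>l\<in>{i..<i+g}. b i)" by (simp add: sum_distrib_left)
  also have "\<dots> \<le> (\<Sum>i\<in>J. \<Sum>l\<in>{i..<i+g}. b l)"
    by (intro sum_mono mono) (auto simp: J_def)
  also have "\<dots> = sum b (\<Union>i\<in>J. {i..<i+g})"
    using disj fin by (subst sum.UNION_disjoint_family) (auto simp: J_def)
  also have "\<dots> \<le> sum b {..m}" using b by (intro sum_mono2) (auto simp: J_def)
  finally have 2: "real g * sum b J \<le> sum b {..m}" .
  have "sum b I = sum b J + sum b (I - J)"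
    using fin sum.subset_diff[of J I b] by (auto simp: J_def)
  then show ?thesis using 1 2 mult_left_mono[OF 1, of "real g"] by (simp add: distrib_left)
qed

text \<open>Binomial coefficients are unimodal: the monotone case applies to both halves of the row.\<close>

lemma sum_sparse_binomial:
  assumes I: "I \<subseteq> {..n}" and g: "g \<ge> 1" and sep: "\<And>i j. i \<in> I \<Longrightarrow> j \<in> I \<Longrightarrow> i < j \<Longrightarrow> i + g \<le> j"
  shows "(\<Sum>i\<in>I. real (n choose i)) \<le> 2 * real (n choose (n div 2)) + 2 * 2 ^ n / real g"
proof -
  define m where "m = n div 2"
  define b where "b i = real (n choose i)" for i
  have fin: "finite I" using I finite_subset by blast
  have tot: "(\<Sum>i\<le>k. b i) \<le> 2 ^ n" for k
  proof -
    have "(\<Sum>i\<le>k. n choose i) \<le> (\<Sum>i\<le>max k n. n choose i)" by (intro sum_mono2) auto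
    also have "\<dots> = (\<Sum>i\<le>n. n choose i)" by (intro sum.mono_neutral_right) auto
    also have "\<dots> = 2 ^ n" using choose_row_sum by simp
    finally show ?thesis unfolding b_def by (simp flip: of_nat_sum add: of_nat_le_numeral_power_cancel_iff)
  qed
  define I1 where "I1 = I \<inter> {..m}"
  define I2 where "I2 = I - {..m}"
  have mono: "b i \<le> b j" if "i \<le> j" "j \<le> m" for i j
    using that binomial_mono[of i j n] by (simp add: b_def m_def)
  have A: "real g * sum b I1 \<le> real g * b m + 2 ^ n"
  proof -
    have "real g * sum b I1 \<le> real g * b m + (\<Sum>i\<le>m. b i)"
      by (rule sum_sparse_mono) (use mono g sep in \<open>auto simp: I1_def b_def\<close>)
    then show ?thesis using tot[of m] by linarith
  qed
  define I2' where "I2' = (\<lambda>i. n - i) ` I2"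
  have inj: "inj_on (\<lambda>i. n - i) I2" 
  proof (rule inj_onI)
    fix x y assume "x \<in> I2" "y \<in> I2" "n - x = n - y"
    moreover from this have "x \<le> n" "y \<le> n" using I by (auto simp: I2_def)
    ultimately show "x = y" by linarith
  qed
  have sep2: "i + g \<le> j" if ij: "i \<in> I2'" "j \<in> I2'" "i < j" for i j
  proof -
    obtain a where a: "i = n - a" "a \<in> I2" using ij(1) unfolding I2'_def by blast
    obtain c where c: "j = n - c" "c \<in> I2" using ij(2) unfolding I2'_def by blast
    have ac: "i = n - a" "j = n - c" "a \<in> I" "c \<in> I" using a c by (auto simp: I2_def)
    then have "a \<le> n" "c \<le> n" using I by auto
    have "c < a" using ij(3) ac \<open>a \<le> n\<close> \<open>c \<le> n\<close> by linarith
    with sep[of c a] ac have "c + g \<le> a" by blast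
    then show ?thesis using ac \<open>a \<le> n\<close> \<open>c \<le> n\<close> by linarith
  qed
  have sub2: "I2' \<subseteq> {..m}" using I by (auto simp: I2'_def I2_def m_def subset_iff)
  have "sum b I2' = (\<Sum>i\<in>I2. b (n - i))" unfolding I2'_def by (subst sum.reindex[OF inj]) simp
  also have "\<dots> = sum b I2" 
  proof (rule sum.cong)
    fix i assume "i \<in> I2"
    then have "i \<le> n" using I by (auto simp: I2_def)
    then show "b (n - i) = b i" using binomial_symmetric[of i n] by (simp add: b_def)
  qed simp
  finally have s2: "sum b I2' = sum b I2" .
  have B: "real g * sum b I2 \<le> real g * b m + 2 ^ n"
  proof -
    have "real g * sum b I2' \<le> real g * b m + (\<Sum>i\<le>m. b i)"
      by (rule sum_sparse_mono[OF _ mono sub2 g sep2]) (auto simp: b_def)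
    then show ?thesis using tot[of m] unfolding s2 by linarith
  qed
  have "sum b I = sum b I1 + sum b I2"
    unfolding I1_def I2_def using fin by (metis sum.Int_Diff)
  then have "real g * sum b I \<le> 2 * real g * b m + 2 * 2 ^ n" using A B by (simp add: distrib_left)
  then show ?thesis using g unfolding b_def m_def by (simp add: field_simps)
qed

text \<open>The square of the left side times \<open>2 m + 1\<close> is decreasing in \<open>m\<close>.\<close>

lemma central_binomial_even: "real ((2 * m) choose m) / 4 ^ m \<le> 1 / sqrt (real (2 * m + 1))"
proof -
  have "(real ((2 * m) choose m) / 4 ^ m)\<^sup>2 * real (2 * m + 1) \<le> 1"
  proof (induction m)
    case (Suc m)
    have e: "real ((2 * Suc m) choose Suc m) * real (Suc m) = real ((2 * m) choose m) * (2 * real (2 * m + 1))"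
    proof -
      have "Suc m * ((2 * Suc m) choose Suc m) = (2 * Suc m) * (Suc (2 * m) choose m)"
        using Suc_times_binomial_eq[of "Suc (2 * m)" m] by (simp add: mult.commute)
      moreover have "Suc m * (Suc (2 * m) choose m) = Suc (2 * m) * ((2 * m) choose m)"
        using Suc_times_binomial_eq[of "2*m" m] binomial_symmetric[of m "Suc (2 * m)"] by (simp add: Suc_diff_le mult.commute)
      ultimately have "Suc m * (Suc m * ((2 * Suc m) choose Suc m)) = Suc m * (2 * (Suc (2 * m) * ((2 * m) choose m)))"
        by (metis mult.assoc mult.commute)
      then have "Suc m * ((2 * Suc m) choose Suc m) = 2 * (Suc (2 * m) * ((2 * m) choose m))" by (simp only: mult_cancel1) simp
      then have "real (Suc m * ((2 * Suc m) choose Suc m)) = real (2 * (Suc (2 * m) * ((2 * m) choose m)))" by (simp only:)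
      then show ?thesis unfolding of_nat_mult by (simp add: algebra_simps del: binomial_Suc_Suc mult_Suc_right)
    qed
    define a where "a = real ((2 * m) choose m) / 4 ^ m"
    define u where "u = real ((2 * Suc m) choose Suc m)"
    define v where "v = real ((2 * m) choose m)"
    define x where "x = real m"
    have x0: "0 \<le> x" by (simp add: x_def)
    have "u * (x + 1) = v * (2 * (2 * x + 1))"
      using e unfolding x_def u_def v_def by (simp only: of_nat_Suc of_nat_mult of_nat_add of_nat_numeral of_nat_1)
        (simp only: algebra_simps)
    then have "u = 4 * (v * ((2 * x + 1) / (2 * (x + 1))))"
      using x0 by (simp add: field_simps)
    then have "u / 4 ^ Suc m = a * ((2 * x + 1) / (2 * (x + 1)))"
      unfolding a_def v_def[symmetric] by simp
    then have "(u / 4 ^ Suc m)\<^sup>2 * real (2 * Suc m + 1) = (a * ((2 * x + 1) / (2 * (x + 1))))\<^sup>2 * (2 * x + 3)"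
      by (simp add: x_def algebra_simps)
    also have "\<dots> = a\<^sup>2 * real (2 * m + 1) * ((2 * x + 1) * (2 * x + 3) / (2 * (x + 1))\<^sup>2)"
      unfolding x_def by (simp add: power_mult_distrib power_divide power2_eq_square)
    also have "\<dots> \<le> 1 * 1"
    proof (rule mult_mono)
      show "(2 * x + 1) * (2 * x + 3) / (2 * (x + 1))\<^sup>2 \<le> 1"
      proof -
        have "(2 * x + 1) * (2 * x + 3) \<le> (2 * (x + 1))\<^sup>2" by (simp add: power2_eq_square algebra_simps)
        moreover have "0 < (2 * (x + 1))\<^sup>2" using x0 by simp
        ultimately show ?thesis by simp
      qed
    qed (use Suc a_def x0 in auto)
    finally show ?case unfolding u_def by simp
  qed simp
  then have "(real ((2 * m) choose m) / 4 ^ m)\<^sup>2 \<le> (1 / sqrt (real (2 * m + 1)))\<^sup>2"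
    by (simp add: power_divide field_simps)
  then show ?thesis by (rule power2_le_imp_le) simp
qed

lemma central_binomial_bound: "n \<ge> 1 \<Longrightarrow> real (n choose (n div 2)) / 2 ^ n \<le> 1 / sqrt (real n)"
proof -
  assume n: "n \<ge> 1"
  show ?thesis
  proof (cases "even n")
    case True
    then obtain m where m: "n = 2 * m" by blast
    have "real (n choose (n div 2)) / 2 ^ n \<le> 1 / sqrt (real (2 * m + 1))"
      using central_binomial_even[of m] by (simp add: m power_mult)
    also have "\<dots> \<le> 1 / sqrt (real n)" using n by (intro divide_left_mono) (auto simp: m)
    finally show ?thesis .
  next
    case False
    then obtain m where m: "n = 2 * m + 1" by (rule oddE)
    have "2 * (n choose m) = (2 * Suc m) choose (Suc m)"
    proof -
      have "(2 * m + 1) choose (Suc m) = (2 * m + 1) choose m" using binomial_symmetric[of m "2*m+1"] by simp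
      then show ?thesis by (simp add: m)
    qed
    then have "real (n choose m) / 2 ^ n = real ((2 * Suc m) choose (Suc m)) / 4 ^ Suc m"
    proof -
      assume "2 * (n choose m) = (2 * Suc m) choose (Suc m)"
      then have "real ((2 * Suc m) choose (Suc m)) = real (2 * (n choose m))" by (simp only:)
      moreover have "(2::real) ^ n = 2 * 4 ^ m" by (simp add: m power_mult)
      ultimately show ?thesis by simp
    qed
    also have "\<dots> \<le> 1 / sqrt (real (2 * Suc m + 1))" by (rule central_binomial_even)
    also have "\<dots> \<le> 1 / sqrt (real n)" by (intro divide_left_mono) (auto simp: m)
    finally show ?thesis by (simp add: m)
  qed
qed

text \<open>The number of up-steps of a path from \<open>j\<close> to a multiple of \<open>N\<close> lies in a set with gaps at least
  \<open>N / 2\<close> (not \<open>N\<close>, since an up-step changes the end point by \<open>2\<close> relative to a down-step).\<close>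

lemma cycle_kernel_bound:
  assumes n: "n \<ge> 1" and N: "N \<ge> 1"
  shows "cycle_kernel N n j \<le> 4 * (1 / sqrt (real n) + 1 / real N)"
proof -
  define I where "I = {i \<in> {..n}. int N dvd j + 2 * int i - int n}"
  define g where "g = (N + 1) div 2"
  have g: "g \<ge> 1" "2 * real g \<ge> real N" using N by (auto simp: g_def)
  have sep: "i + g \<le> k" if "i \<in> I" "k \<in> I" "i < k" for i k
  proof -
    have "int N dvd (j + 2 * int k - int n) - (j + 2 * int i - int n)"
      using that(1,2) unfolding I_def by (intro dvd_diff[of "int N" "j + 2 * int k - int n" "j + 2 * int i - int n"]) blast+
    then have "int N dvd int (2 * (k - i))" using that(3) by (simp add: of_nat_diff algebra_simps)
    then have "N dvd 2 * (k - i)" by (simp only: of_nat_dvd_iff)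
    then have "N \<le> 2 * (k - i)" using that(3) by (intro dvd_imp_le) auto
    then show ?thesis using that(3) by (auto simp: g_def)
  qed
  have "cycle_kernel N n j = (\<Sum>i\<in>I. real (n choose i)) / 2 ^ n"
    unfolding cycle_kernel_binomial I_def by (subst sum.inter_filter) (auto intro!: sum.cong)
  also have "\<dots> \<le> (2 * real (n choose (n div 2)) + 2 * 2 ^ n / real g) / 2 ^ n"
    using g sep by (intro divide_right_mono sum_sparse_binomial) (auto simp: I_def)
  also have "\<dots> = 2 * (real (n choose (n div 2)) / 2 ^ n) + 2 / real g" by (simp add: add_divide_distrib)
  also have "\<dots> \<le> 2 * (1 / sqrt (real n)) + 4 / real N"
    using central_binomial_bound[OF n] g N by (intro add_mono mult_left_mono) (auto simp: field_simps)
  also have "\<dots> \<le> 4 * (1 / sqrt (real n) + 1 / real N)" by (simp add: algebra_simps divide_right_mono)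
  finally show ?thesis .
qed

section \<open>Lattice walks and Feynman-Kac functionals\<close>

text \<open>The law of the list of the first \<open>n + 1\<close> positions of a Markov chain. Recursion on the first step
  makes every estimate below an induction on \<open>n\<close> that is uniform in the starting point.\<close>

primrec paths :: "('a \<Rightarrow> 'a pmf) \<Rightarrow> nat \<Rightarrow> 'a \<Rightarrow> 'a list pmf" where
  "paths K 0 x = return_pmf [x]"
| "paths K (Suc n) x = bind_pmf (K x) (\<lambda>y. map_pmf ((#) x) (paths K n y))"

lemma paths_map:
  assumes "\<And>x. map_pmf \<pi> (K x) = K' (\<pi> x)"
  shows "map_pmf (map \<pi>) (paths K n x) = paths K' n (\<pi> x)"
proof (induction n arbitrary: x)
  case (Suc n)
  have "map_pmf (map \<pi>) (paths K (Suc n) x) = bind_pmf (K x) (\<lambda>y. map_pmf ((#) (\<pi> x)) (map_pmf (map \<pi>) (paths K n y)))"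
    by (simp add: map_bind_pmf pmf.map_comp o_def)
  also have "\<dots> = bind_pmf (map_pmf \<pi> (K x)) (\<lambda>y. map_pmf ((#) (\<pi> x)) (paths K' n y))"
    by (simp add: Suc bind_map_pmf)
  finally show ?case by (simp add: assms)
qed simp

lemma paths_length: "l \<in> set_pmf (paths K n x) \<Longrightarrow> length l = Suc n \<and> hd l = x"
  by (induction n arbitrary: x l) auto

lemma finite_paths: "(\<And>x. finite (set_pmf (K x))) \<Longrightarrow> finite (set_pmf (paths K n x))"
  by (induction n arbitrary: x) auto

text \<open>Points of \<open>\<int>\<^sup>D\<close> are functions on all natural numbers, of which only the values below \<open>D\<close> matter.
  Steps in different directions then commute as function updates, and the torus enters only through
  the functions that are evaluated.\<close>

definition nudge :: "(nat \<Rightarrow> int) \<Rightarrow> nat \<Rightarrow> int \<Rightarrow> nat \<Rightarrow> int" where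
  "nudge X i s = X(i := X i + s)"

definition lift_step :: "nat \<Rightarrow> (nat \<Rightarrow> int) \<Rightarrow> (nat \<Rightarrow> int) pmf" where
  "lift_step D X = map_pmf (\<lambda>(i, s). nudge X i s) (pmf_of_set ({..<D} \<times> {1, -1}))"

definition step_avg :: "nat \<Rightarrow> ((nat \<Rightarrow> int) \<Rightarrow> real) \<Rightarrow> (nat \<Rightarrow> int) \<Rightarrow> real" where
  "step_avg D \<phi> X = (\<Sum>i<D. \<phi> (nudge X i 1) + \<phi> (nudge X i (-1))) / (2 * real D)"

lemma set_lift_step: "D \<ge> 1 \<Longrightarrow> set_pmf (lift_step D X) = (\<lambda>(i, s). nudge X i s) ` ({..<D} \<times> {1, -1})"
  unfolding lift_step_def by (simp add: set_pmf_of_set lessThan_empty_iff)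

lemma finite_lift_step: "D \<ge> 1 \<Longrightarrow> finite (set_pmf (lift_step D X))"
  by (simp add: set_lift_step)

lemma expectation_lift_step:
  assumes "D \<ge> 1"
  shows "measure_pmf.expectation (lift_step D X) \<phi> = step_avg D \<phi> X"
proof -
  let ?S = "{..<D} \<times> {1, -1::int}"
  have ne: "?S \<noteq> {}" using assms by (auto simp: lessThan_empty_iff)
  have "measure_pmf.expectation (lift_step D X) \<phi> = (\<Sum>(i,s)\<in>?S. \<phi> (nudge X i s)) / real (card ?S)"
    unfolding lift_step_def using ne by (subst integral_map_pmf) (subst integral_pmf_of_set, auto simp: case_prod_beta)
  also have "(\<Sum>(i,s)\<in>?S. \<phi> (nudge X i s)) = (\<Sum>i<D. \<Sum>s\<in>{1,-1}. \<phi> (nudge X i s))"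
    by (rule sum.cartesian_product[symmetric])
  also have "\<dots> = (\<Sum>i<D. \<phi> (nudge X i 1) + \<phi> (nudge X i (-1)))" by simp
  finally show ?thesis by (simp add: step_avg_def card_cartesian_product mult.commute)
qed

abbreviation "walk D \<equiv> paths (lift_step D)"

lemma finite_walk: "D \<ge> 1 \<Longrightarrow> finite (set_pmf (walk D n X))"
  by (simp add: finite_paths finite_lift_step)

lemma walk_expectation_Suc:
  fixes F :: "(nat \<Rightarrow> int) list \<Rightarrow> real"
  assumes "D \<ge> 1"
  shows "measure_pmf.expectation (walk D (Suc n) X) F =
     step_avg D (\<lambda>Y. measure_pmf.expectation (walk D n Y) (\<lambda>l. F (X # l))) X"
proof -
  have "measure_pmf.expectation (walk D (Suc n) X) F =
      (\<Sum>a\<in>set_pmf (lift_step D X). pmf (lift_step D X) a *\<^sub>R measure_pmf.expectation (map_pmf ((#) X) (walk D n a)) F)"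
    unfolding paths.simps using finite_walk[OF assms] finite_lift_step[OF assms]
    by (intro pmf_expectation_bind) auto
  also have "\<dots> = measure_pmf.expectation (lift_step D X) (\<lambda>a. measure_pmf.expectation (walk D n a) (\<lambda>l. F (X # l)))"
    using finite_lift_step[OF assms] by (subst integral_measure_pmf[where A = "set_pmf (lift_step D X)"]) auto
  finally show ?thesis using expectation_lift_step[OF assms] by simp
qed

lemma walk_prob_Suc:
  assumes "D \<ge> 1"
  shows "measure_pmf.prob (walk D (Suc n) X) {l. P l} =
     step_avg D (\<lambda>Y. measure_pmf.prob (walk D n Y) {l. P (X # l)}) X"
proof -
  have *: "measure_pmf.prob p {l. Q l} = measure_pmf.expectation p (\<lambda>l. if Q l then 1 else 0 :: real)" for p :: "'b pmf" and Q
  proof -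
    have "measure_pmf.prob p {l. Q l} = measure_pmf.expectation p (indicator {l. Q l})" by simp
    also have "indicator {l. Q l} = (\<lambda>l. if Q l then 1 else 0 :: real)" by (auto simp: indicator_def)
    finally show ?thesis .
  qed
  show ?thesis unfolding * by (rule walk_expectation_Suc[OF assms])
qed

lemma step_avg_mono: "(\<And>Y. \<phi> Y \<le> \<psi> Y) \<Longrightarrow> step_avg D \<phi> X \<le> step_avg D \<psi> X"
  unfolding step_avg_def by (intro divide_right_mono sum_mono add_mono) auto

lemma step_avg_add: "step_avg D (\<lambda>Y. \<phi> Y + \<psi> Y) X = step_avg D \<phi> X + step_avg D \<psi> X"
  unfolding step_avg_def by (simp add: sum.distrib add_divide_distrib algebra_simps)

lemma step_avg_cmult: "step_avg D (\<lambda>Y. c * \<phi> Y) X = c * step_avg D \<phi> X"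
  unfolding step_avg_def by (simp add: sum_distrib_left algebra_simps)

lemma step_avg_const [simp]: "D \<ge> 1 \<Longrightarrow> step_avg D (\<lambda>Y. c) X = c"
  unfolding step_avg_def by simp

lemma step_avg_sum: "step_avg D (\<lambda>Y. \<Sum>k\<in>S. \<phi> k Y) X = (\<Sum>k\<in>S. step_avg D (\<phi> k) X)"
proof (induction S rule: infinite_finite_induct)
  case (insert x F)
  then show ?case by (simp add: step_avg_add)
qed (auto simp: step_avg_def)

lemma step_avg_nonneg: "(\<And>Y. 0 \<le> \<phi> Y) \<Longrightarrow> 0 \<le> step_avg D \<phi> X"
  unfolding step_avg_def by (intro divide_nonneg_nonneg sum_nonneg add_nonneg_nonneg) auto

lemma step_avg_coord:
  assumes "d < D"
  shows "step_avg D (\<lambda>Y. g (Y d)) X = g (X d) + (g (X d + 1) + g (X d - 1) - 2 * g (X d)) / (2 * real D)"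
proof -
  have "(\<Sum>i<D. g (nudge X i 1 d) + g (nudge X i (-1) d))
     = (\<Sum>i<D. 2 * g (X d) + (if i = d then g (X d + 1) + g (X d - 1) - 2 * g (X d) else 0))"
    by (intro sum.cong) (auto simp: nudge_def)
  also have "\<dots> = 2 * real D * g (X d) + (g (X d + 1) + g (X d - 1) - 2 * g (X d))"
    using assms by (simp add: sum.distrib)
  finally show ?thesis using assms unfolding step_avg_def by (simp add: add_divide_distrib)
qed

text \<open>The expectation of \<open>w(X\<^sub>0) \<cdots> w(X\<^sub>n\<^sub>-\<^sub>1) g(X\<^sub>n)\<close> for the walk started at \<open>X\<^sub>0 = X\<close>.\<close>

primrec feynman_kac :: "nat \<Rightarrow> ((nat \<Rightarrow> int) \<Rightarrow> real) \<Rightarrow> nat \<Rightarrow> ((nat \<Rightarrow> int) \<Rightarrow> real) \<Rightarrow> (nat \<Rightarrow> int) \<Rightarrow> real" where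
  "feynman_kac D w 0 g X = g X"
| "feynman_kac D w (Suc n) g X = w X * step_avg D (feynman_kac D w n g) X"

lemma walk_prod_eq_feynman_kac:
  assumes "D \<ge> 1"
  shows "measure_pmf.expectation (walk D n X) (\<lambda>l. \<Prod>x\<leftarrow>l. w x) = feynman_kac D w (Suc n) (\<lambda>_. 1) X"
proof (induction n arbitrary: X)
  case 0
  have "feynman_kac D w 0 (\<lambda>_. 1) = (\<lambda>_. 1)" by (rule ext) simp
  then show ?case using assms by simp
next
  case (Suc n)
  have e: "feynman_kac D w (Suc n) (\<lambda>_. 1) = (\<lambda>Y. measure_pmf.expectation (walk D n Y) (\<lambda>l. \<Prod>x\<leftarrow>l. w x))"
    by (rule ext) (simp only: Suc)
  show ?case
    unfolding walk_expectation_Suc[OF assms] feynman_kac.simps(2)[of D w "Suc n"] e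
    by (simp add: step_avg_cmult)
qed

lemma feynman_kac_mono:
  assumes "\<And>X. 0 \<le> w X" "\<And>X. g X \<le> h X"
  shows "feynman_kac D w n g X \<le> feynman_kac D w n h X"
proof (induction n arbitrary: X)
  case (Suc n)
  then show ?case using assms by (auto intro!: mult_left_mono step_avg_mono)
qed (use assms in auto)

lemma feynman_kac_mono_weight:
  assumes "\<And>X. 0 \<le> w X" "\<And>X. w X \<le> v X" "\<And>X. 0 \<le> g X"
  shows "0 \<le> feynman_kac D w n g X \<and> feynman_kac D w n g X \<le> feynman_kac D v n g X"
proof (induction n arbitrary: X)
  case (Suc n)
  then show ?case using assms(1,2) order_trans[OF assms(1,2)]
    by (auto intro!: mult_mono step_avg_mono step_avg_nonneg mult_nonneg_nonneg)
qed (use assms in auto)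

lemma feynman_kac_nonneg: "(\<And>X. 0 \<le> w X) \<Longrightarrow> (\<And>X. 0 \<le> g X) \<Longrightarrow> 0 \<le> feynman_kac D w n g X"
  using feynman_kac_mono_weight[of w w g] by auto

lemma feynman_kac_cmult: "feynman_kac D w n (\<lambda>X. c * g X) X = c * feynman_kac D w n g X"
proof (induction n arbitrary: X)
  case (Suc n)
  then have "feynman_kac D w n (\<lambda>X. c * g X) = (\<lambda>X. c * feynman_kac D w n g X)" by (intro ext)
  then show ?case by (simp add: step_avg_cmult)
qed simp

lemma feynman_kac_sum: "feynman_kac D w n (\<lambda>X. \<Sum>k\<in>S. g k X) X = (\<Sum>k\<in>S. feynman_kac D w n (g k) X)"
proof (induction n arbitrary: X)
  case (Suc n)
  then have "feynman_kac D w n (\<lambda>X. \<Sum>k\<in>S. g k X) = (\<lambda>X. \<Sum>k\<in>S. feynman_kac D w n (g k) X)" by (intro ext)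
  then show ?case by (simp add: step_avg_sum sum_distrib_left)
qed simp

text \<open>In other words, \<open>w(X\<^sub>0) \<cdots> w(X\<^sub>n\<^sub>-\<^sub>1) g(X\<^sub>n)\<close> is a supermartingale.\<close>

lemma feynman_kac_supersolution:
  assumes "\<And>X. 0 \<le> w X" "\<And>X. w X * step_avg D g X \<le> g X"
  shows "feynman_kac D w n g X \<le> g X"
proof (induction n arbitrary: X)
  case (Suc n)
  have "feynman_kac D w (Suc n) g X \<le> w X * step_avg D g X"
    using Suc assms(1) by (auto intro!: mult_left_mono step_avg_mono)
  also have "\<dots> \<le> g X" by (rule assms(2))
  finally show ?case .
qed simp

lemma markov_pmf:
  assumes "finite (set_pmf p)" "0 < c" "\<And>l. l \<in> set_pmf p \<Longrightarrow> P l \<Longrightarrow> c \<le> F l" "\<And>l. l \<in> set_pmf p \<Longrightarrow> 0 \<le> F l"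
  shows "measure_pmf.prob p {l. P l} \<le> measure_pmf.expectation p F / (c :: real)"
proof -
  have i: "integrable (measure_pmf p) f" for f :: "_ \<Rightarrow> real" using assms(1) by (rule integrable_measure_pmf_finite)
  have "measure_pmf.prob p {l. P l} * c = measure_pmf.expectation p (\<lambda>l. indicator {l. P l} l * c)" by simp
  also have "\<dots> \<le> measure_pmf.expectation p F"
    by (intro integral_mono_AE i) (use assms in \<open>auto simp: AE_measure_pmf_iff indicator_def\<close>)
  finally show ?thesis using assms(2) by (simp only: pos_le_divide_eq)
qed

lemma exp_neg_le: "0 < (x::real) \<Longrightarrow> exp (- x) \<le> 2 / x\<^sup>2"
proof -
  assume x: "0 < x"
  have "x\<^sup>2 / 2 \<le> exp x" using exp_lower_Taylor_quadratic[of x] x by linarith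
  then have "1 / exp x \<le> 1 / (x\<^sup>2 / 2)" using x by (intro divide_left_mono) auto
  then show ?thesis by (simp add: exp_minus inverse_eq_divide)
qed

definition visits :: "nat \<Rightarrow> int \<Rightarrow> (nat \<Rightarrow> int) list \<Rightarrow> nat" where
  "visits d z l = length (filter (\<lambda>x. x d = z) l)"

lemma visits_Cons: "visits d z (x # l) = (if x d = z then 1 else 0) + visits d z l"
  by (simp add: visits_def)

section \<open>The largest local time of the vertical coordinate\<close>

lemma prod_visits2:
  "(\<Prod>x\<leftarrow>l. (if x d = z then a else if x d = u then b else 1 :: real)) = a ^ visits d z l * b ^ visits d u l" if "z \<noteq> u"
  using that by (induction l) (auto simp: visits_def)

text \<open>A walk that often visits \<open>z\<close> also visits \<open>z - h\<close> often, since each visit to \<open>z\<close> is followed by an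
  excursion to \<open>z - h\<close> with probability of order \<open>1 / h\<close>. The supermartingale behind the estimate
  rewards visits to \<open>z\<close>, penalises visits to \<open>z - h\<close>, and contains a function of the height that is
  harmonic except at these two heights.\<close>

lemma visits_contrast:
  fixes s :: real
  assumes "d < D" "0 < s" "s \<le> 1/2" "h \<ge> 1" and ab: "b \<le> (1 - 2 * s) * a" and a: "0 \<le> a"
  shows "measure_pmf.prob (walk D n X) {l. a \<le> real (visits d z l) \<and> real (visits d (z - int h) l) \<le> b}
     \<le> 2 * exp (- (s\<^sup>2 * a / (2 * real D * real h)))"
proof -
  have D: "D \<ge> 1" using assms by simp
  define c where "c = 1 / (2 * real D * real h)"
  have c: "0 < c" using D assms by (simp add: c_def)
  define v where "v = s * c / (1 - s)"
  have v: "0 \<le> v" using c assms by (simp add: v_def)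
  \<comment> \<open>The distance below \<open>z\<close>, capped at \<open>h\<close>; \<open>g\<close> decreases linearly from \<open>1\<close> at \<open>z\<close> to
    \<open>1 - s\<close> at \<open>z - h\<close> and is constant elsewhere.\<close>
  define k where "k y = max 0 (min (int h) (z - y))" for y
  define g where "g y = 1 - s * real_of_int (k y) / real h" for y :: int
  have hpos: "0 < real h" using assms by simp
  have dk: "k (y + 1) + k (y - 1) - 2 * k y = (if y = z then 1 else if y = z - int h then -1 else 0)" for y
    using assms(4) by (auto simp: k_def max_def min_def)
  have gz: "g z = 1" "g (z - int h) = 1 - s" using hpos by (auto simp: g_def k_def)
  have g1: "1 - s \<le> g y" "g y \<le> 1" for y
  proof -
    have "0 \<le> real_of_int (k y) / real h" "real_of_int (k y) / real h \<le> 1"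
      using hpos by (auto simp: k_def divide_le_eq)
    then have "s * (real_of_int (k y) / real h) \<le> s * 1" "0 \<le> s * (real_of_int (k y) / real h)"
      using assms(2) by (simp_all only: mult_left_mono mult_nonneg_nonneg less_imp_le)
    then show "1 - s \<le> g y" "g y \<le> 1" unfolding g_def by simp_all
  qed
  \<comment> \<open>The reward at \<open>z\<close> and the penalty at \<open>z - h\<close> are as large as the kinks of \<open>g\<close> allow.\<close>
  define w where "w x = (if x d = z then exp (s * c) else if x d = z - int h then exp (- v) else 1)" for x :: "nat \<Rightarrow> int"
  have w0: "0 \<le> w x" for x by (simp add: w_def)
  have avg: "step_avg D (\<lambda>Y. g (Y d)) X = g (X d) - s * c * real_of_int (k (X d + 1) + k (X d - 1) - 2 * k (X d))" for X
  proof -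
    have "g (X d + 1) + g (X d - 1) - 2 * g (X d) = - (s / real h) * real_of_int (k (X d + 1) + k (X d - 1) - 2 * k (X d))"
      using hpos unfolding g_def by (simp add: field_simps)
    then have "step_avg D (\<lambda>Y. g (Y d)) X = g (X d) + (- (s / real h) * real_of_int (k (X d + 1) + k (X d - 1) - 2 * k (X d))) / (2 * real D)"
      unfolding step_avg_coord[OF assms(1)] by simp
    then show ?thesis unfolding c_def by (simp add: mult.commute)
  qed
  have super: "w X * step_avg D (\<lambda>Y. g (Y d)) X \<le> g (X d)" for X
  proof -
    consider "X d = z" | "X d = z - int h" "X d \<noteq> z" | "X d \<noteq> z" "X d \<noteq> z - int h" by blast
    then show ?thesis
    proof cases
      case 1
      have "exp (s * c) * (1 - s * c) \<le> exp (s * c) * exp (- (s * c))"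
        using exp_ge_add_one_self[of "- (s * c)"] by (intro mult_left_mono) auto
      also have "\<dots> = 1" by (simp flip: exp_add)
      finally show ?thesis unfolding avg dk using 1 gz by (simp add: w_def)
    next
      case 2
      have "exp (- v) * (1 + v) \<le> exp (- v) * exp v" by (intro mult_left_mono exp_ge_add_one_self) auto
      also have "\<dots> = 1" by (simp flip: exp_add)
      finally have "(1 - s) * (exp (- v) * (1 + v)) \<le> (1 - s) * 1" using assms by (intro mult_left_mono) auto
      moreover have "(1 - s) * (1 + v) = 1 - s + s * c" using assms by (simp add: v_def field_simps)
      ultimately have "exp (- v) * (1 - s + s * c) \<le> 1 - s" by (metis mult.left_commute mult.right_neutral)
      then show ?thesis unfolding avg dk using 2 gz by (simp add: w_def)
    next
      case 3
      then show ?thesis unfolding avg dk by (simp add: w_def)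
    qed
  qed
  have E: "measure_pmf.expectation (walk D n X) (\<lambda>l. \<Prod>x\<leftarrow>l. w x) \<le> 2"
  proof -
    have "feynman_kac D w (Suc n) (\<lambda>_. 1) X \<le> feynman_kac D w (Suc n) (\<lambda>X. 2 * g (X d)) X"
    proof (rule feynman_kac_mono)
      fix X :: "nat \<Rightarrow> int" show "1 \<le> 2 * g (X d)" using g1(1)[of "X d"] assms by simp
    qed (rule w0)
    also have "\<dots> = 2 * feynman_kac D w (Suc n) (\<lambda>X. g (X d)) X" by (rule feynman_kac_cmult)
    also have "\<dots> \<le> 2 * g (X d)" using feynman_kac_supersolution[of w D "\<lambda>X. g (X d)" "Suc n" X] w0 super by (intro mult_left_mono) auto
    also have "\<dots> \<le> 2" using g1 by simp
    finally show ?thesis unfolding walk_prod_eq_feynman_kac[OF D] .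
  qed
  have zu: "z \<noteq> z - int h" using assms by simp
  have "measure_pmf.prob (walk D n X) {l. a \<le> real (visits d z l) \<and> real (visits d (z - int h) l) \<le> b}
    \<le> measure_pmf.expectation (walk D n X) (\<lambda>l. \<Prod>x\<leftarrow>l. w x) / exp (s\<^sup>2 * c * a)"
  proof (rule markov_pmf)
    fix l assume l: "a \<le> real (visits d z l) \<and> real (visits d (z - int h) l) \<le> b"
    have "(\<Prod>x\<leftarrow>l. w x) = exp (s * c) ^ visits d z l * exp (- v) ^ visits d (z - int h) l"
      unfolding w_def by (rule prod_visits2[OF zu])
    also have "\<dots> = exp (s * c * real (visits d z l) - v * real (visits d (z - int h) l))"
      by (simp add: exp_of_nat_mult exp_diff exp_minus field_simps flip: exp_of_nat2_mult)
    finally have eq: "(\<Prod>x\<leftarrow>l. w x) = exp (s * c * real (visits d z l) - v * real (visits d (z - int h) l))" .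
    have "v * real (visits d (z - int h) l) \<le> v * ((1 - 2 * s) * a)"
      using l ab v by (intro mult_left_mono) auto
    \<comment> \<open>The penalty per visit exceeds the reward by the factor \<open>1 / (1 - s)\<close>, which the factor
      \<open>1 - 2 s\<close> between the numbers of visits outweighs.\<close>
    also have "\<dots> \<le> v * ((1 - s)\<^sup>2 * a)"
      using v a by (intro mult_left_mono mult_right_mono) (auto simp: power2_eq_square algebra_simps)
    also have "\<dots> = s * c * (1 - s) * a" using assms by (simp add: v_def power2_eq_square)
    finally have "v * real (visits d (z - int h) l) \<le> s * c * (1 - s) * a" .
    moreover have "s * c * a \<le> s * c * real (visits d z l)" using l c assms by (intro mult_left_mono) auto
    ultimately have "s\<^sup>2 * c * a \<le> s * c * real (visits d z l) - v * real (visits d (z - int h) l)"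
      by (simp add: power2_eq_square algebra_simps)
    then show "exp (s\<^sup>2 * c * a) \<le> (\<Prod>x\<leftarrow>l. w x)" unfolding eq by simp
  qed (use finite_walk[OF D] in \<open>auto intro!: prod_list_nonneg simp: w0\<close>)
  also have "\<dots> \<le> 2 / exp (s\<^sup>2 * c * a)" using E by (intro divide_right_mono) auto
  also have "\<dots> = 2 * exp (- (s\<^sup>2 * a / (2 * real D * real h)))" by (simp add: exp_minus c_def field_simps)
  finally show ?thesis .
qed

text \<open>By Tanaka's formula the expected number of visits to \<open>z\<close> is \<open>D\<close> times the mean increase of the
  distance of the vertical coordinate to \<open>z\<close>, and \<open>\<bar>y\<bar> \<le> (y\<^sup>2 / b + b) / 2\<close> bounds this by the square
  root of the time when \<open>b\<close> is chosen as that root.\<close>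

lemma visits_expectation:
  assumes "d < D" "X d = 0"
  shows "measure_pmf.expectation (walk D n X) (\<lambda>l. real (visits d z l)) \<le> (1 + real D) / 2 * sqrt (real (Suc n))"
proof -
  have D: "D \<ge> 1" using assms by simp
  define b where "b = sqrt (real (Suc n))"
  have b: "0 < b" by (simp add: b_def)
  \<comment> \<open>\<open>V k\<close> is the resulting bound for \<open>k\<close> visited times when the walk starts at height \<open>y\<close>.\<close>
  define V where "V k y = real D * \<bar>real_of_int z\<bar> + real D / 2 * (((real_of_int y)\<^sup>2 + real k / real D) / b + b) - real D * \<bar>real_of_int (y - z)\<bar>" for k :: nat and y :: int
  have V0: "0 \<le> V 0 y" for y
  proof -
    have "2 * \<bar>real_of_int y\<bar> \<le> (real_of_int y)\<^sup>2 / b + b"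
    proof -
      have "0 \<le> (\<bar>real_of_int y\<bar> - b)\<^sup>2" by simp
      then have "2 * \<bar>real_of_int y\<bar> * b \<le> (real_of_int y)\<^sup>2 + b * b" by (simp add: power2_eq_square algebra_simps)
      then show ?thesis using b by (simp add: field_simps)
    qed
    then have "\<bar>real_of_int (y - z)\<bar> \<le> \<bar>real_of_int z\<bar> + ((real_of_int y)\<^sup>2 / b + b) / 2"
      using abs_triangle_ineq4[of "real_of_int y" "real_of_int z"] unfolding of_int_diff by argo
    then have "real D * \<bar>real_of_int (y - z)\<bar> \<le> real D * (\<bar>real_of_int z\<bar> + ((real_of_int y)\<^sup>2 / b + b) / 2)" by (intro mult_left_mono) auto
    also have "\<dots> = real D * \<bar>real_of_int z\<bar> + real D / 2 * ((real_of_int y)\<^sup>2 / b + b)" by (simp add: distrib_left)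
    finally show ?thesis by (simp add: V_def)
  qed
  have VS: "(if y = z then 1 else 0) + (V k y + (V k (y + 1) + V k (y - 1) - 2 * V k y) / (2 * real D)) = V (Suc k) y" for k y
  proof -
    have a: "\<bar>real_of_int (y + 1 - z)\<bar> + \<bar>real_of_int (y - 1 - z)\<bar> - 2 * \<bar>real_of_int (y - z)\<bar> = (if y = z then 2 else 0)"
    proof -
      have "\<bar>y + 1 - z\<bar> + \<bar>y - 1 - z\<bar> - 2 * \<bar>y - z\<bar> = (if y = z then 2 else 0)" by (cases "y < z"; cases "y = z") (simp_all add: abs_if)
      from arg_cong[OF this, of real_of_int] show ?thesis by (cases "y = z") simp_all
    qed
    have "V k (y + 1) + V k (y - 1) - 2 * V k y = real D / b - real D * (\<bar>real_of_int (y + 1 - z)\<bar> + \<bar>real_of_int (y - 1 - z)\<bar> - 2 * \<bar>real_of_int (y - z)\<bar>)"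
      using b unfolding V_def by (simp add: field_simps power2_eq_square)
    also have "\<dots> = real D / b - real D * (if y = z then 2 else 0)" unfolding a ..
    finally have s: "(V k (y + 1) + V k (y - 1) - 2 * V k y) / (2 * real D) = 1 / (2 * b) - (if y = z then 1 else 0)"
      using D by (simp add: diff_divide_distrib)
    have "V (Suc k) y = V k y + 1 / (2 * b)" using D b unfolding V_def by (simp add: field_simps)
    then show ?thesis unfolding s by simp
  qed
  have "measure_pmf.expectation (walk D n X) (\<lambda>l. real (visits d z l)) \<le> V (Suc n) (X d)" for n X
  proof (induction n arbitrary: X)
    case 0
    have "0 \<le> step_avg D (\<lambda>Y. V 0 (Y d)) X" by (intro step_avg_nonneg V0)
    then show ?case unfolding VS[symmetric, of 0] step_avg_coord[OF assms(1)] by (cases "X d = z") (auto simp: visits_def)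
  next
    case (Suc n)
    have i: "integrable (measure_pmf (walk D n Y)) f" for f :: "_ \<Rightarrow> real" and Y
      using finite_walk[OF D] by (rule integrable_measure_pmf_finite)
    have "measure_pmf.expectation (walk D (Suc n) X) (\<lambda>l. real (visits d z l)) =
      step_avg D (\<lambda>Y. (if X d = z then 1 else 0) + measure_pmf.expectation (walk D n Y) (\<lambda>l. real (visits d z l))) X"
      unfolding walk_expectation_Suc[OF D] visits_Cons by (simp add: i)
    also have "\<dots> \<le> (if X d = z then 1 else 0) + step_avg D (\<lambda>Y. V (Suc n) (Y d)) X"
      unfolding step_avg_add step_avg_const[OF D] by (intro add_left_mono step_avg_mono Suc)
    finally show ?case unfolding VS[symmetric, of "Suc n"] step_avg_coord[OF assms(1)] by simp
  qed
  from this[of n X] have "measure_pmf.expectation (walk D n X) (\<lambda>l. real (visits d z l)) \<le> real D / 2 * ((real (Suc n) / real D) / b + b)"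
    unfolding V_def assms(2) by simp
  also have "\<dots> = (1 + real D) / 2 * b"
  proof -
    have "real (Suc n) = b * b" by (simp add: b_def)
    then show ?thesis using b D by (simp add: field_simps)
  qed
  finally show ?thesis by (simp add: b_def)
qed

text \<open>Kolmogorov's maximal inequality for the coordinate \<open>d\<close>.\<close>

lemma maximal_displacement:
  assumes "d < D" "0 < R"
  shows "measure_pmf.prob (walk D n X) {l. \<exists>x\<in>set l. R \<le> \<bar>real_of_int (x d)\<bar>} \<le> ((real_of_int (X d))\<^sup>2 + real n) / R\<^sup>2"
proof (induction n arbitrary: X)
  have far: "measure_pmf.prob p B \<le> ((real_of_int y)\<^sup>2 + real k) / R\<^sup>2" if "R \<le> \<bar>real_of_int y\<bar>" for p :: "(nat \<Rightarrow> int) list pmf" and B y k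
  proof -
    have "R\<^sup>2 \<le> (real_of_int y)\<^sup>2" using that assms by (metis abs_of_nonneg less_imp_le abs_le_square_iff)
    then have "1 \<le> ((real_of_int y)\<^sup>2 + real k) / R\<^sup>2" using assms by simp
    then show ?thesis using measure_pmf.prob_le_1[of p B] by linarith
  qed
  {
    case 0
    show ?case
    proof (cases "R \<le> \<bar>real_of_int (X d)\<bar>")
      case False
      then show ?thesis by (simp add: measure_return_pmf)
    qed (rule far)
  next
    case (Suc n)
    have D: "D \<ge> 1" using assms by simp
    show ?case
    proof (cases "R \<le> \<bar>real_of_int (X d)\<bar>")
      case False
      have "measure_pmf.prob (walk D (Suc n) X) {l. \<exists>x\<in>set l. R \<le> \<bar>real_of_int (x d)\<bar>} \<le>
        step_avg D (\<lambda>Y. ((real_of_int (Y d))\<^sup>2 + real n) / R\<^sup>2) X"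
        unfolding walk_prob_Suc[OF D] using False by (auto intro!: step_avg_mono Suc)
      also have "\<dots> = (real_of_int (X d))\<^sup>2 / R\<^sup>2 + real n / R\<^sup>2 + (1 / real D) / R\<^sup>2"
        unfolding step_avg_coord[OF assms(1), of "\<lambda>y. ((real_of_int y)\<^sup>2 + real n) / R\<^sup>2"] using assms
        by (simp add: field_simps power2_eq_square)
      also have "\<dots> \<le> (real_of_int (X d))\<^sup>2 / R\<^sup>2 + real n / R\<^sup>2 + 1 / R\<^sup>2"
        using D by (intro add_left_mono divide_right_mono) auto
      also have "\<dots> = ((real_of_int (X d))\<^sup>2 + real (Suc n)) / R\<^sup>2" by (simp add: add_divide_distrib)
      finally show ?thesis .
    qed (rule far)
  }
qed

lemma geometric_sum_bound:
  assumes "0 \<le> r" "r < (1 :: real)"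
  shows "(\<Sum>i<J. r ^ (J - i)) \<le> r / (1 - r)"
proof (induction J)
  case 0
  show ?case using assms by simp
next
  case (Suc J)
  have "(\<Sum>i<Suc J. r ^ (Suc J - i)) = r * (\<Sum>i<J. r ^ (J - i)) + r"
    by (simp add: sum_distrib_left Suc_diff_le)
  also have "\<dots> \<le> r * (r / (1 - r)) + r" using Suc assms by (intro add_right_mono mult_left_mono) auto
  also have "\<dots> = r / (1 - r)" using assms by (simp add: field_simps)
  finally show ?case .
qed

text \<open>Chaining. The height \<open>zz z j\<close> is \<open>z\<close> rounded down to a multiple of \<open>2 ^ j\<close>. If \<open>z\<close> is visited \<open>m\<close>
  times then, going from \<open>j = 0\<close> to \<open>j = J\<close>, either the number of visits drops too much at some
  scale (the event \<open>Fail\<close>), or some multiple of \<open>2 ^ J\<close> is visited \<open>m / 2\<close> times. At scale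
  \<open>2 ^ j\<close> there are about \<open>2 ^ (J - j)\<close> times more heights than at scale \<open>2 ^ J\<close>. A relative loss
  of order \<open>(9/10) ^ (J - j)\<close> per scale is summable over \<open>j\<close>, and it still makes the failure
  probability \<open>exp (- c H (81/50) ^ (J - j))\<close>, which beats the number of heights.\<close>

lemma max_visits_explicit:
  fixes m J n :: nat
  defines "H \<equiv> real m / 2 ^ J"
  assumes "d < D" "X d = 0" "m \<ge> 1"
  shows "measure_pmf.prob (walk D n X) {l. \<exists>z. m \<le> visits d z l} \<le>
    real n / (real m)\<^sup>2 + (2 * H + 3) * ((1 + real D) * sqrt (real (Suc n)) / real m)
     + (2 * H + 3) * (16 * (5184 * real D)\<^sup>2 / H\<^sup>2)"
proof -
  have D: "D \<ge> 1" using assms by simp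
  have H: "0 < H" using assms by (simp add: H_def)
  let ?P = "measure_pmf.prob (walk D n X)"
  define s :: "nat \<Rightarrow> real" where "s j = (9/10) ^ (J - j) / 36" for j
  \<comment> \<open>At scale \<open>j\<close> the threshold for the number of visits; it never falls below \<open>m / 2\<close>.\<close>
  define thr where "thr j = real m * (1 - (\<Sum>i<j. 2 * s i))" for j
  have s0: "0 < s j" "s j \<le> 1/2" for j
  proof -
    show "0 < s j" by (simp add: s_def)
    have "(9/10 :: real) ^ (J - j) \<le> 1" by (rule power_le_one) auto
    then show "s j \<le> 1/2" by (simp add: s_def)
  qed
  have thr_half: "real m / 2 \<le> thr j" if "j \<le> J" for j
  proof -
    have "(\<Sum>i<j. 2 * s i) \<le> (\<Sum>i<J. 2 * s i)" using that s0(1) by (intro sum_mono2) (auto simp: less_imp_le)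
    also have "\<dots> = (\<Sum>i<J. (9/10 :: real) ^ (J - i)) / 18" by (simp add: s_def sum_divide_distrib)
    also have "\<dots> \<le> 1 / 2" using geometric_sum_bound[of "9/10" J] by simp
    finally have "real m * (1/2) \<le> thr j" unfolding thr_def by (intro mult_left_mono) auto
    then show ?thesis by simp
  qed
  have thr_Suc: "thr (Suc j) \<le> (1 - 2 * s j) * thr j" for j
  proof -
    have "0 \<le> (\<Sum>i<j. 2 * s i)" using s0(1) by (intro sum_nonneg) (auto simp: less_imp_le)
    then have "thr j \<le> real m * 1" unfolding thr_def by (intro mult_left_mono) auto
    then have "s j * thr j \<le> s j * real m" using s0(1) by (intro mult_left_mono) (auto simp: less_imp_le)
    moreover have "thr (Suc j) = thr j - 2 * (s j * real m)" by (simp add: thr_def algebra_simps)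
    ultimately show ?thesis by (simp add: algebra_simps)
  qed
  have thr_dec: "thr (Suc j) \<le> thr j" for j using s0(1)[of j] unfolding thr_def by (intro mult_left_mono) auto
  \<comment> \<open>Multiples of \<open>2 ^ j\<close> by elements of \<open>K j\<close> include all rounded heights of absolute value
    at most \<open>m\<close>.\<close>
  define K where "K j = {- int (m div 2 ^ j + 1)..int (m div 2 ^ j + 1)}" for j
  have cK: "real (card (K j)) \<le> (2 * H + 3) * 2 ^ (J - j)" if "j \<le> J" for j
  proof -
    have "real (card (K j)) = 2 * real (m div 2 ^ j) + 3" by (simp add: K_def)
    also have "\<dots> \<le> 2 * (real m / 2 ^ j) + 3" using of_nat_div_le_of_nat[of m "2 ^ j", where 'a = real] by simp
    also have "real m / 2 ^ j = H * 2 ^ (J - j)" using that by (simp add: H_def power_diff)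
    also have "2 * (H * 2 ^ (J - j)) + 3 \<le> 2 * (H * 2 ^ (J - j)) + 3 * 2 ^ (J - j)" by simp
    finally show ?thesis by (simp add: algebra_simps)
  qed
  define zz where "zz z j = 2 ^ j * (z div 2 ^ j)" for z :: int and j :: nat
  have zK: "z div 2 ^ j \<in> K j" if "\<bar>z\<bar> \<le> int m" for z :: int and j :: nat
  proof -
    have "int m div 2 ^ j = int (m div 2 ^ j)" by (simp add: zdiv_int)
    moreover have "z div 2 ^ j \<le> int m div 2 ^ j" using that by (intro zdiv_mono1) auto
    moreover have "(- int m) div 2 ^ j \<le> z div 2 ^ j" using that by (intro zdiv_mono1) auto
    moreover have "- (int m div 2 ^ j) - 1 \<le> (- int m) div 2 ^ j"
      using zdiv_zminus1_eq_if[of "2 ^ j" "int m"] by simp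
    ultimately show ?thesis by (simp add: K_def)
  qed
  have zstep: "zz z (Suc j) = zz z j \<or> zz z (Suc j) = zz z j - int (2 ^ j)" for z j
  proof -
    have "z div (2 ^ j * 2) = (z div 2 ^ j) div 2" by (rule zdiv_zmult2_eq) simp
    then have "z div 2 ^ Suc j = (z div 2 ^ j) div 2" by (simp only: power_Suc2)
    then have "z div 2 ^ j = 2 * (z div 2 ^ Suc j) + (z div 2 ^ j) mod 2" by simp
    then have "zz z j = zz z (Suc j) + 2 ^ j * ((z div 2 ^ j) mod 2)"
      unfolding zz_def by (metis distrib_left mult.assoc mult.commute power_Suc2)
    moreover have "(z div 2 ^ j) mod 2 = 0 \<or> (z div 2 ^ j) mod 2 = 1" by auto
    ultimately show ?thesis by auto
  qed
  define Fail where "Fail j k = {l. thr j \<le> real (visits d (2 ^ j * k) l) \<and> real (visits d (2 ^ j * k - int (2 ^ j)) l) \<le> thr (Suc j)}" for j and k :: int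
  \<comment> \<open>Only heights below \<open>m\<close> in absolute value have to be considered.\<close>
  define Far where "Far = {l. \<exists>x\<in>set l. real m \<le> \<bar>real_of_int (x d)\<bar>}"
  define Coarse where "Coarse k = {l. real m / 2 \<le> real (visits d (2 ^ J * k) l)}" for k :: int
  have cover: "{l. \<exists>z. m \<le> visits d z l} \<subseteq> Far \<union> (\<Union>k\<in>K J. Coarse k) \<union> (\<Union>j<J. \<Union>k\<in>K j. Fail j k)"
  proof
    fix l assume "l \<in> {l. \<exists>z. m \<le> visits d z l}"
    then obtain z where z: "m \<le> visits d z l" by blast
    then have "filter (\<lambda>x. x d = z) l \<noteq> []" using assms(4) by (auto simp: visits_def)
    then obtain x where x: "x \<in> set l" "x d = z" by (metis (mono_tags, lifting) filter_False)
    show "l \<in> Far \<union> (\<Union>k\<in>K J. Coarse k) \<union> (\<Union>j<J. \<Union>k\<in>K j. Fail j k)"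
    proof (rule ccontr)
      assume no: "\<not> ?thesis"
      have "\<not> real m \<le> \<bar>real_of_int (x d)\<bar>" using no x unfolding Far_def by blast
      then have zm: "\<bar>z\<bar> \<le> int m" using x by simp
      have "thr j \<le> real (visits d (zz z j) l)" if "j \<le> J" for j
        using that
      proof (induction j)
        case 0
        then show ?case using z by (simp add: thr_def zz_def)
      next
        case (Suc j)
        then have IH: "thr j \<le> real (visits d (zz z j) l)" by simp
        have nf: "l \<notin> Fail j (z div 2 ^ j)" using no Suc zK[OF zm, of j] by auto
        from zstep[of z j] show ?case
        proof
          assume "zz z (Suc j) = zz z j"
          then show ?thesis using IH thr_dec[of j] by simp
        next
          assume e: "zz z (Suc j) = zz z j - int (2 ^ j)"
          show ?thesis using nf IH unfolding Fail_def e unfolding zz_def by auto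
        qed
      qed
      from this[of J] have "l \<in> Coarse (z div 2 ^ J)" using thr_half[of J] by (simp add: Coarse_def zz_def)
      then show False using no zK[OF zm, of J] by blast
    qed
  qed
  have pFar: "?P Far \<le> real n / (real m)\<^sup>2"
    using maximal_displacement[OF assms(2), of "real m" n X] assms unfolding Far_def by simp
  have pCoarse: "?P (Coarse k) \<le> (1 + real D) * sqrt (real (Suc n)) / real m" for k
  proof -
    have "?P (Coarse k) \<le> measure_pmf.expectation (walk D n X) (\<lambda>l. real (visits d (2 ^ J * k) l)) / (real m / 2)"
      unfolding Coarse_def using finite_walk[OF D] assms(4) by (intro markov_pmf) auto
    also have "\<dots> \<le> ((1 + real D) / 2 * sqrt (real (Suc n))) / (real m / 2)"
      using assms by (intro divide_right_mono visits_expectation) auto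
    finally show ?thesis by simp
  qed
  have pFail: "?P (Fail j k) \<le> 4 * (5184 * real D)\<^sup>2 / H\<^sup>2 * (2/5) ^ (J - j)" if j: "j < J" for j k
  proof -
    define i where "i = J - j"
    define x where "x = (162/100) ^ i * H / (5184 * real D)"
    have x: "0 < x" using H D by (simp add: x_def)
    have "?P (Fail j k) \<le> 2 * exp (- ((s j)\<^sup>2 * thr j / (2 * real D * real (2 ^ j))))"
      unfolding Fail_def using thr_half[of j] j s0 thr_Suc
      by (intro visits_contrast[OF assms(2)]) (auto intro: order_trans[of 0 "real m / 2"])
    also have "\<dots> \<le> 2 * exp (- x)"
    proof -
      have p: "(2::real) ^ J = 2 ^ i * 2 ^ j" using j by (simp add: i_def flip: power_add)
      have "x = (81/100) ^ i / 1296 * (real m / 2) / (2 * real D * 2 ^ j)"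
      proof -
        have "(162/100 :: real) ^ i = (81/100) ^ i * 2 ^ i" by (simp flip: power_mult_distrib)
        then show ?thesis unfolding x_def H_def p by simp
      qed
      also have "(81/100 :: real) ^ i / 1296 = (s j)\<^sup>2"
        by (simp add: s_def i_def[symmetric] power_divide power2_eq_square flip: power_mult_distrib)
      also have "(s j)\<^sup>2 * (real m / 2) / (2 * real D * 2 ^ j) \<le> (s j)\<^sup>2 * thr j / (2 * real D * real (2 ^ j))"
        using divide_right_mono[OF mult_left_mono[OF thr_half[of j], of "(s j)\<^sup>2"], of "2 * real D * 2 ^ j"] j by simp
      finally show ?thesis by simp
    qed
    also have "\<dots> \<le> 2 * (2 / x\<^sup>2)" using exp_neg_le[OF x] by simp
    also have "\<dots> = 4 * (5184 * real D)\<^sup>2 / H\<^sup>2 * (1 / (162/100)\<^sup>2) ^ i"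
    proof -
      define a where "a = (162/100 :: real) ^ i"
      have a2: "a\<^sup>2 = ((162/100)\<^sup>2) ^ i" by (simp only: a_def power_mult[symmetric] mult.commute)
      have xa: "x = a * H / (5184 * real D)" by (simp only: x_def a_def)
      have "2 * (2 / x\<^sup>2) = 4 * (5184 * real D)\<^sup>2 / H\<^sup>2 * (1 / a\<^sup>2)"
        unfolding xa by (simp add: power_mult_distrib power_divide)
      then show ?thesis by (simp only: a2 power_one_over)
    qed
    also have "\<dots> \<le> 4 * (5184 * real D)\<^sup>2 / H\<^sup>2 * (2/5) ^ i"
      by (intro mult_left_mono power_mono) (auto simp: power2_eq_square)
    finally show ?thesis by (simp add: i_def)
  qed
  have "?P (Far \<union> (\<Union>k\<in>K J. Coarse k) \<union> (\<Union>j<J. \<Union>k\<in>K j. Fail j k)) \<le>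
     ?P Far + ?P (\<Union>k\<in>K J. Coarse k) + ?P (\<Union>j<J. \<Union>k\<in>K j. Fail j k)"
    using measure_Un_le[of "Far \<union> (\<Union>k\<in>K J. Coarse k)" "walk D n X" "\<Union>j<J. \<Union>k\<in>K j. Fail j k"]
      measure_Un_le[of Far "walk D n X" "\<Union>k\<in>K J. Coarse k"] by simp
  also have "\<dots> \<le> real n / (real m)\<^sup>2 + (\<Sum>k\<in>K J. ?P (Coarse k)) + (\<Sum>j<J. \<Sum>k\<in>K j. ?P (Fail j k))"
  proof (intro add_mono pFar)
    show "?P (\<Union>k\<in>K J. Coarse k) \<le> (\<Sum>k\<in>K J. ?P (Coarse k))"
      by (intro measure_pmf.finite_measure_subadditive_finite) (auto simp: K_def)
    have "?P (\<Union>j<J. \<Union>k\<in>K j. Fail j k) \<le> (\<Sum>j<J. ?P (\<Union>k\<in>K j. Fail j k))"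
      by (intro measure_pmf.finite_measure_subadditive_finite) auto
    also have "\<dots> \<le> (\<Sum>j<J. \<Sum>k\<in>K j. ?P (Fail j k))"
      by (intro sum_mono measure_pmf.finite_measure_subadditive_finite) (auto simp: K_def)
    finally show "?P (\<Union>j<J. \<Union>k\<in>K j. Fail j k) \<le> (\<Sum>j<J. \<Sum>k\<in>K j. ?P (Fail j k))" .
  qed
  also have "(\<Sum>k\<in>K J. ?P (Coarse k)) \<le> real (card (K J)) * ((1 + real D) * sqrt (real (Suc n)) / real m)"
    by (intro sum_bounded_above pCoarse)
  also have "\<dots> \<le> (2 * H + 3) * ((1 + real D) * sqrt (real (Suc n)) / real m)"
    using cK[of J] by (intro mult_right_mono) auto
  also have "(\<Sum>j<J. \<Sum>k\<in>K j. ?P (Fail j k)) \<le> (\<Sum>j<J. (2 * H + 3) * (4 * (5184 * real D)\<^sup>2 / H\<^sup>2) * (4/5) ^ (J - j))"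
  proof (rule sum_mono)
    fix j assume "j \<in> {..<J}"
    then have j: "j < J" by simp
    have "(\<Sum>k\<in>K j. ?P (Fail j k)) \<le> real (card (K j)) * (4 * (5184 * real D)\<^sup>2 / H\<^sup>2 * (2/5) ^ (J - j))"
      by (intro sum_bounded_above pFail j)
    also have "\<dots> \<le> ((2 * H + 3) * 2 ^ (J - j)) * (4 * (5184 * real D)\<^sup>2 / H\<^sup>2 * (2/5) ^ (J - j))"
      using cK[of j] j by (intro mult_right_mono) auto
    also have "\<dots> = (2 * H + 3) * (4 * (5184 * real D)\<^sup>2 / H\<^sup>2) * (2 ^ (J - j) * (2/5) ^ (J - j))" by (simp add: mult_ac)
    also have "(2::real) ^ (J - j) * (2/5) ^ (J - j) = (4/5) ^ (J - j)" by (simp flip: power_mult_distrib)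
    finally show "(\<Sum>k\<in>K j. ?P (Fail j k)) \<le> (2 * H + 3) * (4 * (5184 * real D)\<^sup>2 / H\<^sup>2) * (4/5) ^ (J - j)" .
  qed
  also have "\<dots> = (2 * H + 3) * (4 * (5184 * real D)\<^sup>2 / H\<^sup>2) * (\<Sum>j<J. (4/5) ^ (J - j))" by (simp add: sum_distrib_left)
  also have "\<dots> \<le> (2 * H + 3) * (4 * (5184 * real D)\<^sup>2 / H\<^sup>2) * 4"
    using H geometric_sum_bound[of "4/5" J] by (intro mult_left_mono) auto
  finally have "?P (Far \<union> (\<Union>k\<in>K J. Coarse k) \<union> (\<Union>j<J. \<Union>k\<in>K j. Fail j k)) \<le>
    real n / (real m)\<^sup>2 + (2 * H + 3) * ((1 + real D) * sqrt (real (Suc n)) / real m)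
     + (2 * H + 3) * (4 * (5184 * real D)\<^sup>2 / H\<^sup>2) * 4" by simp
  moreover have "?P {l. \<exists>z. m \<le> visits d z l} \<le> ?P (Far \<union> (\<Union>k\<in>K J. Coarse k) \<union> (\<Union>j<J. \<Union>k\<in>K j. Fail j k))"
    by (intro measure_pmf.finite_measure_mono cover) auto
  moreover have "(2 * H + 3) * (4 * (5184 * real D)\<^sup>2 / H\<^sup>2) * 4 = (2 * H + 3) * (16 * (5184 * real D)\<^sup>2 / H\<^sup>2)" by simp
  ultimately show ?thesis by linarith
qed

text \<open>In the explicit bound \<open>H = m / 2 ^ J\<close> is first chosen large and of bounded size, which makes the last
  term small; then \<open>c\<close> is chosen small, which makes the first two terms small.\<close>

lemma max_visits_tight:
  assumes "d < D" "0 < \<epsilon>"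
  obtains c :: real and m0 :: nat where "0 < c"
    "\<And>m n X. m0 \<le> m \<Longrightarrow> real (Suc n) \<le> c * (real m)\<^sup>2 \<Longrightarrow> X d = 0 \<Longrightarrow>
      measure_pmf.prob (walk D n X) {l. \<exists>z. m \<le> visits d z l} \<le> \<epsilon>"
proof -
  define C where "C = 16 * (5184 * real D)\<^sup>2"
  have C: "0 \<le> C" by (simp add: C_def)
  define H0 where "H0 = max 1 (15 * C / \<epsilon>)"
  have H0: "1 \<le> H0" "5 * C / H0 \<le> \<epsilon> / 3"
  proof -
    show h: "1 \<le> H0" by (simp add: H0_def)
    have "15 * C / \<epsilon> \<le> H0" by (simp add: H0_def)
    then show "5 * C / H0 \<le> \<epsilon> / 3" using h assms(2) by (simp add: field_simps)
  qed
  define a where "a = min 1 (\<epsilon> / 3 / ((4 * H0 + 3) * (1 + real D)))"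
  have a: "0 < a" using H0 assms by (auto simp: a_def intro!: divide_pos_pos mult_pos_pos)
  define c where "c = min (\<epsilon> / 3) (a\<^sup>2)"
  have c: "0 < c" using a assms by (simp add: c_def)
  show thesis
  proof (rule that[of c "nat \<lceil>H0\<rceil>"])
    fix m n :: nat and X :: "nat \<Rightarrow> int"
    assume m: "nat \<lceil>H0\<rceil> \<le> m" and n: "real (Suc n) \<le> c * (real m)\<^sup>2" and X: "X d = 0"
    have mH: "H0 \<le> real m" using m by linarith
    have m1: "1 \<le> m" using mH H0 by linarith
    \<comment> \<open>With this choice \<open>H = m / 2 ^ J\<close> lies between \<open>H0\<close> and \<open>2 * H0\<close>.\<close>
    define J where "J = (GREATEST j. 2 ^ j * H0 \<le> real m)"
    have bd: "\<forall>j. 2 ^ j * H0 \<le> real m \<longrightarrow> j \<le> m"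
    proof (intro allI impI)
      fix j :: nat assume "2 ^ j * H0 \<le> real m"
      moreover have "2 ^ j * 1 \<le> 2 ^ j * H0" using H0 by (intro mult_left_mono) auto
      moreover have "real j \<le> 2 ^ j" using less_exp[of j] by (metis less_imp_le of_nat_le_iff of_nat_numeral of_nat_power)
      ultimately show "j \<le> m" by linarith
    qed
    have J1: "2 ^ J * H0 \<le> real m"
      unfolding J_def by (rule GreatestI_nat[where k = 0 and b = m]) (use bd mH in auto)
    have J2: "real m < 2 ^ Suc J * H0"
    proof (rule ccontr)
      assume "\<not> ?thesis"
      then have "Suc J \<le> J" unfolding J_def using bd by (intro Greatest_le_nat[where b = m]) (auto simp: J_def)
      then show False by simp
    qed
    define H where "H = real m / 2 ^ J"
    have H: "H0 \<le> H" "H \<le> 2 * H0" using J1 J2 by (auto simp: H_def field_simps)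
    have b1: "real n / (real m)\<^sup>2 \<le> \<epsilon> / 3"
    proof -
      have "real n \<le> c * (real m)\<^sup>2" using n by simp
      then have "real n / (real m)\<^sup>2 \<le> c" using m1 by (simp add: divide_le_eq)
      then show ?thesis by (simp add: c_def)
    qed
    have b2: "(2 * H + 3) * ((1 + real D) * sqrt (real (Suc n)) / real m) \<le> \<epsilon> / 3"
    proof -
      have "real (Suc n) \<le> (a * real m)\<^sup>2"
      proof -
        have "c * (real m)\<^sup>2 \<le> a\<^sup>2 * (real m)\<^sup>2" by (intro mult_right_mono) (auto simp: c_def)
        then show ?thesis using n by (simp add: power_mult_distrib)
      qed
      then have "sqrt (real (Suc n)) \<le> a * real m" using a by (intro real_le_lsqrt) auto
      then have q: "sqrt (real (Suc n)) / real m \<le> a" using m1 by (simp add: divide_le_eq)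
      have "(2 * H + 3) * ((1 + real D) * (sqrt (real (Suc n)) / real m)) \<le> (4 * H0 + 3) * ((1 + real D) * a)"
        using H H0 q a by (intro mult_mono mult_left_mono) auto
      also have "\<dots> = ((4 * H0 + 3) * (1 + real D)) * a" by simp
      also have "\<dots> \<le> ((4 * H0 + 3) * (1 + real D)) * (\<epsilon> / 3 / ((4 * H0 + 3) * (1 + real D)))"
        using H0 by (intro mult_left_mono) (auto simp: a_def)
      also have "\<dots> = \<epsilon> / 3" using H0 by simp
      finally show ?thesis by simp
    qed
    have b3: "(2 * H + 3) * (C / H\<^sup>2) \<le> \<epsilon> / 3"
    proof -
      have "(2 * H + 3) * (C / H\<^sup>2) \<le> (5 * H) * (C / H\<^sup>2)" using H H0 C by (intro mult_right_mono) auto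
      also have "\<dots> = 5 * C / H" using H H0 by (simp add: power2_eq_square)
      also have "\<dots> \<le> 5 * C / H0" using H H0 C by (intro divide_left_mono) auto
      finally show ?thesis using H0 by simp
    qed
    show "measure_pmf.prob (walk D n X) {l. \<exists>z. m \<le> visits d z l} \<le> \<epsilon>"
      using max_visits_explicit[where X = X and J = J and n = n, OF assms(1) X m1] b1 b2 b3 unfolding H_def[symmetric] C_def[symmetric] by linarith
  qed (rule c)
qed

section \<open>Heat kernel bounds and discounted hitting probabilities\<close>

lemma nudge_commute: "nudge (nudge X i s) j t = nudge (nudge X j t) i s"
  by (auto simp: nudge_def fun_eq_iff)

lemma nudge_other [simp]: "i \<noteq> j \<Longrightarrow> nudge X i s j = X j"
  by (simp add: nudge_def)

text \<open>The function \<open>b\<close> of the height, restricted to those points whose coordinates in \<open>I\<close> agree with \<open>y\<close>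
  modulo \<open>N\<close>, after \<open>\<nu> i\<close> steps of averaging in each direction \<open>i \<in> I\<close>.\<close>

definition heat_profile :: "nat \<Rightarrow> nat \<Rightarrow> nat set \<Rightarrow> (nat \<Rightarrow> int) \<Rightarrow> (int \<Rightarrow> real) \<Rightarrow> (nat \<Rightarrow> nat) \<Rightarrow> (nat \<Rightarrow> int) \<Rightarrow> real" where
  "heat_profile N d I y b \<nu> X = b (X d) * (\<Prod>i\<in>I. cycle_kernel N (\<nu> i) (X i - y i))"

lemma heat_profile_nudge:
  assumes "finite I" "i \<in> I" "d \<notin> I"
  shows "heat_profile N d I y b \<nu> (nudge X i 1) + heat_profile N d I y b \<nu> (nudge X i (-1)) = 2 * heat_profile N d I y b (\<nu>(i := Suc (\<nu> i))) X"
proof -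
  have id: "i \<noteq> d" using assms by blast
  have *: "(\<Prod>j\<in>I. cycle_kernel N (\<nu> j) (nudge X i s j - y j)) = cycle_kernel N (\<nu> i) (X i + s - y i) * (\<Prod>j\<in>I - {i}. cycle_kernel N (\<nu> j) (X j - y j))" for s
    unfolding prod.remove[OF assms(1,2)] by (intro arg_cong2[where f = "(*)"] prod.cong) (auto simp: nudge_def)
  have **: "(\<Prod>j\<in>I. cycle_kernel N ((\<nu>(i := Suc (\<nu> i))) j) (X j - y j)) = cycle_kernel N (Suc (\<nu> i)) (X i - y i) * (\<Prod>j\<in>I - {i}. cycle_kernel N (\<nu> j) (X j - y j))"
    unfolding prod.remove[OF assms(1,2)] by (intro arg_cong2[where f = "(*)"] prod.cong) auto
  have e: "X i + 1 - y i = X i - y i + 1" "X i + - 1 - y i = X i - y i - 1" by simp_all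
  show ?thesis unfolding heat_profile_def * ** nudge_other[OF id] e by (simp add: algebra_simps)
qed

text \<open>Averaging in a horizontal direction commutes with the Feynman-Kac semigroup of a potential that
  depends only on the height.\<close>

lemma feynman_kac_heat_profile_nudge:
  assumes "finite I" "i \<in> I" "d \<notin> I"
  shows "feynman_kac D (\<lambda>X. \<omega> (X d)) k (heat_profile N d I y b \<nu>) (nudge X i 1) + feynman_kac D (\<lambda>X. \<omega> (X d)) k (heat_profile N d I y b \<nu>) (nudge X i (-1))
     = 2 * feynman_kac D (\<lambda>X. \<omega> (X d)) k (heat_profile N d I y b (\<nu>(i := Suc (\<nu> i)))) X"
proof (induction k arbitrary: X)
  case 0
  then show ?case unfolding feynman_kac.simps by (rule heat_profile_nudge[OF assms])
next
  case (Suc k)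
  define \<phi> where "\<phi> = feynman_kac D (\<lambda>X. \<omega> (X d)) k (heat_profile N d I y b \<nu>)"
  define \<psi> where "\<psi> = feynman_kac D (\<lambda>X. \<omega> (X d)) k (heat_profile N d I y b (\<nu>(i := Suc (\<nu> i))))"
  have IH: "\<phi> (nudge X i 1) + \<phi> (nudge X i (-1)) = 2 * \<psi> X" for X unfolding \<phi>_def \<psi>_def by (rule Suc)
  have id: "i \<noteq> d" using assms by blast
  have "step_avg D \<phi> (nudge X i 1) + step_avg D \<phi> (nudge X i (-1)) =
    (\<Sum>j<D. (\<phi> (nudge (nudge X i 1) j 1) + \<phi> (nudge (nudge X i (-1)) j 1)) + (\<phi> (nudge (nudge X i 1) j (-1)) + \<phi> (nudge (nudge X i (-1)) j (-1)))) / (2 * real D)"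
    unfolding step_avg_def by (simp add: sum.distrib add_divide_distrib algebra_simps)
  also have "\<dots> = (\<Sum>j<D. 2 * (\<psi> (nudge X j 1) + \<psi> (nudge X j (-1)))) / (2 * real D)"
    unfolding nudge_commute[of X i] IH by (simp add: algebra_simps)
  also have "\<dots> = 2 * step_avg D \<psi> X" unfolding step_avg_def sum_distrib_left[symmetric] by simp
  finally have "\<omega> (X d) * (step_avg D \<phi> (nudge X i 1) + step_avg D \<phi> (nudge X i (-1))) = \<omega> (X d) * (2 * step_avg D \<psi> X)" by simp
  then show ?case unfolding feynman_kac.simps nudge_other[OF id] \<phi>_def[symmetric] \<psi>_def[symmetric] by (simp add: distrib_left)
qed

lemma feynman_kac_vertical:
  assumes "d < D"
  shows "\<exists>G. \<forall>X. feynman_kac D (\<lambda>X. \<omega> (X d)) k (\<lambda>X. b (X d)) X = G (X d)"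
proof (induction k)
  case 0
  then show ?case by auto
next
  case (Suc k)
  then obtain G where G: "feynman_kac D (\<lambda>X. \<omega> (X d)) k (\<lambda>X. b (X d)) = (\<lambda>X. G (X d))" by blast
  show ?case unfolding feynman_kac.simps G step_avg_coord[OF assms]
    by (intro exI[of _ "\<lambda>z. \<omega> z * (G z + (G (z + 1) + G (z - 1) - 2 * G z) / (2 * real D))"]) simp
qed

text \<open>Given which coordinate moves at which time, the coordinates are independent. Each coordinate in \<open>I\<close>
  that has moved at least \<open>t\<close> times contributes a factor \<open>r\<close>, and the height still carries the
  potential. That a coordinate \<open>i\<close> has moved fewer than \<open>t\<close> times is estimated by the exponential
  moment \<open>exp (t - \<nu> i)\<close>, which loses the factor \<open>\<rho>\<close> in every step. Starting from \<open>\<nu>\<close> earlier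
  moves is what makes the induction on \<open>k\<close> work.\<close>

lemma heat_bound:
  fixes t :: nat and r Bm :: real
  assumes D: "d < D" and I: "I \<subseteq> {..<d}" and w: "\<And>z. 0 \<le> \<omega> z" "\<And>z. \<omega> z \<le> 1"
    and b: "\<And>z. 0 \<le> b z" "\<And>z. b z \<le> Bm" and r: "\<And>n j. t \<le> n \<Longrightarrow> cycle_kernel N n j \<le> r"
  defines "\<rho> \<equiv> 1 - (1 - exp (-1)) / real D"
  shows "feynman_kac D (\<lambda>X. \<omega> (X d)) k (heat_profile N d I y b \<nu>) X \<le>
     r ^ card I * feynman_kac D (\<lambda>X. \<omega> (X d)) k (\<lambda>X. b (X d)) X + Bm * exp (real t) * \<rho> ^ k * (\<Sum>i\<in>I. exp (- real (\<nu> i)))"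
proof (induction k arbitrary: X \<nu>)
  case 0
  have fin: "finite I" using I finite_subset by blast
  have r0: "0 \<le> r" using r[of t 0] cycle_kernel_nonneg[of N t 0] by linarith
  have Bm: "0 \<le> Bm" using b[of 0] by linarith
  have err: "0 \<le> Bm * exp (real t) * (\<Sum>i\<in>I. exp (- real (\<nu> i)))" using Bm by (intro mult_nonneg_nonneg sum_nonneg) auto
  show ?case
  proof (cases "\<forall>i\<in>I. t \<le> \<nu> i")
    case True
    have "(\<Prod>i\<in>I. cycle_kernel N (\<nu> i) (X i - y i)) \<le> (\<Prod>i\<in>I. r)" using True r cycle_kernel_nonneg by (intro prod_mono) auto
    then have "heat_profile N d I y b \<nu> X \<le> b (X d) * r ^ card I" unfolding heat_profile_def using b by (intro mult_left_mono) auto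
    then show ?thesis using err by (simp add: mult.commute)
  next
    case False
    then obtain i where i: "i \<in> I" "\<nu> i < t" by auto
    have "(\<Prod>i\<in>I. cycle_kernel N (\<nu> i) (X i - y i)) \<le> 1" by (intro prod_le_1) (auto simp: cycle_kernel_nonneg cycle_kernel_le_1)
    then have "heat_profile N d I y b \<nu> X \<le> Bm * 1" unfolding heat_profile_def
      using b Bm by (intro mult_mono prod_nonneg) (auto simp: cycle_kernel_nonneg)
    \<comment> \<open>Some coordinate has moved too rarely: the error term alone dominates.\<close>
    also have "\<dots> \<le> Bm * (exp (real t) * exp (- real (\<nu> i)))"
      using i Bm by (intro mult_left_mono) (auto simp flip: exp_add)
    also have "\<dots> \<le> Bm * (exp (real t) * (\<Sum>i\<in>I. exp (- real (\<nu> i))))"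
      using i fin Bm by (intro mult_left_mono member_le_sum) auto
    also have "\<dots> \<le> r ^ card I * b (X d) + \<dots>" using b r0 by simp
    finally show ?thesis by (simp add: mult.assoc)
  qed
next
  case (Suc k)
  define W where "W = (\<lambda>X :: nat \<Rightarrow> int. \<omega> (X d))"
  have fin: "finite I" using I finite_subset by blast
  have dI: "d \<notin> I" using I by auto
  have D1: "D \<ge> 1" using D by simp
  define F where "F = feynman_kac D W k (\<lambda>X. b (X d))"
  define \<phi> where "\<phi> = feynman_kac D W k (heat_profile N d I y b \<nu>)"
  define c where "c = Bm * exp (real t) * \<rho> ^ k"
  define E where "E = (\<Sum>i\<in>I. exp (- real (\<nu> i)))"
  have \<rho>: "0 \<le> \<rho>"
  proof -
    have "(1 - exp (-1)) / real D \<le> 1" using D1 by (intro divide_le_eq_1_pos[THEN iffD2]) (auto intro: order_trans[of _ 1])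
    then show ?thesis by (simp add: \<rho>_def)
  qed
  have Bm: "0 \<le> Bm" using b[of 0] by linarith
  have c0: "0 \<le> c" using \<rho> Bm by (simp add: c_def)
  have E0: "0 \<le> E" by (simp add: E_def sum_nonneg)
  obtain G where G: "\<And>X. F X = G (X d)" using feynman_kac_vertical[OF D, of \<omega> k b] unfolding F_def W_def by blast
  have pair: "\<phi> (nudge X j 1) + \<phi> (nudge X j (-1)) \<le> r ^ card I * (F (nudge X j 1) + F (nudge X j (-1))) + 2 * c * (E - (if j \<in> I then (1 - exp (-1)) * exp (- real (\<nu> j)) else 0))" if "j < D" for j
  proof (cases "j \<in> I")
    case True
    then have jd: "j \<noteq> d" using dI by blast
    have "\<phi> (nudge X j 1) + \<phi> (nudge X j (-1)) = 2 * feynman_kac D W k (heat_profile N d I y b (\<nu>(j := Suc (\<nu> j)))) X"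
      unfolding \<phi>_def W_def by (rule feynman_kac_heat_profile_nudge[OF fin True dI])
    also have "\<dots> \<le> 2 * (r ^ card I * F X + c * (\<Sum>i\<in>I. exp (- real ((\<nu>(j := Suc (\<nu> j))) i))))"
      unfolding F_def W_def c_def by (intro mult_left_mono Suc) simp
    also have "(\<Sum>i\<in>I. exp (- real ((\<nu>(j := Suc (\<nu> j))) i))) = E - (1 - exp (-1)) * exp (- real (\<nu> j))"
    proof -
      have "(\<Sum>i\<in>I. exp (- real ((\<nu>(j := Suc (\<nu> j))) i))) = exp (- real (Suc (\<nu> j))) + (\<Sum>i\<in>I - {j}. exp (- real (\<nu> i)))"
        unfolding sum.remove[OF fin True] by (intro arg_cong2[where f = "(+)"] sum.cong) auto
      moreover have "E = exp (- real (\<nu> j)) + (\<Sum>i\<in>I - {j}. exp (- real (\<nu> i)))"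
        unfolding E_def by (rule sum.remove[OF fin True])
      moreover have "exp (- real (Suc (\<nu> j))) = exp (-1) * exp (- real (\<nu> j))" by (simp flip: exp_add)
      ultimately show ?thesis by (simp add: algebra_simps)
    qed
    also have "F X = (F (nudge X j 1) + F (nudge X j (-1))) / 2" unfolding G nudge_other[OF jd] by simp
    finally show ?thesis using True by (simp add: algebra_simps add_divide_distrib)
  next
    case False
    have "\<phi> (nudge X j s) \<le> r ^ card I * F (nudge X j s) + c * E" for s
      unfolding \<phi>_def F_def W_def c_def E_def by (rule Suc)
    from this[of 1] this[of "-1"] False show ?thesis by (simp add: algebra_simps)
  qed
  have sumE: "(\<Sum>j<D. E - (if j \<in> I then (1 - exp (-1)) * exp (- real (\<nu> j)) else 0)) = real D * E - (1 - exp (-1)) * E"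
  proof -
    have "(\<Sum>j<D. if j \<in> I then (1 - exp (-1)) * exp (- real (\<nu> j)) else 0) = (\<Sum>j\<in>{..<D} \<inter> I. (1 - exp (-1)) * exp (- real (\<nu> j)))"
      by (simp add: sum.inter_restrict)
    also have "{..<D} \<inter> I = I" using I D by auto
    finally show ?thesis by (simp add: sum_subtractf E_def flip: sum_distrib_left)
  qed
  have "step_avg D \<phi> X \<le> (\<Sum>j<D. r ^ card I * (F (nudge X j 1) + F (nudge X j (-1))) + 2 * c * (E - (if j \<in> I then (1 - exp (-1)) * exp (- real (\<nu> j)) else 0))) / (2 * real D)"
    unfolding step_avg_def using pair by (intro divide_right_mono sum_mono) auto
  also have "\<dots> = (r ^ card I * (\<Sum>j<D. F (nudge X j 1) + F (nudge X j (-1))) + 2 * c * (real D * E - (1 - exp (-1)) * E)) / (2 * real D)"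
    unfolding sum.distrib[of "\<lambda>j. r ^ card I * (F (nudge X j 1) + F (nudge X j (-1)))"] sumE[symmetric] by (simp only: sum_distrib_left)
  also have "\<dots> = r ^ card I * step_avg D F X + c * (\<rho> * E)"
    using D1 unfolding step_avg_def \<rho>_def by (simp add: field_simps)
  finally have "W X * step_avg D \<phi> X \<le> W X * (r ^ card I * step_avg D F X + c * (\<rho> * E))"
    using w by (intro mult_left_mono) (auto simp: W_def)
  also have "\<dots> = r ^ card I * (W X * step_avg D F X) + W X * (c * (\<rho> * E))" by (simp add: algebra_simps)
  also have "W X * (c * (\<rho> * E)) \<le> 1 * (c * (\<rho> * E))" using w c0 \<rho> E0 by (intro mult_right_mono) (auto simp: W_def)
  finally show ?case unfolding W_def[symmetric] feynman_kac.simps \<phi>_def[symmetric] F_def[symmetric] E_def[symmetric] c_def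
    by (simp add: mult_ac)
qed

text \<open>The discounted probability that \<open>T\<close> holds at one of the times \<open>0, \<dots>, n\<close>: a trajectory that first
  satisfies \<open>T\<close> at time \<open>k\<close> counts with the product of \<open>w\<close> over the times before \<open>k\<close>.\<close>

primrec hit :: "nat \<Rightarrow> ((nat \<Rightarrow> int) \<Rightarrow> real) \<Rightarrow> ((nat \<Rightarrow> int) \<Rightarrow> bool) \<Rightarrow> nat \<Rightarrow> (nat \<Rightarrow> int) \<Rightarrow> real" where
  "hit D w T 0 X = (if T X then 1 else 0)"
| "hit D w T (Suc n) X = (if T X then 1 else w X * step_avg D (hit D w T n) X)"

lemma hit_bounds:
  assumes "D \<ge> 1" "\<And>X. 0 \<le> w X" "\<And>X. w X \<le> 1"
  shows "0 \<le> hit D w T n X \<and> hit D w T n X \<le> 1"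
proof (induction n arbitrary: X)
  case (Suc n)
  have "0 \<le> step_avg D (hit D w T n) X" using Suc by (intro step_avg_nonneg) auto
  moreover have "step_avg D (hit D w T n) X \<le> 1"
    using step_avg_mono[of "hit D w T n" "\<lambda>_. 1" D X] Suc step_avg_const[OF assms(1), of 1 X] by simp
  ultimately have "0 \<le> w X * step_avg D (hit D w T n) X" "w X * step_avg D (hit D w T n) X \<le> 1"
    using assms Suc by (auto intro!: mult_le_one)
  then show ?case by simp
qed auto

lemma hit_Suc_mono:
  assumes "D \<ge> 1" "\<And>X. 0 \<le> w X"  "\<And>X. w X \<le> 1"
  shows "hit D w T n X \<le> hit D w T (Suc n) X"
proof (induction n arbitrary: X)
  case 0
  have "0 \<le> w X * step_avg D (hit D w T 0) X" using assms by (intro mult_nonneg_nonneg step_avg_nonneg) auto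
  then show ?case by simp
next
  case (Suc n)
  have "w X * step_avg D (hit D w T n) X \<le> w X * step_avg D (hit D w T (Suc n)) X"
    by (intro mult_left_mono step_avg_mono Suc assms)
  then show ?case by simp
qed

text \<open>A visit to \<open>A\<close> up to time \<open>K\<close> is a visit to the larger set \<open>F\<close>, and later visits are estimated by
  their discounted expected number.\<close>

lemma hit_decomp:
  assumes D: "D \<ge> 1" and w: "\<And>X. 0 \<le> w X" "\<And>X. w X \<le> 1" and AF: "\<And>X. A X \<Longrightarrow> F X"
  shows "hit D w A n X \<le> hit D (\<lambda>_. 1) F K X + (\<Sum>k\<in>{K<..n}. feynman_kac D w k (\<lambda>X. if A X then 1 else 0) X)"
proof (induction K arbitrary: n X)
  case 0
  have "hit D w A n X \<le> (\<Sum>k\<in>{..n}. feynman_kac D w k (\<lambda>X. if A X then 1 else 0) X)" for n X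
  proof (induction n arbitrary: X)
    case (Suc n)
    let ?f = "\<lambda>k. feynman_kac D w k (\<lambda>X. if A X then 1 else 0)"
    have nn: "0 \<le> ?f k X" for k X using w by (intro feynman_kac_nonneg) auto
    have "w X * step_avg D (hit D w A n) X \<le> w X * step_avg D (\<lambda>X. \<Sum>k\<le>n. ?f k X) X"
      using Suc w by (intro mult_left_mono step_avg_mono) auto
    also have "\<dots> = (\<Sum>k\<le>n. ?f (Suc k) X)" by (simp add: step_avg_sum sum_distrib_left)
    finally have 1: "w X * step_avg D (hit D w A n) X \<le> (\<Sum>k\<le>n. ?f (Suc k) X)" .
    have "(\<Sum>k\<le>Suc n. ?f k X) = (if A X then 1 else 0) + (\<Sum>k\<le>n. ?f (Suc k) X)"
      by (subst sum.atMost_Suc_shift) simp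
    moreover have "0 \<le> (\<Sum>k\<le>n. ?f (Suc k) X)" by (intro sum_nonneg nn)
    ultimately show ?case using 1 by (auto simp del: feynman_kac.simps)
  qed simp
  from this[of n X] have "hit D w A n X \<le> (if A X then 1 else 0) + (\<Sum>k\<in>{0<..n}. feynman_kac D w k (\<lambda>X. if A X then 1 else 0) X)"
    by (simp add: sum.head atMost_atLeast0)
  then show ?case using AF[of X] by (auto split: if_splits)
next
  case (Suc K)
  let ?f = "\<lambda>k. feynman_kac D w k (\<lambda>X. if A X then 1 else 0)"
  have nn: "0 \<le> ?f k X" for k X using w by (intro feynman_kac_nonneg) auto
  have hb1: "0 \<le> hit D w A n X \<and> hit D w A n X \<le> 1" for n by (rule hit_bounds[OF D w])
  have hb2: "0 \<le> hit D (\<lambda>_. 1) F n X \<and> hit D (\<lambda>_. 1) F n X \<le> 1" for n X by (rule hit_bounds[OF D]) auto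
  have nns: "0 \<le> (\<Sum>k\<in>S. ?f k X)" for S by (intro sum_nonneg nn)
  show ?case
  proof (cases "F X")
    case True
    then show ?thesis using hb1[of n] nns[of "{Suc K<..n}"] by simp
  next
    case False
    then have nA: "\<not> A X" using AF by blast
    show ?thesis
    proof (cases n)
      case 0
      have "0 \<le> hit D (\<lambda>_. 1) F (Suc K) X" using hb2[of "Suc K"] by blast
      then show ?thesis using 0 nA by simp
    next
      case (Suc m)
      have "hit D w A n X = w X * step_avg D (hit D w A m) X" using nA Suc by simp
      also have "\<dots> \<le> w X * step_avg D (\<lambda>X. hit D (\<lambda>_. 1) F K X + (\<Sum>k\<in>{K<..m}. ?f k X)) X"
        using w Suc.IH by (intro mult_left_mono step_avg_mono) auto
      also have "\<dots> = w X * step_avg D (hit D (\<lambda>_. 1) F K) X + (\<Sum>k\<in>{K<..m}. ?f (Suc k) X)"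
        by (simp add: step_avg_add step_avg_sum sum_distrib_left distrib_left)
      also have "(\<Sum>k\<in>{K<..m}. ?f (Suc k) X) = (\<Sum>k\<in>{Suc K<..n}. ?f k X)"
      proof -
        have "{Suc K<..n} = Suc ` {K<..m}" unfolding Suc using image_Suc_atLeastAtMost[of "Suc K" m]
          by (simp add: atLeastSucAtMost_greaterThanAtMost)
        then show ?thesis by (simp add: sum.reindex)
      qed
      also have "w X * step_avg D (hit D (\<lambda>_. 1) F K) X \<le> 1 * step_avg D (hit D (\<lambda>_. 1) F K) X"
        using w hb2 by (intro mult_right_mono step_avg_nonneg) auto
      also have "\<dots> = hit D (\<lambda>_. 1) F (Suc K) X" using False by simp
      finally show ?thesis by simp
    qed
  qed
qed

text \<open>The visits to \<open>A\<close> form a chain of returns, each of which multiplies the expectation by at most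
  \<open>\<theta> q\<close>: the bound \<open>B\<close> solves \<open>\<theta> (1 + B q) = B\<close>.\<close>

lemma feynman_kac_reward_bound:
  assumes D: "D \<ge> 1" and w: "\<And>X. 0 \<le> w X" "\<And>X. w X \<le> 1"
    and ret: "\<And>n X. A X \<Longrightarrow> w X * step_avg D (hit D w A n) X \<le> q"
    and q: "0 \<le> q" "\<theta> * q < 1" "1 \<le> \<theta>"
  defines "B \<equiv> \<theta> / (1 - \<theta> * q)"
  shows "feynman_kac D (\<lambda>X. (if A X then \<theta> else 1) * w X) n (\<lambda>_. 1) X \<le> (if A X then B else 1 + B * hit D w A n X)"
proof (induction n arbitrary: X)
  have B1: "1 \<le> B"
  proof -
    have "1 - \<theta> * q \<le> \<theta>" using q mult_nonneg_nonneg[of \<theta> q] by linarith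
    then show ?thesis unfolding B_def using q by (simp add: le_divide_eq)
  qed
  have Beq: "\<theta> * (1 + B * q) = B"
  proof -
    have "1 + B * q = 1 / (1 - \<theta> * q)" unfolding B_def using q by (simp add: field_simps)
    then show ?thesis unfolding B_def by simp
  qed
  {
    case 0
    show ?case using B1 by auto
  next
    case (Suc n)
    let ?v = "\<lambda>X. (if A X then \<theta> else 1) * w X"
    have hb: "0 \<le> hit D w A n X \<and> hit D w A n X \<le> 1" for X using hit_bounds[OF D w] .
    have IH: "feynman_kac D ?v n (\<lambda>_. 1) X \<le> 1 + B * hit D w A n X" for X
    proof (cases "A X")
      case True
      then have "hit D w A n X = 1" by (cases n) auto
      then show ?thesis using Suc[of X] True by simp
    qed (use Suc[of X] in simp)
    have "step_avg D (feynman_kac D ?v n (\<lambda>_. 1)) X \<le> step_avg D (\<lambda>X. 1 + B * hit D w A n X) X"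
      by (intro step_avg_mono IH)
    also have "\<dots> = 1 + B * step_avg D (hit D w A n) X" by (simp add: step_avg_add step_avg_cmult step_avg_const[OF D])
    finally have 1: "w X * step_avg D (feynman_kac D ?v n (\<lambda>_. 1)) X \<le> w X * (1 + B * step_avg D (hit D w A n) X)"
      using w by (intro mult_left_mono) auto
    also have "\<dots> = w X + B * (w X * step_avg D (hit D w A n) X)" by (simp add: algebra_simps)
    also have "\<dots> \<le> 1 + B * (w X * step_avg D (hit D w A n) X)" using w by simp
    finally have 2: "w X * step_avg D (feynman_kac D ?v n (\<lambda>_. 1)) X \<le> 1 + B * (w X * step_avg D (hit D w A n) X)" .
    show ?case
    proof (cases "A X")
      case True
      have "\<theta> * (w X * step_avg D (feynman_kac D ?v n (\<lambda>_. 1)) X) \<le> \<theta> * (1 + B * q)"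
        using 2 ret[OF True, of n] B1 q by (intro mult_left_mono order_trans[OF 2] add_left_mono) auto
      then show ?thesis using True Beq by (simp add: mult.assoc)
    qed (use 2 in simp)
  }
qed

section \<open>Covering a set of points of the vertical plane\<close>

text \<open>The lift to \<open>\<int>\<^bsup>d+1\<^esup>\<close> of the plane spanned by the horizontal direction \<open>0\<close> and the vertical
  direction \<open>d\<close>.\<close>

definition in_plane :: "nat \<Rightarrow> nat \<Rightarrow> (nat \<Rightarrow> int) \<Rightarrow> bool" where
  "in_plane N d X \<longleftrightarrow> (\<forall>i\<in>{1..<d}. int N dvd X i)"

definition on_set :: "nat \<Rightarrow> nat \<Rightarrow> (int \<times> int) set \<Rightarrow> (nat \<Rightarrow> int) \<Rightarrow> bool" where
  "on_set N d A X \<longleftrightarrow> in_plane N d X \<and> (X 0 mod int N, X d) \<in> A"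

definition level_count :: "(int \<times> int) set \<Rightarrow> int \<Rightarrow> real" where
  "level_count A z = real (card {p \<in> A. snd p = z})"

abbreviation zero_below :: "nat \<Rightarrow> (nat \<Rightarrow> int) \<Rightarrow> bool" where
  "zero_below \<nu> \<equiv> \<lambda>y. \<forall>i<\<nu>. y i = 0"

abbreviation discount :: "real \<Rightarrow> nat \<Rightarrow> (int \<times> int) set \<Rightarrow> (nat \<Rightarrow> int) \<Rightarrow> real" where
  "discount \<kappa> d A X \<equiv> exp (- \<kappa> * level_count A (X d))"

abbreviation covers :: "nat \<Rightarrow> nat \<Rightarrow> (nat \<Rightarrow> int) list \<Rightarrow> (int \<times> int) set \<Rightarrow> bool" where
  "covers N d l A \<equiv> \<forall>p\<in>A. \<exists>x\<in>set l. in_plane N d x \<and> (x 0 mod int N, x d) = p"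

lemma in_plane_iff_zero:
  assumes "\<And>i. i < \<nu> \<Longrightarrow> int N dvd X (Suc i) - y i" "(\<Sum>i<\<nu>. \<bar>y i\<bar>) < int N"
  shows "in_plane N (Suc \<nu>) X \<longleftrightarrow> zero_below \<nu> y"
proof -
  have "int N dvd X (Suc i) \<longleftrightarrow> y i = 0" if i: "i < \<nu>" for i
  proof -
    have "int N dvd X (Suc i) \<longleftrightarrow> int N dvd y i"
      using assms(1)[OF i] by (metis dvd_diff_right_iff dvd_diff_left_iff zdvd_zdiffD diff_diff_eq2 dvd_diff_commute dvd_add_right_iff diff_add_cancel)
    moreover have "\<bar>y i\<bar> \<le> (\<Sum>i<\<nu>. \<bar>y i\<bar>)" using i by (intro member_le_sum) auto
    then have "\<bar>y i\<bar> < int N" using assms(2) by linarith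
    then have "int N dvd y i \<longleftrightarrow> y i = 0" using zdvd_imp_le[of "int N" "\<bar>y i\<bar>"] by fastforce
    ultimately show ?thesis by simp
  qed
  moreover have "in_plane N (Suc \<nu>) X \<longleftrightarrow> (\<forall>i<\<nu>. int N dvd X (Suc i))"
    unfolding in_plane_def by (metis One_nat_def atLeastLessThan_iff le_add1 less_Suc_eq_0_disj not_less_eq plus_1_eq_Suc not_one_le_zero)
  ultimately show ?thesis by simp
qed

lemma sum_abs_nudge: "i < \<nu> \<Longrightarrow> s \<in> {1,-1} \<Longrightarrow> (\<Sum>j<\<nu>. \<bar>nudge y i s j\<bar>) \<le> (\<Sum>j<\<nu>. \<bar>y j\<bar>) + 1"
proof -
  assume i: "i < \<nu>" "s \<in> {1,-1}"
  have "(\<Sum>j<\<nu>. \<bar>nudge y i s j\<bar>) \<le> (\<Sum>j<\<nu>. \<bar>y j\<bar> + (if j = i then 1 else 0))"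
    using i by (intro sum_mono) (auto simp: nudge_def)
  also have "\<dots> = (\<Sum>j<\<nu>. \<bar>y j\<bar>) + 1" using i by (simp add: sum.distrib)
  finally show ?thesis .
qed

lemma sum_split_ends: "(\<Sum>j<Suc (Suc \<nu>). f j) = f 0 + (\<Sum>i<\<nu>. f (Suc i)) + (f (Suc \<nu>) :: real)"
  unfolding sum.lessThan_Suc[of f "Suc \<nu>"] sum.lessThan_Suc_shift[of f \<nu>] by simp

text \<open>As long as the walk is too short to wind around the torus, the \<open>d - 1\<close> transversal coordinates form
  a lazy walk on \<open>\<int>\<^bsup>d-1\<^esup>\<close>. Laziness only delays it, so it hits \<open>0\<close> within \<open>k\<close> steps with at most
  the probability of the walk without pauses.\<close>

lemma hit_plane_le:
  assumes "\<nu> \<ge> 1" "\<And>i. i < \<nu> \<Longrightarrow> int N dvd X (Suc i) - y i" "(\<Sum>i<\<nu>. \<bar>y i\<bar>) + int k < int N"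
  shows "hit (Suc (Suc \<nu>)) (\<lambda>_. 1) (in_plane N (Suc \<nu>)) k X \<le> hit \<nu> (\<lambda>_. 1) (zero_below \<nu>) k y"
  using assms(2,3)
proof (induction k arbitrary: X y)
  case 0
  then show ?case using in_plane_iff_zero[of \<nu> N X y] by simp
next
  case (Suc k)
  let ?U = "hit (Suc (Suc \<nu>)) (\<lambda>_. 1) (in_plane N (Suc \<nu>))"
  let ?V = "hit \<nu> (\<lambda>_. 1) (zero_below \<nu>)"
  have iff: "in_plane N (Suc \<nu>) X \<longleftrightarrow> zero_below \<nu> y"
    using Suc.prems by (intro in_plane_iff_zero) auto
  have le1: "?U n X \<le> 1" for n X using hit_bounds[of "Suc (Suc \<nu>)" "\<lambda>_. 1"] by simp
  show ?case
  proof (cases "zero_below \<nu> y")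
    case True
    then show ?thesis using le1[of "Suc k" X] by simp
  next
    case False
    have V: "?V (Suc k) y = step_avg \<nu> (?V k) y" by (subst hit.simps(2), subst if_not_P[OF False]) simp
    have "\<not> in_plane N (Suc \<nu>) X" using iff False by blast
    then have U: "?U (Suc k) X = step_avg (Suc (Suc \<nu>)) (?U k) X" by simp
    have mono: "?V k y \<le> ?V (Suc k) y" using assms(1) by (intro hit_Suc_mono) auto
    have ends: "?U k (nudge X j s) \<le> ?V (Suc k) y" if "j = 0 \<or> j = Suc \<nu>" for j s
    proof -
      have "?U k (nudge X j s) \<le> ?V k y"
        using Suc.prems that by (intro Suc.IH) (auto simp: nudge_def)
      then show ?thesis using mono by linarith
    qed
    have mid: "?U k (nudge X (Suc i) s) \<le> ?V k (nudge y i s)" if "i < \<nu>" "s \<in> {1,-1}" for i s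
    proof (rule Suc.IH)
      show "int N dvd nudge X (Suc i) s (Suc j) - nudge y i s j" if "j < \<nu>" for j
        using Suc.prems(1)[OF that] by (auto simp: nudge_def)
      show "(\<Sum>j<\<nu>. \<bar>nudge y i s j\<bar>) + int k < int N"
        using sum_abs_nudge[OF that, of y] Suc.prems(2) by simp
    qed
    have "(\<Sum>j<Suc (Suc \<nu>). ?U k (nudge X j 1) + ?U k (nudge X j (-1)))
      \<le> 2 * ?V (Suc k) y + (\<Sum>i<\<nu>. ?V k (nudge y i 1) + ?V k (nudge y i (-1))) + 2 * ?V (Suc k) y"
      unfolding sum_split_ends using ends[of 0 1] ends[of 0 "-1"] ends[of "Suc \<nu>" 1] ends[of "Suc \<nu>" "-1"]
      by (intro add_mono sum_mono mid) (auto simp del: hit.simps)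
    also have "(\<Sum>i<\<nu>. ?V k (nudge y i 1) + ?V k (nudge y i (-1))) = 2 * real \<nu> * ?V (Suc k) y"
      unfolding V step_avg_def using assms(1) by simp
    finally have "(\<Sum>j<Suc (Suc \<nu>). ?U k (nudge X j 1) + ?U k (nudge X j (-1))) \<le> 2 * real (Suc (Suc \<nu>)) * ?V (Suc k) y"
      by (simp add: algebra_simps del: hit.simps)
    then have "step_avg (Suc (Suc \<nu>)) (?U k) X \<le> ?V (Suc k) y"
      unfolding step_avg_def by (subst pos_divide_le_eq) (auto simp: mult.commute simp del: hit.simps sum.lessThan_Suc)
    then show ?thesis unfolding U .
  qed
qed

text \<open>Four of the \<open>2 (d + 1)\<close> first steps stay in the plane. After any other step the transversal
  coordinates are at distance one from the origin, as after the first step of a walk on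
  \<open>\<int>\<^bsup>d-1\<^esup>\<close>.\<close>

lemma return_to_plane:
  assumes "\<nu> \<ge> 1" "in_plane N (Suc \<nu>) X" "Suc K < N" "step_avg \<nu> (hit \<nu> (\<lambda>_. 1) (zero_below \<nu>) K) (\<lambda>_. 0) \<le> q"
  defines "D \<equiv> Suc (Suc \<nu>)"
  shows "step_avg D (hit D (\<lambda>_. 1) (in_plane N (Suc \<nu>)) K) X \<le> 2 / real D + (1 - 2 / real D) * q"
proof -
  let ?U = "hit D (\<lambda>_. 1) (in_plane N (Suc \<nu>)) K"
  let ?V = "hit \<nu> (\<lambda>_. 1) (zero_below \<nu>) K"
  let ?o = "\<lambda>_. 0 :: int"
  have le1: "?U X \<le> 1" for X using hit_bounds[of D "\<lambda>_. 1"] by (simp add: D_def)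
  have mid: "?U (nudge X (Suc i) s) \<le> ?V (nudge ?o i s)" if "i < \<nu>" "s \<in> {1,-1}" for i s
    unfolding D_def
  proof (rule hit_plane_le[OF assms(1)])
    show "int N dvd nudge X (Suc i) s (Suc j) - nudge ?o i s j" if "j < \<nu>" for j
      using assms(2) that by (auto simp: nudge_def in_plane_def)
    show "(\<Sum>j<\<nu>. \<bar>nudge ?o i s j\<bar>) + int K < int N"
      using sum_abs_nudge[OF that, of ?o] assms(3) by simp
  qed
  have "(\<Sum>j<D. ?U (nudge X j 1) + ?U (nudge X j (-1))) \<le> (1 + 1) + (\<Sum>i<\<nu>. ?V (nudge ?o i 1) + ?V (nudge ?o i (-1))) + (1 + 1)"
    unfolding D_def sum_split_ends unfolding D_def[symmetric] by (intro add_mono sum_mono mid le1) auto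
  also have "(\<Sum>i<\<nu>. ?V (nudge ?o i 1) + ?V (nudge ?o i (-1))) = 2 * real \<nu> * step_avg \<nu> ?V ?o"
    using assms(1) by (simp add: step_avg_def)
  also have "\<dots> \<le> 2 * real \<nu> * q" using assms(4) by (intro mult_left_mono) auto
  finally have "step_avg D ?U X \<le> (4 + 2 * real \<nu> * q) / (2 * real D)"
    unfolding step_avg_def by (intro divide_right_mono) auto
  also have "\<dots> = 2 / real D + (1 - 2 / real D) * q"
  proof -
    have \<nu>: "real \<nu> = real D - 2" and "0 < real D" by (simp_all add: D_def)
    then show ?thesis unfolding \<nu> by (simp add: field_simps)
  qed
  finally show ?thesis .
qed

lemma decay_rate:
  assumes "D \<ge> 1"
  shows "0 \<le> 1 - (1 - exp (-1)) / real D \<and> 1 - (1 - exp (-1)) / real D \<le> exp (- (1 / (2 * real D)))"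
proof -
  have e: "exp (-1) \<le> (1/2 :: real)"
  proof -
    have "2 \<le> exp (1::real)" using exp_ge_add_one_self[of 1] by simp
    then show ?thesis by (simp add: exp_minus inverse_eq_divide field_simps)
  qed
  have "1 / (2 * real D) \<le> (1 - exp (-1)) / real D" using e assms by (simp add: field_simps)
  moreover have "1 - 1 / (2 * real D) \<le> exp (- (1 / (2 * real D)))" using exp_ge_add_one_self[of "- (1 / (2 * real D))"] by simp
  moreover have "(1 - exp (-1)) / real D \<le> 1" using assms by (subst divide_le_eq_1_pos) (auto intro: order_trans[of _ 1])
  ultimately show ?thesis by linarith
qed

lemma decay_power:
  fixes t k :: nat
  assumes "D \<ge> 1" "k \<ge> 1" "real t \<le> real k / (4 * real D)"
  shows "exp (real t) * (1 - (1 - exp (-1)) / real D) ^ k \<le> 32 * (real D)\<^sup>2 / (real k)\<^sup>2"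
proof -
  have "(1 - (1 - exp (-1)) / real D) ^ k \<le> exp (- (1 / (2 * real D))) ^ k"
    using decay_rate[OF assms(1)] by (intro power_mono) auto
  also have "\<dots> = exp (- (real k / (2 * real D)))" by (simp flip: exp_of_nat_mult)
  finally have "exp (real t) * (1 - (1 - exp (-1)) / real D) ^ k \<le> exp (real k / (4 * real D)) * exp (- (real k / (2 * real D)))"
    using assms(3) decay_rate[OF assms(1)] by (intro mult_mono) auto
  also have "\<dots> = exp (- (real k / (4 * real D)))" using assms by (simp flip: exp_add add: field_simps)
  also have "\<dots> \<le> 2 / (real k / (4 * real D))\<^sup>2" using assms by (intro exp_neg_le) auto
  also have "\<dots> = 32 * (real D)\<^sup>2 / (real k)\<^sup>2" by (simp add: power_divide power_mult_distrib)
  finally show ?thesis .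
qed

text \<open>Four of the transversal coordinates already give the decay \<open>k\<^sup>-\<^sup>2 + N\<^sup>-\<^sup>4\<close>. It is summable in \<open>k\<close>
  up to time \<open>N\<^sup>3\<close>, which is more than the mixing time of the torus.\<close>

lemma plane_prob_early:
  assumes d: "5 \<le> d" and N: "1 \<le> N" and k: "8 * Suc d \<le> k"
    and w: "\<And>X. 0 \<le> w X" "\<And>X. w X \<le> 1"
  shows "feynman_kac (Suc d) w k (\<lambda>X. if on_set N d A X then 1 else 0) X \<le> 200000 * (real (Suc d))\<^sup>2 / (real k)\<^sup>2 + 2048 / real N ^ 4"
proof -
  define D where "D = Suc d"
  have D1: "D \<ge> 1" by (simp add: D_def)
  \<comment> \<open>Each coordinate moves about \<open>k / D\<close> times; a quarter of that is exceeded up to an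
    exponentially small error.\<close>
  define t where "t = k div (4 * D)"
  have t4: "real t \<le> real k / (4 * real D)" using of_nat_div_le_of_nat[of k "4 * D", where 'a = real] by (simp add: t_def)
  have t8: "real k / (8 * real D) \<le> real t"
  proof -
    have "k < 4 * D + 4 * D * t" unfolding t_def using D1 by (intro dividend_less_times_div) simp
    then have "real k < real (4 * D + 4 * D * t)" by (simp only: of_nat_less_iff)
    moreover have "real (8 * D) \<le> real k" using k unfolding D_def of_nat_le_iff .
    ultimately have "real k \<le> real t * (8 * real D)" by (simp add: mult.commute)
    then show ?thesis using D1 by (simp add: pos_divide_le_eq)
  qed
  have kpos: "1 \<le> k" using k by simp
  have t1: "1 \<le> t"
  proof -
    have "real (8 * D) \<le> real k" using k unfolding D_def of_nat_le_iff .
    then have "1 \<le> real k / (8 * real D)" using D1 by simp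
    then show ?thesis using t8 by linarith
  qed
  define I :: "nat set" where "I = {1,2,3,4}"
  have I: "I \<subseteq> {..<d}" "card I = 4" using d by (auto simp: I_def)
  define r where "r = 4 * (1 / sqrt (real t) + 1 / real N)"
  have r: "cycle_kernel N n j \<le> r" if "t \<le> n" for n j
  proof -
    have "cycle_kernel N n j \<le> 4 * (1 / sqrt (real n) + 1 / real N)" using that t1 N by (intro cycle_kernel_bound) auto
    also have "\<dots> \<le> r" unfolding r_def using that t1 by (intro mult_left_mono add_right_mono divide_left_mono) auto
    finally show ?thesis .
  qed
  have "feynman_kac D w k (\<lambda>X. if on_set N d A X then 1 else 0) X \<le> feynman_kac D (\<lambda>_. 1) k (\<lambda>X. if on_set N d A X then 1 else 0) X"
    using feynman_kac_mono_weight[of w "\<lambda>_. 1"] w by auto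
  also have "\<dots> \<le> feynman_kac D (\<lambda>X. (\<lambda>_. 1) (X d)) k (heat_profile N d I (\<lambda>_. 0) (\<lambda>_. 1) (\<lambda>_. 0)) X"
  proof (rule feynman_kac_mono)
    fix X show "(if on_set N d A X then 1 else 0) \<le> heat_profile N d I (\<lambda>_. 0) (\<lambda>_. 1) (\<lambda>_. 0) X"
    proof (cases "on_set N d A X")
      case True
      then have "\<forall>i\<in>I. int N dvd X i" using I d by (auto simp: on_set_def in_plane_def I_def)
      then show ?thesis using True by (simp add: heat_profile_def)
    qed (simp add: heat_profile_def prod_nonneg)
  qed simp
  also have "\<dots> \<le> r ^ card I * feynman_kac D (\<lambda>X. (\<lambda>_. 1) (X d)) k (\<lambda>X. (\<lambda>_. 1) (X d)) X + 1 * exp (real t) * (1 - (1 - exp (-1)) / real D) ^ k * (\<Sum>i\<in>I. exp (- real ((\<lambda>_. 0::nat) i)))"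
    using I r by (intro heat_bound) (auto simp: D_def)
  also have "feynman_kac D (\<lambda>X. (\<lambda>_. 1) (X d)) k (\<lambda>X. (\<lambda>_. 1) (X d)) X = 1"
  proof -
    have "feynman_kac D (\<lambda>X. 1) k (\<lambda>X. 1) = (\<lambda>X. 1)"
    proof (induction k)
      case (Suc k)
      show ?case by (rule ext) (simp only: feynman_kac.simps Suc step_avg_const[OF D1] mult_1)
    qed (rule ext, simp)
    then show ?thesis by simp
  qed
  also have "(\<Sum>i\<in>I. exp (- real ((\<lambda>_. 0::nat) i))) = 4" using I by simp
  also have "r ^ card I * 1 \<le> 2048 * (1 / (real t)\<^sup>2 + 1 / real N ^ 4)"
  proof -
    define a b where "a = 1 / sqrt (real t)" and "b = 1 / real N"
    have ab: "0 \<le> a" "0 \<le> b" by (auto simp: a_def b_def)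
    have "(a + b)\<^sup>2 \<le> 2 * (a\<^sup>2 + b\<^sup>2)" using sum_squares_bound[of a b] by (simp add: power2_eq_square algebra_simps)
    then have "((a + b)\<^sup>2)\<^sup>2 \<le> (2 * (a\<^sup>2 + b\<^sup>2))\<^sup>2" by (intro power_mono) auto
    also have "\<dots> \<le> 8 * ((a\<^sup>2)\<^sup>2 + (b\<^sup>2)\<^sup>2)" using sum_squares_bound[of "a\<^sup>2" "b\<^sup>2"] by (simp add: power2_eq_square algebra_simps)
    finally have "(a + b) ^ 4 \<le> 8 * (a ^ 4 + b ^ 4)" by (simp flip: power_mult)
    moreover have "a ^ 4 = 1 / (real t)\<^sup>2"
    proof -
      have "a\<^sup>2 = 1 / real t" by (simp add: a_def power_divide)
      then have "(a\<^sup>2)\<^sup>2 = 1 / (real t)\<^sup>2" by (simp add: power_divide)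
      then show ?thesis by (simp flip: power_mult)
    qed
    moreover have "r ^ card I * 1 = 256 * (a + b) ^ 4"
    proof -
      have "r = 4 * (a + b)" by (simp add: r_def a_def b_def)
      then have "r ^ 4 = 4 ^ 4 * (a + b) ^ 4" by (simp only: power_mult_distrib)
      then show ?thesis using I by simp
    qed
    ultimately show ?thesis by (simp add: b_def power_divide)
  qed
  also have "1 / (real t)\<^sup>2 \<le> 64 * (real D)\<^sup>2 / (real k)\<^sup>2"
  proof -
    have "(real k / (8 * real D))\<^sup>2 \<le> (real t)\<^sup>2" using t8 by (intro power_mono) auto
    then have "1 / (real t)\<^sup>2 \<le> 1 / (real k / (8 * real D))\<^sup>2" using kpos D1 t1 by (intro divide_left_mono mult_pos_pos zero_less_power) auto
    then show ?thesis by (simp add: power_divide power_mult_distrib)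
  qed
  also have "1 * exp (real t) * (1 - (1 - exp (-1)) / real D) ^ k * 4 \<le> 4 * (32 * (real D)\<^sup>2 / (real k)\<^sup>2)"
    using decay_power[OF D1 kpos t4] by simp
  finally have "feynman_kac D w k (\<lambda>X. if on_set N d A X then 1 else 0) X \<le> 2048 * (64 * (real D)\<^sup>2 / (real k)\<^sup>2 + 1 / real N ^ 4) + 4 * (32 * (real D)\<^sup>2 / (real k)\<^sup>2)" by simp
  also have "\<dots> = 131200 * ((real D)\<^sup>2 / (real k)\<^sup>2) + 2048 / real N ^ 4" by simp
  also have "\<dots> \<le> 200000 * ((real D)\<^sup>2 / (real k)\<^sup>2) + 2048 / real N ^ 4" by (intro add_right_mono mult_right_mono) auto
  finally show ?thesis by (simp add: D_def)
qed

lemma level_count_le: "finite A \<Longrightarrow> 0 \<le> level_count A z \<and> level_count A z \<le> real (card A)"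
  unfolding level_count_def by (auto intro!: card_mono)

lemma level_count_eq_sum: "finite A \<Longrightarrow> level_count A z = (\<Sum>p\<in>A. if z = snd p then 1 else 0)"
  unfolding level_count_def by (simp add: sum.If_cases Int_def eq_commute)

text \<open>After time \<open>N\<^sup>3\<close> all horizontal coordinates have moved at least \<open>N\<^sup>2\<close> times, up to a small
  error. The horizontal position is then at a given point with probability at most \<open>(8 / N) ^ d\<close>,
  conditionally on the heights.\<close>

lemma set_prob_late:
  assumes N: "4 * Suc d \<le> N" and k: "N ^ 3 < k" and A: "finite A" "card A = N"
    and w: "\<And>z. 0 \<le> \<omega> z" "\<And>z. \<omega> z \<le> 1" and d: "1 \<le> d"
  shows "feynman_kac (Suc d) (\<lambda>X. \<omega> (X d)) k (\<lambda>X. if on_set N d A X then 1 else 0) X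
    \<le> (8 / real N) ^ d * feynman_kac (Suc d) (\<lambda>X. \<omega> (X d)) k (\<lambda>X. level_count A (X d)) X + real N * (real d * (32 * (real (Suc d))\<^sup>2 / (real k)\<^sup>2))"
proof -
  define D where "D = Suc d"
  define W where "W = (\<lambda>X :: nat \<Rightarrow> int. \<omega> (X d))"
  have D1: "D \<ge> 1" by (simp add: D_def)
  have N1: "1 \<le> N" using N by simp
  define t where "t = N\<^sup>2"
  have t1: "1 \<le> t" using N1 by (simp add: t_def)
  have kpos: "1 \<le> k" using k by simp
  have t4: "real t \<le> real k / (4 * real D)"
  proof -
    have "4 * D * N\<^sup>2 \<le> N * N\<^sup>2" using N by (intro mult_right_mono) (auto simp: D_def)
    also have "\<dots> = N ^ 3" by (simp add: power2_eq_square power3_eq_cube)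
    also have "\<dots> \<le> k" using k by simp
    finally have "real (4 * D * N\<^sup>2) \<le> real k" by (simp only: of_nat_le_iff)
    then show ?thesis using D1 by (simp add: t_def field_simps)
  qed
  have r: "cycle_kernel N n j \<le> 8 / real N" if "t \<le> n" for n j
  proof -
    have "cycle_kernel N n j \<le> 4 * (1 / sqrt (real n) + 1 / real N)" using that t1 N1 by (intro cycle_kernel_bound) auto
    also have "\<dots> \<le> 4 * (1 / sqrt (real t) + 1 / real N)" using that t1 by (intro mult_left_mono add_right_mono divide_left_mono) auto
    also have "sqrt (real t) = real N" by (simp add: t_def)
    finally show ?thesis by simp
  qed
  \<comment> \<open>The horizontal coordinates of the point \<open>p\<close> of the plane.\<close>
  define y where "y p = (\<lambda>i::nat. if i = 0 then fst p else 0)" for p :: "int \<times> int"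
  define g where "g p = heat_profile N d {..<d} (y p) (\<lambda>z. if z = snd p then 1 else 0) (\<lambda>_. 0)" for p :: "int \<times> int"
  have "feynman_kac D W k (\<lambda>X. if on_set N d A X then 1 else 0) X \<le> feynman_kac D W k (\<lambda>X. \<Sum>p\<in>A. g p X) X"
  proof (rule feynman_kac_mono)
    fix X show "(if on_set N d A X then 1 else 0) \<le> (\<Sum>p\<in>A. g p X)"
    proof (cases "on_set N d A X")
      case True
      define p where "p = (X 0 mod int N, X d)"
      have p: "p \<in> A" using True by (simp add: on_set_def p_def)
      have "int N dvd X i - y p i" if "i < d" for i
      proof (cases "i = 0")
        case True
        then show ?thesis by (simp add: y_def p_def)
      next
        case False
        then show ?thesis using \<open>on_set N d A X\<close> that by (auto simp: y_def on_set_def in_plane_def)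
      qed
      then have "g p X = 1" by (simp add: g_def heat_profile_def p_def)
      moreover have "g p X \<le> (\<Sum>p\<in>A. g p X)" using p A by (intro member_le_sum) (auto simp: g_def heat_profile_def intro!: mult_nonneg_nonneg prod_nonneg)
      ultimately show ?thesis using True by simp
    qed (auto simp: g_def heat_profile_def intro!: sum_nonneg mult_nonneg_nonneg prod_nonneg)
  qed (use w in \<open>simp add: W_def\<close>)
  also have "\<dots> = (\<Sum>p\<in>A. feynman_kac D W k (g p) X)" by (rule feynman_kac_sum)
  also have "\<dots> \<le> (\<Sum>p\<in>A. (8 / real N) ^ d * feynman_kac D W k (\<lambda>X. if X d = snd p then 1 else 0) X + real d * (32 * (real D)\<^sup>2 / (real k)\<^sup>2))"
  proof (rule sum_mono)
    fix p
    have "feynman_kac D W k (g p) X \<le> (8 / real N) ^ card {..<d} * feynman_kac D W k (\<lambda>X. (\<lambda>z. if z = snd p then 1 else 0) (X d)) X + 1 * exp (real t) * (1 - (1 - exp (-1)) / real D) ^ k * (\<Sum>i\<in>{..<d}. exp (- real ((\<lambda>_. 0::nat) i)))"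
      unfolding g_def W_def using r w by (intro heat_bound) (auto simp: D_def)
    also have "1 * exp (real t) * (1 - (1 - exp (-1)) / real D) ^ k * (\<Sum>i\<in>{..<d}. exp (- real ((\<lambda>_. 0::nat) i))) \<le> real d * (32 * (real D)\<^sup>2 / (real k)\<^sup>2)"
      using mult_left_mono[OF decay_power[OF D1 kpos t4], of "real d"] by (simp add: mult_ac)
    finally show "feynman_kac D W k (g p) X \<le> (8 / real N) ^ d * feynman_kac D W k (\<lambda>X. if X d = snd p then 1 else 0) X + real d * (32 * (real D)\<^sup>2 / (real k)\<^sup>2)" by simp
  qed
  also have "\<dots> = (8 / real N) ^ d * (\<Sum>p\<in>A. feynman_kac D W k (\<lambda>X. if X d = snd p then 1 else 0) X) + real N * (real d * (32 * (real D)\<^sup>2 / (real k)\<^sup>2))"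
    using A by (simp add: sum.distrib sum_distrib_left)
  also have "(\<Sum>p\<in>A. feynman_kac D W k (\<lambda>X. if X d = snd p then 1 else 0) X) = feynman_kac D W k (\<lambda>X. level_count A (X d)) X"
    unfolding level_count_eq_sum[OF A(1)] by (rule feynman_kac_sum[symmetric])
  finally show ?thesis unfolding D_def W_def .
qed

text \<open>Along any trajectory the terms \<open>a exp (- \<kappa> (sum of the previous a))\<close> add up to about \<open>1 / \<kappa>\<close>, like
  the integral of \<open>exp (- \<kappa> s)\<close>, whatever the time horizon.\<close>

lemma occupation_bound:
  assumes A: "finite A" and \<kappa>: "0 < \<kappa>" and D: "1 \<le> D"
  shows "(\<Sum>k<n. feynman_kac D (\<lambda>X. exp (- \<kappa> * level_count A (X d))) k (\<lambda>X. level_count A (X d)) X) \<le> 1 / \<kappa> + real (card A)"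
proof (induction n arbitrary: X)
  case 0
  then show ?case using \<kappa> by simp
next
  case (Suc n)
  let ?f = "\<lambda>k. feynman_kac D (\<lambda>X. exp (- \<kappa> * level_count A (X d))) k (\<lambda>X. level_count A (X d))"
  define a where "a = level_count A (X d)"
  define B where "B = 1 / \<kappa> + real (card A)"
  have a: "0 \<le> a" "a \<le> real (card A)" using level_count_le[OF A] by (auto simp: a_def)
  have B: "0 < B" using \<kappa> by (simp add: B_def add_pos_nonneg)
  have "step_avg D (\<lambda>X. \<Sum>k<n. ?f k X) X \<le> step_avg D (\<lambda>_. B) X"
    unfolding B_def by (intro step_avg_mono Suc)
  then have "step_avg D (\<lambda>X. \<Sum>k<n. ?f k X) X \<le> B" using step_avg_const[OF D] by simp
  then have 1: "exp (- \<kappa> * a) * step_avg D (\<lambda>X. \<Sum>k<n. ?f k X) X \<le> exp (- \<kappa> * a) * B" by (intro mult_left_mono) auto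
  have "exp (- \<kappa> * a) \<le> 1 / (1 + \<kappa> * a)"
  proof -
    have "0 < 1 + \<kappa> * a" using a \<kappa> by (simp add: add_pos_nonneg)
    moreover have "1 + \<kappa> * a \<le> exp (\<kappa> * a)" by (rule exp_ge_add_one_self)
    ultimately have "1 / exp (\<kappa> * a) \<le> 1 / (1 + \<kappa> * a)" by (intro divide_left_mono) auto
    then show ?thesis by (simp add: exp_minus inverse_eq_divide)
  qed
  then have 2: "exp (- \<kappa> * a) * B \<le> 1 / (1 + \<kappa> * a) * B" using B by (intro mult_right_mono) auto
  have 3: "a + 1 / (1 + \<kappa> * a) * B \<le> B"
  proof -
    have p: "0 < 1 + \<kappa> * a" using a \<kappa> by (simp add: add_pos_nonneg)
    have "a * (1 + \<kappa> * a) \<le> \<kappa> * a * B"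
    proof -
      have "\<kappa> * a * B = a + \<kappa> * a * real (card A)" using \<kappa> by (simp add: B_def algebra_simps)
      moreover have "\<kappa> * a * a \<le> \<kappa> * a * real (card A)" using a \<kappa> by (intro mult_left_mono) auto
      ultimately show ?thesis by (simp add: algebra_simps)
    qed
    then have "a * (1 + \<kappa> * a) + B \<le> B * (1 + \<kappa> * a)" by (simp add: algebra_simps)
    then have "(a * (1 + \<kappa> * a) + B) / (1 + \<kappa> * a) \<le> B" using p by (simp add: pos_divide_le_eq)
    then show ?thesis using p by (simp add: add_divide_distrib)
  qed
  have "(\<Sum>k<Suc n. ?f k X) = a + (\<Sum>k<n. ?f (Suc k) X)"
    unfolding sum.lessThan_Suc_shift by (simp add: a_def)
  also have "(\<Sum>k<n. ?f (Suc k) X) = exp (- \<kappa> * a) * step_avg D (\<lambda>X. \<Sum>k<n. ?f k X) X"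
    unfolding step_avg_sum by (simp add: a_def sum_distrib_left)
  finally show ?case using 1 2 3 unfolding B_def by linarith
qed

lemma sum_inverse_squares: "K \<ge> 1 \<Longrightarrow> (\<Sum>k\<in>{K<..n}. 1 / (real k)\<^sup>2) \<le> 1 / real K"
proof -
  assume K: "K \<ge> 1"
  have "(\<Sum>k\<in>{K<..n}. 1 / (real k)\<^sup>2) \<le> 1 / real K - 1 / real n" if "K \<le> n" for n
    using that
  proof (induction n rule: dec_induct)
    case (step n)
    have n: "1 \<le> n" using step K by simp
    have "{K<..Suc n} = insert (Suc n) {K<..n}" using step by auto
    then have "(\<Sum>k\<in>{K<..Suc n}. 1 / (real k)\<^sup>2) = 1 / (real (Suc n))\<^sup>2 + (\<Sum>k\<in>{K<..n}. 1 / (real k)\<^sup>2)" by simp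
    also have "1 / (real (Suc n))\<^sup>2 \<le> 1 / (real n * real (Suc n))"
      using n by (intro divide_left_mono) (auto simp: power2_eq_square)
    also have "1 / (real n * real (Suc n)) = 1 / real n - 1 / real (Suc n)" using n by (simp add: field_simps)
    finally show ?case using step by linarith
  qed simp
  moreover have "{K<..n} = {}" if "\<not> K \<le> n" using that by auto
  ultimately show ?thesis using K
    by (cases "K \<le> n") (auto intro: order_trans[of _ "1 / real K - 1 / real n"])
qed

text \<open>A return within time \<open>K\<close> is a return to the plane. Visits between the times \<open>K\<close> and \<open>N\<^sup>3\<close> are
  few because the walk leaves the plane, the visits after \<open>N\<^sup>3\<close> because of the discount: their
  expected number is of order \<open>N\<^bsup>-d\<^esup> / \<kappa> = 1 / Cc\<close>, uniformly in the number \<open>n\<close> of steps and in the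
  shape of \<open>A\<close>.\<close>

lemma return_prob_small:
  assumes d: "5 \<le> d" and q: "\<And>K. step_avg (d - 1) (hit (d - 1) (\<lambda>_. 1) (zero_below (d - 1)) K) (\<lambda>_. 0) \<le> q" and \<epsilon>: "0 < \<epsilon>"
  obtains Cc :: real and N0 :: nat where "0 < Cc"
    "\<And>N A n X. N0 \<le> N \<Longrightarrow> finite A \<Longrightarrow> card A = N \<Longrightarrow> on_set N d A X \<Longrightarrow>
      discount (Cc / real N ^ d) d A X * step_avg (Suc d) (hit (Suc d) (discount (Cc / real N ^ d) d A) (on_set N d A) n) X
       \<le> 2 / (real d + 1) + (1 - 2 / (real d + 1)) * q + \<epsilon>"
proof -
  define D where "D = Suc d"
  have D1: "1 \<le> D" by (simp add: D_def)
  define C1 where "C1 = 200000 * (real D)\<^sup>2"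
  define C3 where "C3 = real d * (32 * (real D)\<^sup>2)"
  have C: "0 \<le> C1" "0 \<le> C3" by (auto simp: C1_def C3_def)
  \<comment> \<open>The error \<open>\<epsilon>\<close> is split into a quarter for the early visits, controlled by \<open>K\<close>, a quarter
    for the late visits, controlled by \<open>Cc\<close>, and a half for terms of order \<open>1 / N\<close>.\<close>
  define K where "K = max (8 * D) (nat \<lceil>4 * C1 / \<epsilon>\<rceil>)"
  have K: "8 * D \<le> K" "1 \<le> K" "C1 / real (Suc K) \<le> \<epsilon> / 4"
  proof -
    show "8 * D \<le> K" by (simp add: K_def)
    then show "1 \<le> K" using D1 by linarith
    have "4 * C1 / \<epsilon> \<le> real K" unfolding K_def by linarith
    then have "4 * C1 / \<epsilon> \<le> real (Suc K)" by simp
    then show "C1 / real (Suc K) \<le> \<epsilon> / 4" using \<epsilon> by (simp add: field_simps)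
  qed
  define Cc where "Cc = 4 * 8 ^ d / \<epsilon>"
  have Cc: "0 < Cc" "8 ^ d / Cc = \<epsilon> / 4" using \<epsilon> by (auto simp: Cc_def)
  define C5 where "C5 = 2048 + 8 ^ d + C3"
  define N0 where "N0 = max (max (4 * D) (K + 2)) (nat \<lceil>2 * C5 / \<epsilon>\<rceil>)"
  show thesis
  proof (rule that[OF Cc(1)])
    fix N n :: nat and A :: "(int \<times> int) set" and X :: "nat \<Rightarrow> int"
    assume N: "N0 \<le> N" and A: "finite A" "card A = N" and X: "on_set N d A X"
    have N4: "4 * D \<le> N" "Suc K < N" using N by (auto simp: N0_def)
    have N1: "1 \<le> N" using N4 by simp
    have N5: "C5 / real N \<le> \<epsilon> / 2"
    proof -
      have "2 * C5 / \<epsilon> \<le> real N" using N unfolding N0_def by linarith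
      then show ?thesis using \<epsilon> N1 by (simp add: field_simps)
    qed
    define \<kappa> where "\<kappa> = Cc / real N ^ d"
    have \<kappa>: "0 < \<kappa>" using Cc N1 by (simp add: \<kappa>_def)
    define \<omega> where "\<omega> z = exp (- \<kappa> * level_count A z)" for z
    define w where "w = (\<lambda>X :: nat \<Rightarrow> int. \<omega> (X d))"
    have \<omega>: "0 \<le> \<omega> z" "\<omega> z \<le> 1" for z using \<kappa> level_count_le[OF A(1)] by (auto simp: \<omega>_def)
    have w: "0 \<le> w X" "w X \<le> 1" for X using \<omega> by (auto simp: w_def)
    define f where "f k = feynman_kac D w k (\<lambda>X. if on_set N d A X then 1 else 0) X" for k
    define L where "L k = feynman_kac D w k (\<lambda>X. level_count A (X d)) X" for k
    have L0: "0 \<le> L k" for k unfolding L_def using w level_count_le[OF A(1)] by (intro feynman_kac_nonneg) auto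
    have sumL: "(\<Sum>k<m. L k) \<le> 1 / \<kappa> + real N" for m
      using occupation_bound[OF A(1) \<kappa> D1] unfolding L_def w_def \<omega>_def A(2) by blast
    have f: "f k \<le> C1 * (1 / (real k)\<^sup>2) + (if k \<le> N ^ 3 then 2048 / real N ^ 4 else 0) + (8 / real N) ^ d * L k + (if N ^ 3 < k then real N * C3 * (1 / (real k)\<^sup>2) else 0)" if "Suc K < k" for k
    proof (cases "k \<le> N ^ 3")
      case True
      have "f k \<le> C1 / (real k)\<^sup>2 + 2048 / real N ^ 4"
        unfolding f_def C1_def D_def using d N1 w K that by (intro plane_prob_early) (auto simp: D_def)
      moreover have "0 \<le> (8 / real N) ^ d * L k" using L0 by simp
      ultimately show ?thesis using True by simp
    next
      case False
      have "f k \<le> (8 / real N) ^ d * L k + real N * (real d * (32 * (real D)\<^sup>2 / (real k)\<^sup>2))"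
        unfolding f_def L_def w_def D_def using N4 False A \<omega> d by (intro set_prob_late) (auto simp: D_def)
      moreover have "real N * (real d * (32 * (real D)\<^sup>2 / (real k)\<^sup>2)) = real N * C3 * (1 / (real k)\<^sup>2)" by (simp add: C3_def)
      moreover have "0 \<le> C1 * (1 / (real k)\<^sup>2)" using C by simp
      ultimately have "f k \<le> C1 * (1 / (real k)\<^sup>2) + 0 + (8 / real N) ^ d * L k + real N * C3 * (1 / (real k)\<^sup>2)" by linarith
      then show ?thesis using False by simp
    qed
    define S where "S = {Suc K<..Suc n}"
    have finS: "finite S" by (simp add: S_def)
    have "(\<Sum>k\<in>S. f k) \<le> (\<Sum>k\<in>S. C1 * (1 / (real k)\<^sup>2) + (if k \<le> N ^ 3 then 2048 / real N ^ 4 else 0) + (8 / real N) ^ d * L k + (if N ^ 3 < k then real N * C3 * (1 / (real k)\<^sup>2) else 0))"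
      by (intro sum_mono f) (simp add: S_def)
    also have "\<dots> = C1 * (\<Sum>k\<in>S. 1 / (real k)\<^sup>2) + (\<Sum>k\<in>S. if k \<le> N ^ 3 then 2048 / real N ^ 4 else 0) + (8 / real N) ^ d * (\<Sum>k\<in>S. L k) + (\<Sum>k\<in>S. if N ^ 3 < k then real N * C3 * (1 / (real k)\<^sup>2) else 0)"
      by (simp only: sum.distrib sum_distrib_left)
    also have "C1 * (\<Sum>k\<in>S. 1 / (real k)\<^sup>2) \<le> \<epsilon> / 4"
    proof -
      have "C1 * (\<Sum>k\<in>S. 1 / (real k)\<^sup>2) \<le> C1 * (1 / real (Suc K))"
        unfolding S_def by (intro mult_left_mono sum_inverse_squares C) simp
      also have "\<dots> = C1 / real (Suc K)" by simp
      finally show ?thesis using K(3) by linarith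
    qed
    also have "(\<Sum>k\<in>S. if k \<le> N ^ 3 then 2048 / real N ^ 4 else 0) \<le> 2048 / real N"
    proof -
      have "(\<Sum>k\<in>S. if k \<le> N ^ 3 then 2048 / real N ^ 4 else 0) = real (card (S \<inter> {k. k \<le> N ^ 3})) * (2048 / real N ^ 4)"
        using finS by (simp add: sum.If_cases)
      also have "card (S \<inter> {k. k \<le> N ^ 3}) \<le> card {1..N ^ 3}" by (intro card_mono) (auto simp: S_def)
      then have "real (card (S \<inter> {k. k \<le> N ^ 3})) \<le> real (N ^ 3)" by simp
      then have "real (card (S \<inter> {k. k \<le> N ^ 3})) * (2048 / real N ^ 4) \<le> real (N ^ 3) * (2048 / real N ^ 4)" by (intro mult_right_mono) auto
      also have "\<dots> = 2048 / real N" using N1 by (simp add: power_eq_if)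
      finally show ?thesis .
    qed
    also have "(8 / real N) ^ d * (\<Sum>k\<in>S. L k) \<le> \<epsilon> / 4 + 8 ^ d / real N"
    proof -
      have "(\<Sum>k\<in>S. L k) \<le> (\<Sum>k<Suc (Suc n). L k)" using L0 by (intro sum_mono2) (auto simp: S_def)
      also have "\<dots> \<le> 1 / \<kappa> + real N" by (rule sumL)
      finally have "(8 / real N) ^ d * (\<Sum>k\<in>S. L k) \<le> (8 / real N) ^ d * (1 / \<kappa> + real N)" by (intro mult_left_mono) auto
      also have "\<dots> = 8 ^ d / Cc + 8 ^ d * (real N / real N ^ d)"
        using N1 Cc by (simp add: \<kappa>_def power_divide field_simps)
      also have "real N / real N ^ d \<le> 1 / real N"
      proof -
        have "real N ^ 2 \<le> real N ^ d" using N1 d by (intro power_increasing) auto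
        then show ?thesis using N1 by (simp add: divide_simps power2_eq_square)
      qed
      finally show ?thesis using Cc(2) by simp
    qed
    also have "(\<Sum>k\<in>S. if N ^ 3 < k then real N * C3 * (1 / (real k)\<^sup>2) else 0) \<le> C3 / real N"
    proof -
      have "(\<Sum>k\<in>S. if N ^ 3 < k then real N * C3 * (1 / (real k)\<^sup>2) else 0) = (\<Sum>k\<in>S \<inter> {k. N ^ 3 < k}. real N * C3 * (1 / (real k)\<^sup>2))"
        using finS by (simp add: sum.If_cases)
      also have "\<dots> \<le> (\<Sum>k\<in>{N ^ 3<..Suc n}. real N * C3 * (1 / (real k)\<^sup>2))"
        using C by (intro sum_mono2) (auto simp: S_def)
      also have "\<dots> = real N * C3 * (\<Sum>k\<in>{N ^ 3<..Suc n}. 1 / (real k)\<^sup>2)" by (simp only: sum_distrib_left)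
      also have "\<dots> \<le> real N * C3 * (1 / real (N ^ 3))"
        using N1 C by (intro mult_left_mono sum_inverse_squares) auto
      also have "\<dots> = C3 / (real N)\<^sup>2" using N1 by (simp add: power2_eq_square power3_eq_cube)
      also have "\<dots> \<le> C3 / real N" using N1 C by (intro divide_left_mono) (auto simp: power2_eq_square)
      finally show ?thesis .
    qed
    finally have "(\<Sum>k\<in>S. f k) \<le> \<epsilon> / 4 + 2048 / real N + (\<epsilon> / 4 + 8 ^ d / real N) + C3 / real N" by simp
    also have "\<dots> = \<epsilon> / 2 + C5 / real N" by (simp add: C5_def add_divide_distrib)
    finally have sumf: "(\<Sum>k\<in>S. f k) \<le> \<epsilon>" using N5 by linarith
    let ?u = "hit D w (on_set N d A) n"
    let ?U = "hit D (\<lambda>_. 1) (in_plane N d) K"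
    have "w X * step_avg D ?u X \<le> w X * step_avg D (\<lambda>Y. ?U Y + (\<Sum>k\<in>{K<..n}. feynman_kac D w k (\<lambda>X. if on_set N d A X then 1 else 0) Y)) X"
      using w by (intro mult_left_mono step_avg_mono hit_decomp D1) (auto simp: on_set_def)
    also have "\<dots> = w X * step_avg D ?U X + (\<Sum>k\<in>{K<..n}. f (Suc k))"
      by (simp add: f_def step_avg_add step_avg_sum sum_distrib_left distrib_left)
    also have "(\<Sum>k\<in>{K<..n}. f (Suc k)) = (\<Sum>k\<in>S. f k)"
    proof -
      have "S = Suc ` {K<..n}" unfolding S_def using image_Suc_atLeastAtMost[of "Suc K" n]
        by (simp add: atLeastSucAtMost_greaterThanAtMost)
      then show ?thesis by (simp add: sum.reindex)
    qed
    also have "w X * step_avg D ?U X \<le> 1 * step_avg D ?U X"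
    proof (rule mult_right_mono)
      have "0 \<le> ?U Y" for Y using hit_bounds[OF D1, where w = "\<lambda>_. 1"] by simp
      then show "0 \<le> step_avg D ?U X" by (rule step_avg_nonneg)
    qed (rule w)
    also have "1 * step_avg D ?U X \<le> 2 / (real d + 1) + (1 - 2 / (real d + 1)) * q"
    proof -
      obtain \<nu> where \<nu>: "d = Suc \<nu>" "1 \<le> \<nu>" using d by (cases d) auto
      have "in_plane N (Suc \<nu>) X" using X \<nu> by (simp add: on_set_def)
      from return_to_plane[OF \<nu>(2) this N4(2), of q] q[of K] show ?thesis unfolding D_def \<nu>(1) by (simp add: add.commute)
    qed
    finally have "w X * step_avg D ?u X \<le> 2 / (real d + 1) + (1 - 2 / (real d + 1)) * q + \<epsilon>" using sumf by simp
    then show "discount (Cc / real N ^ d) d A X * step_avg (Suc d) (hit (Suc d) (discount (Cc / real N ^ d) d A) (on_set N d A) n) X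
       \<le> 2 / (real d + 1) + (1 - 2 / (real d + 1)) * q + \<epsilon>"
      unfolding w_def \<omega>_def \<kappa>_def D_def by simp
  qed
qed

lemma prod_list_exp: "(\<Prod>x\<leftarrow>l. exp (f x)) = exp (\<Sum>x\<leftarrow>l. f x :: real)"
  by (induction l) (auto simp: exp_add)

text \<open>Markov's inequality for \<open>\<theta>\<close> to the number of visits to \<open>A\<close> times the discount. If all points of \<open>A\<close>
  are visited, there are at least \<open>N\<close> visits; if every height is visited at most \<open>m\<close> times, the
  exponent of the discount is at most \<open>\<kappa>\<close> times \<open>m\<close> for each point of \<open>A\<close>.\<close>

lemma cover_prob:
  assumes A: "finite A" "card A = N" and \<theta>: "1 \<le> \<theta>" "0 \<le> q'" "\<theta> * q' < 1" and \<kappa>: "0 < \<kappa>"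
    and ret: "\<And>n X. on_set N d A X \<Longrightarrow> discount \<kappa> d A X * step_avg (Suc d) (hit (Suc d) (discount \<kappa> d A) (on_set N d A) n) X \<le> q'"
  shows "measure_pmf.prob (walk (Suc d) n X) {l. covers N d l A \<and> (\<forall>z. visits d z l \<le> m)}
    \<le> (1 + \<theta> / (1 - \<theta> * q')) * exp (\<kappa> * real N * real m) / \<theta> ^ N"
proof -
  define w where "w = (\<lambda>X :: nat \<Rightarrow> int. discount \<kappa> d A X)"
  define v where "v = (\<lambda>X. (if on_set N d A X then \<theta> else 1) * w X)"
  have w: "0 \<le> w X" "w X \<le> 1" for X using \<kappa> level_count_le[OF A(1)] by (auto simp: w_def)
  have B0: "0 \<le> \<theta> / (1 - \<theta> * q')" using \<theta> by simp
  have "measure_pmf.expectation (walk (Suc d) n X) (\<lambda>l. \<Prod>x\<leftarrow>l. v x) \<le> (if on_set N d A X then \<theta> / (1 - \<theta> * q') else 1 + \<theta> / (1 - \<theta> * q') * hit (Suc d) w (on_set N d A) (Suc n) X)"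
  proof -
    have D1: "1 \<le> Suc d" by simp
    have r: "w X * step_avg (Suc d) (hit (Suc d) w (on_set N d A) n) X \<le> q'" if "on_set N d A X" for n X
      using ret[OF that] unfolding w_def .
    show ?thesis unfolding v_def walk_prod_eq_feynman_kac[OF D1] by (rule feynman_kac_reward_bound[OF D1 w r \<theta>(2,3,1)])
  qed
  also have "\<dots> \<le> 1 + \<theta> / (1 - \<theta> * q')"
  proof -
    have "hit (Suc d) w (on_set N d A) (Suc n) X \<le> 1" by (rule hit_bounds[THEN conjunct2]) (use w in auto)
    then have "\<theta> / (1 - \<theta> * q') * hit (Suc d) w (on_set N d A) (Suc n) X \<le> \<theta> / (1 - \<theta> * q') * 1" using B0 by (intro mult_left_mono)
    then show ?thesis by (auto simp del: hit.simps)
  qed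
  finally have E: "measure_pmf.expectation (walk (Suc d) n X) (\<lambda>l. \<Prod>x\<leftarrow>l. v x) \<le> 1 + \<theta> / (1 - \<theta> * q')" .
  define c where "c = \<theta> ^ N * exp (- (\<kappa> * real N * real m))"
  have c: "0 < c" using \<theta> by (simp add: c_def)
  have "measure_pmf.prob (walk (Suc d) n X) {l. covers N d l A \<and> (\<forall>z. visits d z l \<le> m)}
    \<le> measure_pmf.expectation (walk (Suc d) n X) (\<lambda>l. \<Prod>x\<leftarrow>l. v x) / c"
  proof (rule markov_pmf)
    fix l assume l: "covers N d l A \<and> (\<forall>z. visits d z l \<le> m)"
    define h where "h = length (filter (on_set N d A) l)"
    have "(\<Prod>x\<leftarrow>l. v x) = \<theta> ^ h * (\<Prod>x\<leftarrow>l. w x)"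
      unfolding h_def by (induction l) (auto simp: v_def)
    also have "(\<Prod>x\<leftarrow>l. w x) = exp (- \<kappa> * (\<Sum>x\<leftarrow>l. level_count A (x d)))"
      by (simp only: w_def prod_list_exp sum_list_const_mult)
    finally have eq: "(\<Prod>x\<leftarrow>l. v x) = \<theta> ^ h * exp (- \<kappa> * (\<Sum>x\<leftarrow>l. level_count A (x d)))" .
    have "A \<subseteq> (\<lambda>x. (x 0 mod int N, x d)) ` set (filter (on_set N d A) l)"
      using l by (fastforce simp: on_set_def)
    then have "N \<le> card ((\<lambda>x. (x 0 mod int N, x d)) ` set (filter (on_set N d A) l))" unfolding A(2)[symmetric] by (intro card_mono) auto
    also have "\<dots> \<le> card (set (filter (on_set N d A) l))" by (intro card_image_le) auto
    also have "\<dots> \<le> h" unfolding h_def by (rule card_length)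
    finally have h: "\<theta> ^ N \<le> \<theta> ^ h" using \<theta> by (intro power_increasing)
    have "(\<Sum>x\<leftarrow>l. level_count A (x d)) = (\<Sum>p\<in>A. real (visits d (snd p) l))"
    proof (induction l)
      case (Cons a l)
      have "(\<Sum>p\<in>A. real (visits d (snd p) (a # l))) = (\<Sum>p\<in>A. (if a d = snd p then 1 else 0) + real (visits d (snd p) l))"
        by (intro sum.cong) (auto simp: visits_Cons)
      then show ?case using Cons by (simp add: sum.distrib level_count_eq_sum[OF A(1)])
    qed (simp add: visits_def)
    also have "\<dots> \<le> real (card A) * real m" using l by (intro sum_bounded_above) auto
    finally have "\<kappa> * (\<Sum>x\<leftarrow>l. level_count A (x d)) \<le> \<kappa> * (real N * real m)" using \<kappa> A by (intro mult_left_mono) auto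
    then have "exp (- (\<kappa> * real N * real m)) \<le> exp (- \<kappa> * (\<Sum>x\<leftarrow>l. level_count A (x d)))" by (simp add: mult.assoc)
    then show "c \<le> (\<Prod>x\<leftarrow>l. v x)" unfolding c_def eq using h \<theta> by (intro mult_mono) auto
  next
    fix l show "0 \<le> (\<Prod>x\<leftarrow>l. v x)" using w \<theta> by (intro prod_list_nonneg) (auto simp: v_def)
  qed (use c finite_walk[of "Suc d" n X] in auto)
  also have "\<dots> \<le> (1 + \<theta> / (1 - \<theta> * q')) / c" using E c by (intro divide_right_mono) auto
  also have "\<dots> = (1 + \<theta> / (1 - \<theta> * q')) * exp (\<kappa> * real N * real m) / \<theta> ^ N"
    unfolding c_def by (simp add: exp_minus field_simps)
  finally show ?thesis .
qed

section \<open>From trajectories in the cylinder to lifted walks\<close>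

lemma pmf_paths:
  "pmf (paths K n x) l = (if length l = Suc n \<and> hd l = x then \<Prod>i<n. pmf (K (l ! i)) (l ! Suc i) else 0)"
proof (induction n arbitrary: x l)
  case 0
  show ?case by (cases l) (auto simp: pmf_return)
next
  case (Suc n)
  show ?case
  proof (cases l)
    case Nil
    have "l \<notin> set_pmf (paths K (Suc n) x)" using paths_length[of l K "Suc n" x] Nil by auto
    then have "pmf (paths K (Suc n) x) l = 0" by (metis set_pmf_iff)
    then show ?thesis using Nil by (simp del: paths.simps)
  next
    case (Cons a l')
    have m: "pmf (map_pmf ((#) x) p) l = (if a = x then pmf p l' else 0)" for p
    proof (cases "a = x")
      case True
      then show ?thesis unfolding Cons by (simp add: pmf_map_inj')
    next
      case False
      then have "l \<notin> set_pmf (map_pmf ((#) x) p)" by (auto simp: Cons)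
      then have "pmf (map_pmf ((#) x) p) l = 0" by (metis set_pmf_iff)
      then show ?thesis using False by simp
    qed
    define c where "c = (if a = x \<and> length l' = Suc n then \<Prod>i<n. pmf (K (l' ! i)) (l' ! Suc i) else 0)"
    have "pmf (paths K (Suc n) x) l = (\<integral>y. pmf (map_pmf ((#) x) (paths K n y)) l \<partial>K x)"
      by (simp add: pmf_bind)
    also have "\<dots> = (\<integral>y. indicator {hd l'} y * c \<partial>K x)"
      by (intro Bochner_Integration.integral_cong refl) (auto simp: m Suc c_def indicator_def)
    also have "\<dots> = pmf (K x) (hd l') * c" by (simp add: measure_pmf_single)
    also have "\<dots> = (if length l = Suc (Suc n) \<and> hd l = x then \<Prod>i<Suc n. pmf (K (l ! i)) (l ! Suc i) else 0)"
      unfolding Cons prod.lessThan_Suc_shift c_def by (cases l') auto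
    finally show ?thesis .
  qed
qed

lemma space_srw [simp]: "space (srw nb x) = UNIV"
  using sets_eq_imp_space_eq[OF sets_srw[of nb x]] by (simp add: space_PiM)

lemma prefix_cylinder_sets:
  fixes nb :: "'a :: countable \<Rightarrow> 'a set"
  shows "{\<omega>. \<forall>i\<le>n. \<omega> i = p i} \<in> sets (srw nb x)"
proof -
  have "{\<omega> \<in> space (PiM UNIV (\<lambda>_. count_space UNIV)). \<forall>i\<in>{..n}. \<omega> i = p i} \<in> sets (PiM UNIV (\<lambda>_::nat. count_space (UNIV :: 'a set)))"
    by measurable
  then show ?thesis by (simp add: sets_srw space_PiM Ball_def)
qed

lemma prefix_vimage:
  "(\<lambda>\<omega>. map \<omega> [0..<Suc n]) -` {l} = (if length l = Suc n then {\<omega>. \<forall>i\<le>n. \<omega> i = l ! i} else {})"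
proof (cases "length l = Suc n")
  case True
  have "map \<omega> [0..<Suc n] = l \<longleftrightarrow> (\<forall>i\<le>n. \<omega> i = l ! i)" for \<omega>
  proof -
    have "map \<omega> [0..<Suc n] = l \<longleftrightarrow> (\<forall>i<Suc n. map \<omega> [0..<Suc n] ! i = l ! i)"
      using True by (simp add: list_eq_iff_nth_eq del: upt_Suc)
    also have "\<dots> \<longleftrightarrow> (\<forall>i<Suc n. \<omega> i = l ! i)"
    proof -
      have "map \<omega> [0..<Suc n] ! i = \<omega> i" if "i < Suc n" for i using that by (simp del: upt_Suc)
      then show ?thesis by metis
    qed
    finally show ?thesis by (simp add: less_Suc_eq_le)
  qed
  then show ?thesis using True by (simp add: vimage_def del: upt_Suc)
next
  case False
  then have "map \<omega> [0..<Suc n] \<noteq> l" for \<omega> by auto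
  then show ?thesis using False by (simp add: vimage_def del: upt_Suc)
qed

lemma measurable_prefix:
  fixes nb :: "'a :: countable \<Rightarrow> 'a set"
  shows "(\<lambda>\<omega>. map \<omega> [0..<Suc n]) \<in> measurable (srw nb x) (count_space UNIV)"
  unfolding measurable_count_space_eq2_countable
  by (auto simp: prefix_vimage prefix_cylinder_sets simp del: upt_Suc)

lemma distr_srw_prefix:
  fixes nb :: "'a :: countable \<Rightarrow> 'a set"
  shows "distr (srw nb x) (count_space UNIV) (\<lambda>\<omega>. map \<omega> [0..<Suc n]) = measure_pmf (paths (\<lambda>y. pmf_of_set (nb y)) n x)"
proof (rule measure_eqI_countable[of _ UNIV])
  interpret prob_space "srw nb x" by (rule prob_space_srw)
  fix l :: "'a list"
  have "emeasure (distr (srw nb x) (count_space UNIV) (\<lambda>\<omega>. map \<omega> [0..<Suc n])) {l} = emeasure (srw nb x) ((\<lambda>\<omega>. map \<omega> [0..<Suc n]) -` {l})"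
    using measurable_prefix by (subst emeasure_distr) auto
  also have "\<dots> = ennreal (pmf (paths (\<lambda>y. pmf_of_set (nb y)) n x) l)"
  proof (cases "length l = Suc n")
    case True
    then have "hd l = l ! 0" by (cases l) auto
    then show ?thesis unfolding prefix_vimage using True
      by (simp add: emeasure_eq_measure measure_srw_path pmf_paths)
  qed (simp add: prefix_vimage pmf_paths del: upt_Suc)
  finally show "emeasure (distr (srw nb x) (count_space UNIV) (\<lambda>\<omega>. map \<omega> [0..<Suc n])) {l} = emeasure (measure_pmf (paths (\<lambda>y. pmf_of_set (nb y)) n x)) {l}"
    by (simp only: emeasure_pmf_single)
qed auto

text \<open>Events that depend on finitely many steps are measurable, and their probability is that of the
  finite path law, since lists over a countable type have countably many values.\<close>

lemma srw_prefix_event: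
  fixes nb :: "'a :: countable \<Rightarrow> 'a set"
  shows "{\<omega>. P (map \<omega> [0..<Suc n])} \<in> sets (srw nb x)"
    and "measure (srw nb x) {\<omega>. P (map \<omega> [0..<Suc n])} = measure_pmf.prob (paths (\<lambda>y. pmf_of_set (nb y)) n x) {l. P l}"
proof -
  have e: "{\<omega>. P (map \<omega> [0..<Suc n])} = (\<lambda>\<omega>. map \<omega> [0..<Suc n]) -` {l. P l} \<inter> space (srw nb x)" by auto
  show "{\<omega>. P (map \<omega> [0..<Suc n])} \<in> sets (srw nb x)"
    unfolding e using measurable_prefix by (rule measurable_sets) auto
  show "measure (srw nb x) {\<omega>. P (map \<omega> [0..<Suc n])} = measure_pmf.prob (paths (\<lambda>y. pmf_of_set (nb y)) n x) {l. P l}"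
    unfolding e distr_srw_prefix[symmetric] using measurable_prefix by (subst measure_distr) auto
qed

lemma lattice_nbrs_eq:
  "lattice_nbrs (map X [0..<n]) = (\<lambda>(i, s). map (nudge X i s) [0..<n]) ` ({..<n} \<times> {1, -1})" (is "?L = ?R")
proof
  show "?R \<subseteq> ?L"
  proof
    fix y assume "y \<in> ?R"
    then obtain z where z: "y = (\<lambda>(i, s). map (nudge X i s) [0..<n]) z" "z \<in> {..<n} \<times> {1, -1}" by (rule imageE)
    obtain i s where zz: "z = (i, s)" by (rule prod.exhaust)
    have hs: "i < n" "s \<in> {1, -1}" and y: "y = map (nudge X i s) [0..<n]" using z unfolding zz by simp_all
    have "(\<Sum>j<n. \<bar>map (nudge X i s) [0..<n] ! j - map X [0..<n] ! j\<bar>) = (\<Sum>j<n. if j = i then 1 else 0)"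
      using hs by (intro sum.cong) (auto simp: nudge_def)
    then show "y \<in> lattice_nbrs (map X [0..<n])" using hs unfolding y by (simp add: lattice_nbrs_def)
  qed
  show "?L \<subseteq> ?R"
  proof
    fix y assume "y \<in> ?L"
    then have y: "length y = n" "(\<Sum>j<n. \<bar>y ! j - X j\<bar>) = 1"
      by (auto simp: lattice_nbrs_def)
    have "\<exists>i<n. y ! i \<noteq> X i"
    proof (rule ccontr)
      assume "\<not> ?thesis"
      then have "(\<Sum>j<n. \<bar>y ! j - X j\<bar>) = 0" by simp
      then show False using y by simp
    qed
    then obtain i where i: "i < n" "y ! i \<noteq> X i" by blast
    have s: "(\<Sum>j<n. \<bar>y ! j - X j\<bar>) = \<bar>y ! i - X i\<bar> + (\<Sum>j\<in>{..<n} - {i}. \<bar>y ! j - X j\<bar>)"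
      using i by (intro sum.remove) auto
    have nn: "0 \<le> (\<Sum>j\<in>{..<n} - {i}. \<bar>y ! j - X j\<bar>)" by (intro sum_nonneg) auto
    have one: "\<bar>y ! i - X i\<bar> = 1" and "(\<Sum>j\<in>{..<n} - {i}. \<bar>y ! j - X j\<bar>) = 0" using s nn y i by linarith+
    then have "\<forall>j\<in>{..<n} - {i}. \<bar>y ! j - X j\<bar> = 0" by (subst (asm) sum_nonneg_eq_0_iff) auto
    then have "y = map (nudge X i (y ! i - X i)) [0..<n]"
      using y by (intro nth_equalityI) (auto simp: nudge_def)
    moreover have "y ! i - X i \<in> {1, -1}" using one by auto
    ultimately show "y \<in> ?R" using i by (intro image_eqI[of _ _ "(i, y ! i - X i)"]) auto
  qed
qed

lemma lattice_kernel:
  assumes "n \<ge> 1"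
  shows "map_pmf (\<lambda>Y. map Y [0..<n]) (lift_step n X) = pmf_of_set (lattice_nbrs (map X [0..<n]))"
proof -
  have inj: "inj_on (\<lambda>(i, s). map (nudge X i s) [0..<n]) ({..<n} \<times> {1, -1})"
  proof (rule inj_onI, clarify)
    fix i j :: nat and s t :: int
    assume a: "i < n" "j < n" "s \<in> {1,-1}" "t \<in> {1,-1}" "map (nudge X i s) [0..<n] = map (nudge X j t) [0..<n]"
    then have e: "nudge X i s k = nudge X j t k" if "k < n" for k using that by simp
    show "i = j \<and> s = t" using e[OF a(1)] e[OF a(2)] a(3,4) by (auto simp: nudge_def split: if_splits)
  qed
  have ne: "{..<n} \<times> {1, -1::int} \<noteq> {}" using assms by (auto simp: lessThan_empty_iff)
  have "map_pmf (\<lambda>Y. map Y [0..<n]) (lift_step n X) = map_pmf (\<lambda>(i, s). map (nudge X i s) [0..<n]) (pmf_of_set ({..<n} \<times> {1, -1}))"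
    unfolding lift_step_def by (simp add: pmf.map_comp o_def case_prod_unfold)
  also have "\<dots> = pmf_of_set (lattice_nbrs (map X [0..<n]))"
    unfolding lattice_nbrs_eq using inj ne by (intro map_pmf_of_set_inj) auto
  finally show ?thesis .
qed

lemma walk_hit_prob:
  assumes "D \<ge> 1"
  shows "measure_pmf.prob (walk D n X) {l. \<exists>x\<in>set l. T x} = hit D (\<lambda>_. 1) T n X"
proof (induction n arbitrary: X)
  case (Suc n)
  show ?case
  proof (cases "T X")
    case True
    then have "measure_pmf.prob (walk D (Suc n) X) {l. \<exists>x\<in>set l. T x} = step_avg D (\<lambda>Y. 1) X"
      unfolding walk_prob_Suc[OF assms] by simp
    then show ?thesis using True step_avg_const[OF assms] by simp
  next
    case False
    have f: "(\<lambda>Y. measure_pmf.prob (walk D n Y) {l. \<exists>x\<in>set l. T x}) = hit D (\<lambda>_. 1) T n" using Suc by (intro ext)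
    show ?thesis unfolding walk_prob_Suc[OF assms] using False by (simp add: f)
  qed
qed (simp add: measure_return_pmf indicator_def)

text \<open>Hitting \<open>0\<close> from a uniformly chosen neighbour of \<open>0\<close> is returning to \<open>0\<close>.\<close>

lemma hit_le_return_prob:
  assumes "\<nu> \<ge> 1"
  shows "step_avg \<nu> (hit \<nu> (\<lambda>_. 1) (zero_below \<nu>) K) (\<lambda>_. 0) \<le> return_prob \<nu>"
proof -
  let ?o = "\<lambda>_. 0 :: int"
  let ?z = "replicate \<nu> 0 :: int list"
  let ?\<pi> = "\<lambda>Y :: nat \<Rightarrow> int. map Y [0..<\<nu>]"
  interpret prob_space "srw lattice_nbrs ?z" by (rule prob_space_srw)
  have z: "?\<pi> ?o = ?z" by (simp add: map_replicate_const)
  have zero: "?\<pi> Y = ?z \<longleftrightarrow> zero_below \<nu> Y" for Y by (auto simp: list_eq_iff_nth_eq)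
  have paths: "paths (\<lambda>y. pmf_of_set (lattice_nbrs y)) n ?z = map_pmf (map ?\<pi>) (walk \<nu> n ?o)" for n
    using paths_map[where \<pi> = ?\<pi> and K = "lift_step \<nu>" and K' = "\<lambda>y. pmf_of_set (lattice_nbrs y)" and n = n and x = ?o, OF lattice_kernel[OF assms]] z by simp
  have "step_avg \<nu> (hit \<nu> (\<lambda>_. 1) (zero_below \<nu>) K) ?o = step_avg \<nu> (\<lambda>Y. measure_pmf.prob (walk \<nu> K Y) {l. \<exists>x\<in>set l. zero_below \<nu> x}) ?o"
    unfolding walk_hit_prob[OF assms] ..
  also have "\<dots> = measure_pmf.prob (walk \<nu> (Suc K) ?o) {l. \<exists>x\<in>set (tl l). zero_below \<nu> x}"
    unfolding walk_prob_Suc[OF assms] by simp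
  also have "\<dots> = measure_pmf.prob (paths (\<lambda>y. pmf_of_set (lattice_nbrs y)) (Suc K) ?z) {l. \<exists>x\<in>set (tl l). x = ?z}"
  proof -
    have "(\<exists>x\<in>set (tl (map ?\<pi> l)). x = ?z) \<longleftrightarrow> (\<exists>x\<in>set (tl l). zero_below \<nu> x)" for l
    proof -
      have e: "set (tl (map ?\<pi> l)) = ?\<pi> ` set (tl l)" by (simp add: map_tl[symmetric])
      show ?thesis unfolding zero[symmetric] e by blast
    qed
    then show ?thesis unfolding paths measure_map_pmf by (simp only: vimage_def mem_Collect_eq)
  qed
  also have "\<dots> = measure (srw lattice_nbrs ?z) {\<omega>. \<exists>x\<in>set (tl (map \<omega> [0..<Suc (Suc K)])). x = ?z}"
    by (rule srw_prefix_event(2)[symmetric])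
  also have "\<dots> \<le> measure (srw lattice_nbrs ?z) {\<omega>. \<exists>n\<ge>1. \<omega> n = ?z}"
  proof (rule finite_measure_mono)
    have "tl (map \<omega> [0..<Suc (Suc K)]) = map \<omega> [1..<Suc (Suc K)]" for \<omega> :: "nat \<Rightarrow> int list"
      by (simp add: upt_conv_Cons del: upt_Suc)
    then show "{\<omega>. \<exists>x\<in>set (tl (map \<omega> [0..<Suc (Suc K)])). x = ?z} \<subseteq> {\<omega>. \<exists>n\<ge>1. \<omega> n = ?z}" by (auto simp del: upt_Suc)
    have "{\<omega>. \<exists>n\<ge>1. \<omega> n = ?z} = (\<Union>n. {\<omega>. (\<lambda>l. 1 \<le> n \<and> last l = ?z) (map \<omega> [0..<Suc n])})"
      by auto
    also have "\<dots> \<in> events" by (intro sets.countable_UN image_subsetI srw_prefix_event(1))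
    finally show "{\<omega>. \<exists>n\<ge>1. \<omega> n = ?z} \<in> events" .
  qed
  finally show ?thesis by (simp add: return_prob_def)
qed

text \<open>The covering map from \<open>\<int>\<^bsup>d+1\<^esup>\<close> to the cylinder.\<close>

definition proj :: "nat \<Rightarrow> nat \<Rightarrow> (nat \<Rightarrow> int) \<Rightarrow> int list" where
  "proj N d X = cyl_proj N (map X [0..<Suc d])"

lemma proj_eq: "proj N d X = map (\<lambda>i. if i < d then X i mod int N else X i) [0..<Suc d]"
  unfolding proj_def cyl_proj_def by (simp add: butlast_append)

lemma length_proj [simp]: "length (proj N d X) = Suc d" by (simp add: proj_eq del: upt_Suc)

lemma nth_proj: "i \<le> d \<Longrightarrow> proj N d X ! i = (if i < d then X i mod int N else X i)"
  by (simp add: proj_eq nth_append)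

lemma last_proj [simp]: "last (proj N d X) = X d" by (simp add: proj_eq)

lemma proj_eq_iff: "proj N d X = proj N d Y \<longleftrightarrow> (\<forall>i<d. X i mod int N = Y i mod int N) \<and> X d = Y d"
  by (auto simp: list_eq_iff_nth_eq nth_proj less_Suc_eq_le split: if_splits)

lemma cyl_origin_eq: "cyl_origin d = proj N d (\<lambda>_. 0)"
  unfolding cyl_origin_def by (rule nth_equalityI) (simp_all add: nth_proj del: replicate_Suc)

lemma cylinder_eq: "cylinder d N = range (proj N d)"
proof
  show "cylinder d N \<subseteq> range (proj N d)"
  proof
    fix x assume "x \<in> cylinder d N"
    then obtain z where z: "length z = d + 1" "x = cyl_proj N z" by (auto simp: cylinder_def)
    have "z = map (\<lambda>i. z ! i) [0..<Suc d]" using z by (intro nth_equalityI) (auto simp del: upt_Suc)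
    then have "x = proj N d (\<lambda>i. z ! i)" unfolding proj_def using z by metis
    then show "x \<in> range (proj N d)" by blast
  qed
next
  have "proj N d X \<in> cylinder d N" for X
    unfolding cylinder_def proj_def by (rule imageI) (simp del: upt_Suc)
  then show "range (proj N d) \<subseteq> cylinder d N" by blast
qed

lemma cyl_nbrs_proj: "cyl_nbrs N (proj N d X) = (\<lambda>(i, s). proj N d (nudge X i s)) ` ({..<Suc d} \<times> {1, -1})"
proof -
  define X' where "X' i = (if i < d then X i mod int N else X i)" for i
  have p: "proj N d X = map X' [0..<Suc d]" by (simp add: proj_eq X'_def)
  have "proj N d (nudge X' i s) = proj N d (nudge X i s)" for i s
    by (auto simp: proj_eq_iff nudge_def X'_def mod_simps)
  then show ?thesis unfolding cyl_nbrs_def p lattice_nbrs_eq image_image by (auto simp: proj_def case_prod_beta simp del: upt_Suc intro!: image_cong)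
qed

lemma cyl_nbrs_sym: "x \<in> cylinder d N \<Longrightarrow> y \<in> cyl_nbrs N x \<Longrightarrow> x \<in> cyl_nbrs N y"
proof -
  assume "x \<in> cylinder d N" "y \<in> cyl_nbrs N x"
  then obtain X where x: "x = proj N d X" by (auto simp: cylinder_eq)
  have "y \<in> (\<lambda>(i, s). proj N d (nudge X i s)) ` ({..<Suc d} \<times> {1, -1})"
    using \<open>y \<in> cyl_nbrs N x\<close> unfolding x cyl_nbrs_proj .
  then obtain z where z: "y = (\<lambda>(i, s). proj N d (nudge X i s)) z" "z \<in> {..<Suc d} \<times> {1, -1}" by (rule imageE)
  obtain i s where zz: "z = (i, s)" by (rule prod.exhaust)
  have "i < Suc d" "s \<in> {1,-1}" "y = proj N d (nudge X i s)" using z unfolding zz by simp_all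
  then have X: "x = proj N d X" "i < Suc d" "s \<in> {1,-1}" "y = proj N d (nudge X i s)" using x by blast+
  have "nudge (nudge X i s) i (- s) = X" by (auto simp: nudge_def)
  then show ?thesis using X unfolding X(4) cyl_nbrs_proj by (intro image_eqI[of _ _ "(i, - s)"]) auto
qed

text \<open>For \<open>N \<ge> 3\<close> the \<open>2 (d + 1)\<close> steps lead to different neighbours in the cylinder, so that a uniform
  step projects to a uniform neighbour.\<close>

lemma cyl_kernel:
  assumes N: "N \<ge> 3"
  shows "map_pmf (proj N d) (lift_step (Suc d) X) = pmf_of_set (cyl_nbrs N (proj N d X))"
proof -
  have inj: "inj_on (\<lambda>(i, s). proj N d (nudge X i s)) ({..<Suc d} \<times> {1, -1})"
  proof (rule inj_onI, clarify)
    fix i j :: nat and s t :: int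
    assume a: "i < Suc d" "j < Suc d" "s \<in> {1,-1}" "t \<in> {1,-1}" "proj N d (nudge X i s) = proj N d (nudge X j t)"
    have e: "int N dvd nudge X i s k - nudge X j t k" if "k < Suc d" for k
    proof (cases "k < d")
      case True
      then have "nudge X i s k mod int N = nudge X j t k mod int N" using a(5) unfolding proj_eq_iff by blast
      then show ?thesis by (simp only: mod_eq_dvd_iff)
    next
      case False
      then have "k = d" using that by simp
      then have "nudge X i s k = nudge X j t k" using a(5) unfolding proj_eq_iff by blast
      then show ?thesis by simp
    qed
    have "\<not> int N dvd 1" "\<not> int N dvd -1" "\<not> int N dvd 2" "\<not> int N dvd -2" 
      using N dvd_imp_le_int[of 1 "int N"] dvd_imp_le_int[of "-1" "int N"] dvd_imp_le_int[of 2 "int N"] dvd_imp_le_int[of "-2" "int N"] by linarith+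
    then show "i = j \<and> s = t" using e[OF a(1)] a(3,4) by (auto simp: nudge_def split: if_splits)
  qed
  have ne: "{..<Suc d} \<times> {1, -1::int} \<noteq> {}" by (auto simp: lessThan_empty_iff)
  have "map_pmf (proj N d) (lift_step (Suc d) X) = map_pmf (\<lambda>(i, s). proj N d (nudge X i s)) (pmf_of_set ({..<Suc d} \<times> {1, -1}))"
    unfolding lift_step_def by (simp add: pmf.map_comp o_def case_prod_unfold)
  also have "\<dots> = pmf_of_set (cyl_nbrs N (proj N d X))"
    unfolding cyl_nbrs_proj using inj ne by (intro map_pmf_of_set_inj) auto
  finally show ?thesis .
qed

lemma cyl_walk_prob:
  assumes "N \<ge> 3"
  shows "measure (cyl_walk d N) {\<omega>. P (map \<omega> [0..<Suc n])} = measure_pmf.prob (walk (Suc d) n (\<lambda>_. 0)) {l. P (map (proj N d) l)}"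
proof -
  have "paths (\<lambda>y. pmf_of_set (cyl_nbrs N y)) n (cyl_origin d) = map_pmf (map (proj N d)) (walk (Suc d) n (\<lambda>_. 0))"
    unfolding cyl_origin_eq[of d N] by (rule paths_map[symmetric]) (rule cyl_kernel[OF assms])
  then show ?thesis unfolding cyl_walk_def srw_prefix_event(2) by (simp add: vimage_def)
qed

definition plane_lift :: "nat \<Rightarrow> int \<times> int \<Rightarrow> nat \<Rightarrow> int" where
  "plane_lift d p i = (if i = 0 then fst p else if i = d then snd p else 0)"

lemma proj_plane_lift_iff:
  assumes "d \<ge> 1" "p \<in> strip N"
  shows "proj N d X = proj N d (plane_lift d p) \<longleftrightarrow> in_plane N d X \<and> (X 0 mod int N, X d) = p"
proof -
  have u: "fst p mod int N = fst p" using assms(2) by (auto simp: strip_def)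
  have "(\<forall>i<d. X i mod int N = plane_lift d p i mod int N) \<longleftrightarrow> X 0 mod int N = fst p \<and> (\<forall>i\<in>{1..<d}. int N dvd X i)"
  proof
    assume a: "\<forall>i<d. X i mod int N = plane_lift d p i mod int N"
    then have "X 0 mod int N = fst p" using assms(1) u by (auto simp: plane_lift_def)
    moreover have "int N dvd X i" if "i \<in> {1..<d}" for i
    proof -
      have "X i mod int N = plane_lift d p i mod int N" using a that by simp
      moreover have "plane_lift d p i = 0" using that by (simp add: plane_lift_def)
      ultimately show ?thesis by auto
    qed
    ultimately show "X 0 mod int N = fst p \<and> (\<forall>i\<in>{1..<d}. int N dvd X i)" by blast
  next
    assume a: "X 0 mod int N = fst p \<and> (\<forall>i\<in>{1..<d}. int N dvd X i)"
    show "\<forall>i<d. X i mod int N = plane_lift d p i mod int N"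
    proof (intro allI impI)
      fix i assume "i < d"
      then show "X i mod int N = plane_lift d p i mod int N" using a u
        by (cases "i = 0") (auto simp: plane_lift_def)
    qed
  qed
  moreover have "plane_lift d p d = snd p" using assms(1) by (simp add: plane_lift_def)
  moreover have "(X 0 mod int N, X d) = p \<longleftrightarrow> X 0 mod int N = fst p \<and> X d = snd p" by (cases p) simp
  ultimately show ?thesis unfolding proj_eq_iff in_plane_def by argo
qed

text \<open>Otherwise an open path joins the bottom of the strip to its top. It is a path in the cylinder outside
  \<open>S\<close>, and puts both ends of the cylinder into the same component.\<close>

lemma crossed_of_disconnects:
  assumes d: "d \<ge> 1" and N: "N \<ge> 1" and dis: "disconnects d N S"
  shows "crossed N {p \<in> strip N. proj N d (plane_lift d p) \<in> S}"
proof (rule ccontr)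
  let ?pt = "\<lambda>p. proj N d (plane_lift d p)"
  define S' where "S' = {p \<in> strip N. ?pt p \<in> S}"
  assume "\<not> crossed N {p \<in> strip N. ?pt p \<in> S}"
  then have nc: "\<not> crossed N S'" by (simp add: S'_def)
  have lst: "last (?pt p) = snd p" for p using d by (simp add: plane_lift_def)
  have inj: "inj_on ?pt (strip N)"
  proof (rule inj_onI)
    fix p q assume "p \<in> strip N" "q \<in> strip N" "?pt p = ?pt q"
    then have "(plane_lift d p 0 mod int N, plane_lift d p d) = q" using proj_plane_lift_iff[OF d, of q N "plane_lift d p"] by blast
    moreover have "(plane_lift d p 0 mod int N, plane_lift d p d) = p" using proj_plane_lift_iff[OF d \<open>p \<in> strip N\<close>, of "plane_lift d p"] by blast
    ultimately show "p = q" by simp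
  qed
  have finS: "finite S" using dis by (simp add: disconnects_def)
  have finS': "finite S'"
  proof (rule inj_on_finite[of ?pt _ S])
    show "inj_on ?pt S'" using inj by (rule inj_on_subset) (auto simp: S'_def)
  qed (auto simp: S'_def finS)
  define V where "V = cylinder d N - S"
  define E where "E = Restr {(x, y). y \<in> cyl_nbrs N x} V"
  obtain M0 :: int where M0: "\<And>M. M \<ge> M0 \<Longrightarrow> \<exists>C\<in>components_within (cyl_nbrs N) V. \<exists>D\<in>components_within (cyl_nbrs N) V. C \<noteq> D \<and> {x \<in> cylinder d N. M \<le> last x} \<subseteq> C \<and> {x \<in> cylinder d N. last x \<le> - M} \<subseteq> D"
    using dis unfolding disconnects_def eventually_at_top_linorder V_def by blast
  \<comment> \<open>Above height \<open>M\<close> and below \<open>- M\<close> there are no visited points of the strip, and the two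
    ends of the cylinder lie in different components.\<close>
  define M where "M = max M0 (1 + Max (insert 0 ((\<lambda>p. \<bar>snd p\<bar>) ` S')))"
  have M: "\<bar>snd p\<bar> < M" if "p \<in> S'" for p
  proof -
    have "\<bar>snd p\<bar> \<le> Max (insert 0 ((\<lambda>p. \<bar>snd p\<bar>) ` S'))" using that finS' by (intro Max_ge) auto
    then show "\<bar>snd p\<bar> < M" by (simp add: M_def)
  qed
  have MM: "M \<ge> M0" by (simp add: M_def)
  obtain q where q: "snd q \<ge> M" "q \<in> strip N - S'" "(0, - M) \<in> strip N - S'"
    "((0, - M), q) \<in> {(x, y). rook_adj x y \<and> x \<in> strip N - S' \<and> y \<in> strip N - S'}\<^sup>*"
    using crossing_or_open_path[OF M N nc] by blast
  have VS: "?pt p \<in> V" if "p \<in> strip N - S'" for p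
    using that by (auto simp: V_def S'_def cylinder_eq)
  have adj: "(?pt p, ?pt p') \<in> E" if r: "rook_adj p p'" "p \<in> strip N - S'" "p' \<in> strip N - S'" for p p'
  proof -
    obtain i s where "i < Suc d" "s \<in> {1,-1}" "plane_lift d p' = nudge (plane_lift d p) i s"
    proof (cases "fst p' = fst p")
      case True
      then have "\<bar>snd p' - snd p\<bar> = 1" using r(1) by (simp add: rook_adj_def)
      then have "snd p' - snd p \<in> {1,-1}" by auto
      moreover have "plane_lift d p' = nudge (plane_lift d p) d (snd p' - snd p)" 
      proof
        fix k show "plane_lift d p' k = nudge (plane_lift d p) d (snd p' - snd p) k"
          using True d by (cases "k = 0"; cases "k = d") (simp_all add: plane_lift_def nudge_def)
      qed
      ultimately show thesis using that by blast
    next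
      case False
      then have "\<bar>fst p' - fst p\<bar> \<ge> 1" by auto
      then have "snd p' = snd p" "\<bar>fst p' - fst p\<bar> = 1" using r(1) unfolding rook_adj_def by linarith+
      then have "snd p' = snd p" "fst p' - fst p \<in> {1,-1}" by auto
      moreover from this(1) have "plane_lift d p' = nudge (plane_lift d p) 0 (fst p' - fst p)"
      proof (intro ext)
        fix k show "plane_lift d p' k = nudge (plane_lift d p) 0 (fst p' - fst p) k"
          using \<open>snd p' = snd p\<close> d by (cases "k = 0"; cases "k = d") (simp_all add: plane_lift_def nudge_def)
      qed
      ultimately show thesis using that by blast
    qed
    then have "?pt p' \<in> cyl_nbrs N (?pt p)" unfolding cyl_nbrs_proj by (intro image_eqI[of _ _ "(i, s)"]) auto
    then show ?thesis using VS[OF r(2)] VS[OF r(3)] by (simp add: E_def)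
  qed
  have path: "(?pt (0, - M), ?pt p) \<in> E\<^sup>*" if "((0, - M), p) \<in> {(x, y). rook_adj x y \<and> x \<in> strip N - S' \<and> y \<in> strip N - S'}\<^sup>*" for p
    using that
  proof (induction rule: rtrancl_induct)
    case (step y z)
    then show ?case using adj[of y z] by (auto intro: rtrancl_into_rtrancl)
  qed simp
  have symE: "sym E" unfolding E_def using cyl_nbrs_sym by (auto simp: sym_def V_def)
  have eq: "equiv V (Restr (E\<^sup>*) V)"
  proof (rule equivI)
    show "refl_on V (Restr (E\<^sup>*) V)" by (auto simp: refl_on_def)
    show "sym (Restr (E\<^sup>*) V)" using symD[OF sym_rtrancl[OF symE]] by (intro symI) blast
    show "trans (Restr (E\<^sup>*) V)" by (rule trans_Restr[OF trans_rtrancl])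
  qed auto
  obtain C D where CD: "C \<in> components_within (cyl_nbrs N) V" "D \<in> components_within (cyl_nbrs N) V" "C \<noteq> D"
    "{x \<in> cylinder d N. M \<le> last x} \<subseteq> C" "{x \<in> cylinder d N. last x \<le> - M} \<subseteq> D"
    using M0[OF MM] by blast
  have cyl: "?pt p \<in> cylinder d N" for p by (simp add: cylinder_eq)
  have "M \<le> last (?pt q)" "last (?pt (0, - M)) \<le> - M" unfolding lst using q(1) by simp_all
  then have "?pt q \<in> C" "?pt (0, - M) \<in> D" using CD(4,5) cyl by blast+
  moreover have "(?pt (0, - M), ?pt q) \<in> Restr (E\<^sup>*) V" using path[OF q(4)] VS[OF q(2)] VS[OF q(3)] by blast
  ultimately have "D = C" using CD(1,2) unfolding components_within_def E_def[symmetric]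
    by (intro quotient_eqI[OF eq]) auto
  then show False using CD(3) by simp
qed

lemma walk_height: "l \<in> set_pmf (walk D n X) \<Longrightarrow> D \<ge> 1 \<Longrightarrow> x \<in> set l \<Longrightarrow> \<bar>x d\<bar> \<le> \<bar>X d\<bar> + int n"
proof (induction n arbitrary: X l)
  case (Suc n)
  from Suc.prems(1) obtain Y l' where Y: "Y \<in> set_pmf (lift_step D X)" "l' \<in> set_pmf (walk D n Y)" "l = X # l'" by auto
  have "\<bar>Y d\<bar> \<le> \<bar>X d\<bar> + 1" using Y(1) Suc.prems(2) by (auto simp: set_lift_step nudge_def)
  then show ?case using Suc.IH[OF Y(2) Suc.prems(2)] Suc.prems(3) Y(3) by fastforce
qed simp

text \<open>The lifted walk of \<open>n\<close> steps stays at heights at most \<open>n\<close>, which leaves finitely many paths.\<close>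

lemma king_path_of_disconnection:
  assumes d: "d \<ge> 1" and N: "N \<ge> 1" and l: "l \<in> set_pmf (walk (Suc d) n (\<lambda>_. 0))"
    and S: "disconnects d N S" "S \<subseteq> proj N d ` set l"
  shows "\<exists>xs\<in>king_paths N n. covers N d l (set xs)"
proof -
  have vis: "\<exists>x\<in>set l. in_plane N d x \<and> (x 0 mod int N, x d) = p" if p: "p \<in> strip N" "proj N d (plane_lift d p) \<in> S" for p
  proof -
    have "proj N d (plane_lift d p) \<in> proj N d ` set l" using p(2) S(2) by blast
    then obtain x where "proj N d (plane_lift d p) = proj N d x" "x \<in> set l" by (rule imageE)
    then have "x \<in> set l" "proj N d x = proj N d (plane_lift d p)" by simp_all
    then show ?thesis using proj_plane_lift_iff[OF d p(1)] by blast
  qed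
  have "\<bar>snd p\<bar> \<le> int n" if p: "p \<in> {p \<in> strip N. proj N d (plane_lift d p) \<in> S}" for p
  proof -
    obtain x where "x \<in> set l" "(x 0 mod int N, x d) = p" using vis[of p] p by blast
    then show ?thesis using walk_height[OF l, of x d] by auto
  qed
  from king_path_of_crossed[OF crossed_of_disconnects[OF d N S(1)] this N] vis
  show ?thesis by blast
qed

section \<open>Lower bound on the disconnection time\<close>

lemma disconnection_time_ge_iff:
  "enat k \<le> disconnection_time d N \<omega> \<longleftrightarrow> \<not> (\<exists>s<k. disconnects d N (\<omega> ` {0..s}))"
  unfolding disconnection_time_def le_Inf_iff by (auto simp: not_less)

lemma ereal_le_enat_iff: "ereal r \<le> ereal_of_enat T \<longleftrightarrow> enat (nat \<lceil>r\<rceil>) \<le> T"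
  by (cases T) (auto simp: nat_le_iff ceiling_le_iff)

text \<open>The event \<open>T\<^sub>N < k\<close> as a property of the list of the first \<open>k + 1\<close> positions.\<close>

definition disconnects_before :: "nat \<Rightarrow> nat \<Rightarrow> nat \<Rightarrow> int list list \<Rightarrow> bool" where
  "disconnects_before d N k l \<longleftrightarrow> (\<exists>s<k. disconnects d N (set (take (Suc s) l)))"

lemma disconnects_before_iff: "disconnects_before d N k (map \<omega> [0..<Suc k]) \<longleftrightarrow> disconnection_time d N \<omega> < enat k"
proof -
  have "set (take (Suc s) (map \<omega> [0..<Suc k])) = \<omega> ` {0..s}" if "s < k" for s
    using that by (simp add: take_map take_upt atLeastLessThanSuc_atLeastAtMost del: upt_Suc)
  then have "disconnects_before d N k (map \<omega> [0..<Suc k]) \<longleftrightarrow> (\<exists>s<k. disconnects d N (\<omega> ` {0..s}))"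
    unfolding disconnects_before_def by auto
  then show ?thesis using disconnection_time_ge_iff[of k d N \<omega>] by (simp add: not_le[symmetric])
qed

lemma prob_space_cyl_walk: "prob_space (cyl_walk d N)"
  unfolding cyl_walk_def by (rule prob_space_srw)

lemma space_cyl_walk [simp]: "space (cyl_walk d N) = UNIV"
  by (simp add: cyl_walk_def)

lemma time_ge_sets: "{\<omega>. enat k \<le> disconnection_time d N \<omega>} \<in> sets (cyl_walk d N)"
proof -
  have "{\<omega>. enat k \<le> disconnection_time d N \<omega>} = {\<omega>. \<not> disconnects_before d N k (map \<omega> [0..<Suc k])}"
    unfolding disconnects_before_iff by (simp add: not_less)
  then show ?thesis unfolding cyl_walk_def by (simp only: srw_prefix_event(1)[of "\<lambda>l. \<not> disconnects_before d N k l"])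
qed

lemma measurable_disconnection_time: "disconnection_time d N \<in> measurable (cyl_walk d N) (count_space UNIV)"
proof -
  have fin: "disconnection_time d N -` {enat t} \<in> sets (cyl_walk d N)" for t
  proof -
    have "disconnection_time d N -` {enat t} = {\<omega>. enat t \<le> disconnection_time d N \<omega>} - {\<omega>. enat (Suc t) \<le> disconnection_time d N \<omega>}"
    proof -
      have "T = enat t \<longleftrightarrow> enat t \<le> T \<and> \<not> enat (Suc t) \<le> T" for T by (cases T) auto
      then show ?thesis by (simp add: set_eq_iff)
    qed
    then show ?thesis using time_ge_sets by (simp add: sets.Diff)
  qed
  have inf: "disconnection_time d N -` {\<infinity>} \<in> sets (cyl_walk d N)"
  proof -
    have "disconnection_time d N -` {\<infinity>} = UNIV - (\<Union>t. disconnection_time d N -` {enat t})"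
    proof -
      have "T = \<infinity> \<longleftrightarrow> (\<forall>t. T \<noteq> enat t)" for T :: enat by (cases T) auto
      then show ?thesis by (simp add: set_eq_iff)
    qed
    also have "\<dots> \<in> sets (cyl_walk d N)"
    proof (rule sets.Diff)
      show "UNIV \<in> sets (cyl_walk d N)" using sets.top[of "cyl_walk d N"] by simp
      show "(\<Union>t. disconnection_time d N -` {enat t}) \<in> sets (cyl_walk d N)" by (intro sets.countable_UN image_subsetI fin)
    qed
    finally show ?thesis .
  qed
  have "disconnection_time d N -` {T} \<in> sets (cyl_walk d N)" for T
    using fin inf by (cases T) auto
  then show ?thesis unfolding measurable_count_space_eq2_countable by auto
qed

lemma measurable_time_ratio: "time_ratio d N \<in> borel_measurable (cyl_walk d N)"
proof -
  have "time_ratio d N = (\<lambda>T. case T of enat t \<Rightarrow> real N ^ (2 * d) / real t | \<infinity> \<Rightarrow> 0) \<circ> disconnection_time d N"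
    by (auto simp: time_ratio_def fun_eq_iff)
  then show ?thesis using measurable_comp[OF measurable_disconnection_time, of _ borel] by simp
qed

lemma power_times_geometric_tendsto_0:
  assumes "0 < \<rho>" "\<rho> < (1::real)" "1 \<le> e"
  shows "(\<lambda>N. real N ^ e * \<rho> ^ N) \<longlonglongrightarrow> 0"
proof -
  define r where "r = root e \<rho>"
  have r: "0 < r" "r < 1" "r ^ e = \<rho>" using assms by (auto simp: r_def)
  have "(\<lambda>N. real N * r ^ N) \<longlonglongrightarrow> 0" using r by (intro powser_times_n_limit_0) auto
  then have "(\<lambda>N. (real N * r ^ N) ^ e) \<longlonglongrightarrow> 0 ^ e" by (intro tendsto_power)
  moreover have "(real N * r ^ N) ^ e = real N ^ e * \<rho> ^ N" for N
    by (simp only: power_mult_distrib r(3)[symmetric] power_mult[symmetric] mult.commute)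
  moreover have "(0::real) ^ e = 0" using assms(3) by (simp add: zero_power)
  ultimately show ?thesis by simp
qed

text \<open>Union bound over the king paths, on the event that no height is visited more than \<open>m\<close> times.\<close>

lemma disconnection_prob_bound:
  assumes d: "1 \<le> d" and N: "3 \<le> N" and \<theta>: "1 \<le> \<theta>" "0 \<le> q'" "\<theta> * q' < 1" and \<kappa>: "0 < \<kappa>"
    and ret: "\<And>A n X. finite A \<Longrightarrow> card A = N \<Longrightarrow> on_set N d A X \<Longrightarrow>
        discount \<kappa> d A X * step_avg (Suc d) (hit (Suc d) (discount \<kappa> d A) (on_set N d A) n) X \<le> q'"
  shows "measure (cyl_walk d N) {\<omega>. disconnection_time d N \<omega> < enat k} \<le>
    measure_pmf.prob (walk (Suc d) k (\<lambda>_. 0)) {l. \<exists>z. Suc m \<le> visits d z l}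
     + real ((2 * k + 1) * 8 * 7 ^ N) * ((1 + \<theta> / (1 - \<theta> * q')) * exp (\<kappa> * real N * real m) / \<theta> ^ N)"
proof -
  define p where "p = walk (Suc d) k (\<lambda>_. 0)"
  define Big where "Big = {l. \<exists>z. Suc m \<le> visits d z l}"
  define Cov where "Cov xs = {l. covers N d l (set xs) \<and> (\<forall>z. visits d z l \<le> m)}" for xs :: "(int \<times> int) list"
  define b where "b = (1 + \<theta> / (1 - \<theta> * q')) * exp (\<kappa> * real N * real m) / \<theta> ^ N"
  have N1: "1 \<le> N" using N by simp
  have b0: "0 \<le> b" using \<theta> by (simp add: b_def)
  have Cov: "measure_pmf.prob p (Cov xs) \<le> b" if "xs \<in> king_paths N k" for xs
  proof -
    have c: "finite (set xs)" "card (set xs) = N" using that by (auto simp: king_paths_def distinct_card)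
    show ?thesis unfolding p_def Cov_def b_def by (rule cover_prob[OF c \<theta> \<kappa> ret[OF c]])
  qed
  have "measure (cyl_walk d N) {\<omega>. disconnection_time d N \<omega> < enat k} = measure_pmf.prob p {l. disconnects_before d N k (map (proj N d) l)}"
    unfolding disconnects_before_iff[symmetric] p_def by (rule cyl_walk_prob[OF N])
  also have "\<dots> = measure_pmf.prob p ({l. disconnects_before d N k (map (proj N d) l)} \<inter> set_pmf p)"
    by (simp add: measure_Int_set_pmf)
  also have "\<dots> \<le> measure_pmf.prob p (Big \<union> (\<Union>xs\<in>king_paths N k. Cov xs))"
  proof (rule measure_pmf.finite_measure_mono)
    show "{l. disconnects_before d N k (map (proj N d) l)} \<inter> set_pmf p \<subseteq> Big \<union> (\<Union>xs\<in>king_paths N k. Cov xs)"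
    proof
      fix l assume l: "l \<in> {l. disconnects_before d N k (map (proj N d) l)} \<inter> set_pmf p"
      then obtain s where s: "disconnects d N (set (take (Suc s) (map (proj N d) l)))" unfolding disconnects_before_def by blast
      have "set (take (Suc s) (map (proj N d) l)) \<subseteq> proj N d ` set l" using set_take_subset[of "Suc s" "map (proj N d) l"] by simp
      then obtain xs where "xs \<in> king_paths N k" "covers N d l (set xs)"
        using king_path_of_disconnection[OF d N1 _ s] l unfolding p_def by blast
      then show "l \<in> Big \<union> (\<Union>xs\<in>king_paths N k. Cov xs)"
        unfolding Big_def Cov_def by (cases "\<exists>z. Suc m \<le> visits d z l") (auto simp: not_less_eq_eq)
    qed
  qed simp
  also have "\<dots> \<le> measure_pmf.prob p Big + measure_pmf.prob p (\<Union>xs\<in>king_paths N k. Cov xs)"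
    by (intro measure_Un_le) auto
  also have "measure_pmf.prob p (\<Union>xs\<in>king_paths N k. Cov xs) \<le> (\<Sum>xs\<in>king_paths N k. measure_pmf.prob p (Cov xs))"
    using card_king_paths(1)[OF N1] by (intro measure_pmf.finite_measure_subadditive_finite) auto
  also have "\<dots> \<le> real (card (king_paths N k)) * b" by (intro sum_bounded_above Cov)
  also have "\<dots> \<le> real ((2 * k + 1) * 8 * 7 ^ N) * b"
    using card_king_paths(2)[OF N1, of k] b0 by (intro mult_right_mono) (simp_all only: of_nat_le_iff)
  finally show ?thesis unfolding Big_def b_def p_def by simp
qed

text \<open>The bound on the covering probability is used with \<open>\<kappa> = Cc / N ^ d\<close> and \<open>m = \<delta> N ^ d\<close>. Its
  product with the number of paths is a polynomial in \<open>N\<close> times \<open>(7 exp (Cc \<delta>) / \<theta>) ^ N\<close>.\<close>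

lemma disconnection_unlikely:
  assumes d: "2 \<le> d" and hyp: "7 * (2 / (real d + 1) + (1 - 2 / (real d + 1)) * return_prob (d - 1)) < 1" and \<epsilon>: "0 < \<epsilon>"
  obtains \<gamma>0 :: real and N1 :: nat where "0 < \<gamma>0"
    "\<And>N \<gamma>. N1 \<le> N \<Longrightarrow> 0 < \<gamma> \<Longrightarrow> \<gamma> \<le> \<gamma>0 \<Longrightarrow> 1 - \<epsilon> \<le> measure (cyl_walk d N) {\<omega>. ereal (\<gamma> * real N ^ (2 * d)) \<le> ereal_of_enat (disconnection_time d N \<omega>)}"
proof -
  define q0 where "q0 = 2 / (real d + 1) + (1 - 2 / (real d + 1)) * return_prob (d - 1)"
  have rp: "0 \<le> return_prob (d - 1)" by (simp add: return_prob_def)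
  have c0: "0 \<le> 1 - 2 / (real d + 1)" using d by simp
  have q0_ge: "2 / (real d + 1) \<le> q0" using mult_nonneg_nonneg[OF c0 rp] by (simp add: q0_def)
  have "0 < 2 / (real d + 1)" by simp
  then have "0 < q0" using q0_ge by (rule less_le_trans)
  moreover have "7 * q0 < 1" using hyp unfolding q0_def .
  ultimately have q0: "0 < q0" "7 * q0 < 1" by simp_all
  \<comment> \<open>The hypothesis even forces \<open>d \<ge> 14\<close>; the heat kernel estimates ask for four transversal
    coordinates.\<close>
  have d5: "5 \<le> d"
  proof -
    have "2 / (real d + 1) < 1 / 7" using q0 q0_ge by linarith
    then have "14 < real d + 1" by (simp add: field_simps)
    then show ?thesis by linarith
  qed
  \<comment> \<open>Any \<open>\<theta>\<close> strictly between \<open>7\<close> and \<open>1 / q0\<close> will do, and then any \<open>e > 0\<close> with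
    \<open>\<theta> (q0 + e) < 1\<close>.\<close>
  define \<theta> where "\<theta> = (7 + 1 / q0) / 2"
  have "7 < 1 / q0" using q0 by (simp add: field_simps)
  then have \<theta>7: "7 < \<theta>" by (simp add: \<theta>_def)
  have \<theta>q0: "\<theta> * q0 < 1"
  proof -
    have "\<theta> * q0 = (7 * q0 + 1) / 2" using q0 by (simp add: \<theta>_def field_simps)
    then show ?thesis using q0 by simp
  qed
  define e where "e = (1 - \<theta> * q0) / (2 * \<theta>)"
  have e: "0 < e" using \<theta>q0 \<theta>7 by (simp add: e_def)
  define q' where "q' = q0 + e"
  have q': "0 \<le> q'" "\<theta> * q' < 1"
  proof -
    show "0 \<le> q'" using q0 e by (simp add: q'_def)
    have "\<theta> * e = (1 - \<theta> * q0) / 2" using \<theta>7 by (simp add: e_def)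
    then have "\<theta> * q' = (1 + \<theta> * q0) / 2" by (simp add: q'_def distrib_left field_simps)
    then show "\<theta> * q' < 1" using \<theta>q0 by simp
  qed
  have "1 \<le> d - 1" using d by simp
  note hit_rp = hit_le_return_prob[OF this]
  obtain Cc N0 where Cc: "0 < Cc" and ret: "\<And>N A n X. N0 \<le> N \<Longrightarrow> finite A \<Longrightarrow> card A = N \<Longrightarrow> on_set N d A X \<Longrightarrow>
      discount (Cc / real N ^ d) d A X * step_avg (Suc d) (hit (Suc d) (discount (Cc / real N ^ d) d A) (on_set N d A) n) X \<le> q'"
    using return_prob_small[OF d5 hit_rp e] unfolding q'_def q0_def by blast
  \<comment> \<open>Half of the gap between \<open>7\<close> and \<open>\<theta>\<close>, on the logarithmic scale, is spent on the
    discount.\<close>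
  define \<delta> where "\<delta> = ln (\<theta> / 7) / (2 * Cc)"
  have ln0: "0 < ln (\<theta> / 7)" using \<theta>7 by simp
  have \<delta>: "0 < \<delta>" using Cc ln0 by (simp add: \<delta>_def)
  define \<rho> where "\<rho> = 7 * exp (Cc * \<delta>) / \<theta>"
  have \<rho>: "0 < \<rho>" "\<rho> < 1"
  proof -
    have "Cc * \<delta> = ln (\<theta> / 7) / 2" using Cc by (simp add: \<delta>_def)
    also have "\<dots> < ln (\<theta> / 7)" using ln0 by simp
    finally have "exp (Cc * \<delta>) < \<theta> / 7" using \<theta>7 exp_less_mono[of "Cc * \<delta>" "ln (\<theta> / 7)"] by simp
    then show "\<rho> < 1" using \<theta>7 by (simp add: \<rho>_def field_simps)
    show "0 < \<rho>" using \<theta>7 by (simp add: \<rho>_def)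
  qed
  have "0 < \<epsilon> / 2" using \<epsilon> by simp
  then obtain c m0 where c: "0 < c" and loc: "\<And>m n X. m0 \<le> m \<Longrightarrow> real (Suc n) \<le> c * (real m)\<^sup>2 \<Longrightarrow> X d = 0 \<Longrightarrow>
      measure_pmf.prob (walk (Suc d) n X) {l. \<exists>z. m \<le> visits d z l} \<le> \<epsilon> / 2"
    using max_visits_tight[of d "Suc d" "\<epsilon> / 2"] by (metis lessI)
  \<comment> \<open>Up to time \<open>\<gamma>0 N\<^bsup>2d\<^esup>\<close> the largest local time probably stays below \<open>\<delta> N\<^sup>d\<close>; the factor \<open>2\<close> absorbs
    the rounding of the time.\<close>
  define \<gamma>0 where "\<gamma>0 = c * \<delta>\<^sup>2 / 2"
  have \<gamma>0: "0 < \<gamma>0" using c \<delta> by (simp add: \<gamma>0_def)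
  define B where "B = 1 + \<theta> / (1 - \<theta> * q')"
  have B: "0 \<le> B" using q' \<theta>7 by (simp add: B_def)
  define err where "err N = (2 * (\<gamma>0 * real N ^ (2 * d)) + 3) * 8 * B * \<rho> ^ N" for N :: nat
  have "err \<longlonglongrightarrow> 16 * \<gamma>0 * B * 0 + 24 * B * 0"
  proof -
    have "err = (\<lambda>N. 16 * \<gamma>0 * B * (real N ^ (2 * d) * \<rho> ^ N) + 24 * B * \<rho> ^ N)" by (auto simp: err_def fun_eq_iff algebra_simps)
    moreover have "(\<lambda>N. 16 * \<gamma>0 * B * (real N ^ (2 * d) * \<rho> ^ N) + 24 * B * \<rho> ^ N) \<longlonglongrightarrow> 16 * \<gamma>0 * B * 0 + 24 * B * 0"
      using \<rho> d by (intro tendsto_intros power_times_geometric_tendsto_0 LIMSEQ_realpow_zero) auto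
    ultimately show ?thesis by simp
  qed
  then have "err \<longlonglongrightarrow> 0" by simp
  then have "eventually (\<lambda>N. err N < \<epsilon> / 2) sequentially" using \<epsilon> by (intro order_tendstoD(2)) auto
  then obtain N2 where N2: "\<And>N. N2 \<le> N \<Longrightarrow> err N < \<epsilon> / 2" by (auto simp: eventually_sequentially)
  define N1 where "N1 = Max {3, N0, N2, nat \<lceil>real m0 / \<delta>\<rceil>, nat \<lceil>2 / \<gamma>0\<rceil>}"
  show thesis
  proof (rule that[OF \<gamma>0])
    fix N :: nat and \<gamma> :: real
    assume N: "N1 \<le> N" and \<gamma>: "0 < \<gamma>" "\<gamma> \<le> \<gamma>0"
    have NN: "3 \<le> N" "N0 \<le> N" "N2 \<le> N" "nat \<lceil>real m0 / \<delta>\<rceil> \<le> N" "nat \<lceil>2 / \<gamma>0\<rceil> \<le> N"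
      using N unfolding N1_def by auto
    have Npow: "real N \<le> real N ^ d" "real N \<le> real N ^ (2 * d)"
      using NN(1) d by (auto intro!: self_le_power)
    define k where "k = nat \<lceil>\<gamma> * real N ^ (2 * d)\<rceil>"
    define m where "m = nat \<lfloor>\<delta> * real N ^ d\<rfloor>"
    have x0: "0 \<le> \<delta> * real N ^ d" using \<delta> by simp
    have m: "real m \<le> \<delta> * real N ^ d" "\<delta> * real N ^ d \<le> real (Suc m)" using x0 unfolding m_def by linarith+
    have y0: "0 \<le> \<gamma> * real N ^ (2 * d)" using \<gamma> by simp
    have "real k \<le> \<gamma> * real N ^ (2 * d) + 1" using y0 unfolding k_def by linarith
    also have "\<dots> \<le> \<gamma>0 * real N ^ (2 * d) + 1" using \<gamma> by (intro add_right_mono mult_right_mono) auto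
    finally have k: "real k \<le> \<gamma>0 * real N ^ (2 * d) + 1" .
    have "measure_pmf.prob (walk (Suc d) k (\<lambda>_. 0)) {l. \<exists>z. Suc m \<le> visits d z l} \<le> \<epsilon> / 2"
    proof (rule loc)
      have "real m0 / \<delta> \<le> real N" using NN(4) by linarith
      then have "real m0 \<le> \<delta> * real N" using \<delta> by (simp add: field_simps)
      also have "\<dots> \<le> \<delta> * real N ^ d" using \<delta> Npow by (intro mult_left_mono) auto
      finally show "m0 \<le> Suc m" using m by linarith
      have "2 / \<gamma>0 \<le> real N ^ (2 * d)" using NN(5) Npow(2) by linarith
      then have "2 \<le> \<gamma>0 * real N ^ (2 * d)" using \<gamma>0 by (simp add: field_simps)
      then have "real (Suc k) \<le> 2 * (\<gamma>0 * real N ^ (2 * d))" using k by simp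
      also have "\<dots> = c * (\<delta> * real N ^ d)\<^sup>2" by (simp add: \<gamma>0_def power_mult_distrib power_even_eq)
      also have "\<dots> \<le> c * (real (Suc m))\<^sup>2" using c m x0 by (intro mult_left_mono power_mono) auto
      finally show "real (Suc k) \<le> c * (real (Suc m))\<^sup>2" .
    qed simp
    moreover have "real ((2 * k + 1) * 8 * 7 ^ N) * (B * exp (Cc / real N ^ d * real N * real m) / \<theta> ^ N) \<le> err N"
    proof -
      have "Cc / real N ^ d * real N * real m \<le> Cc / real N ^ d * real N * (\<delta> * real N ^ d)"
        using Cc m by (intro mult_left_mono) auto
      also have "\<dots> = real N * (Cc * \<delta>)" using NN(1) by simp
      finally have "exp (Cc / real N ^ d * real N * real m) \<le> exp (Cc * \<delta>) ^ N" by (simp add: exp_of_nat_mult[symmetric])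
      then have "real ((2 * k + 1) * 8 * 7 ^ N) * (B * exp (Cc / real N ^ d * real N * real m) / \<theta> ^ N)
        \<le> real ((2 * k + 1) * 8 * 7 ^ N) * (B * exp (Cc * \<delta>) ^ N / \<theta> ^ N)"
        using B \<theta>7 by (intro mult_left_mono divide_right_mono) auto
      also have "\<dots> = (2 * real k + 1) * 8 * B * \<rho> ^ N"
        by (simp add: \<rho>_def power_divide power_mult_distrib algebra_simps)
      also have "\<dots> \<le> err N" unfolding err_def using k B \<rho> by (intro mult_right_mono) auto
      finally show ?thesis .
    qed
    moreover have "measure (cyl_walk d N) {\<omega>. disconnection_time d N \<omega> < enat k} \<le>
      measure_pmf.prob (walk (Suc d) k (\<lambda>_. 0)) {l. \<exists>z. Suc m \<le> visits d z l}
       + real ((2 * k + 1) * 8 * 7 ^ N) * (B * exp (Cc / real N ^ d * real N * real m) / \<theta> ^ N)"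
      unfolding B_def
    proof (rule disconnection_prob_bound)
      show "discount (Cc / real N ^ d) d A X * step_avg (Suc d) (hit (Suc d) (discount (Cc / real N ^ d) d A) (on_set N d A) n) X \<le> q'"
        if "finite A" "card A = N" "on_set N d A X" for A n X by (rule ret[OF NN(2) that])
    qed (use d NN \<theta>7 q' Cc in auto)
    ultimately have le: "measure (cyl_walk d N) {\<omega>. disconnection_time d N \<omega> < enat k} \<le> \<epsilon>"
      using N2[OF NN(3)] by linarith
    interpret prob_space "cyl_walk d N" by (rule prob_space_cyl_walk)
    have "{\<omega>. ereal (\<gamma> * real N ^ (2 * d)) \<le> ereal_of_enat (disconnection_time d N \<omega>)} = space (cyl_walk d N) - {\<omega>. disconnection_time d N \<omega> < enat k}"
      unfolding ereal_le_enat_iff k_def[symmetric] by auto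
    moreover have "{\<omega>. disconnection_time d N \<omega> < enat k} \<in> events"
    proof -
      have "{\<omega>. disconnection_time d N \<omega> < enat k} = space (cyl_walk d N) - {\<omega>. enat k \<le> disconnection_time d N \<omega>}" by auto
      then show ?thesis using time_ge_sets[of k d N] by (metis sets.compl_sets)
    qed
    ultimately show "1 - \<epsilon> \<le> prob {\<omega>. ereal (\<gamma> * real N ^ (2 * d)) \<le> ereal_of_enat (disconnection_time d N \<omega>)}"
      using le prob_compl by simp
  qed
qed

text \<open>Finitely many laws are always tight.\<close>

lemma tight_of_eventually_uniform:
  assumes rd: "\<And>n. real_distribution (\<mu> n)" and pos: "\<And>n. measure (\<mu> n) {..-1} = 0"
    and ev: "\<And>\<epsilon>. 0 < \<epsilon> \<Longrightarrow> \<exists>b N. \<forall>n\<ge>N. 1 - \<epsilon> < measure (\<mu> n) {..b}"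
  shows "tight \<mu>"
  unfolding tight_def
proof (intro conjI allI impI rd)
  fix \<epsilon> :: real assume \<epsilon>: "0 < \<epsilon>"
  obtain b0 N where b0: "\<And>n. N \<le> n \<Longrightarrow> 1 - \<epsilon> < measure (\<mu> n) {..b0}" using ev[OF \<epsilon>] by blast
  have "\<exists>b. 1 - \<epsilon> < measure (\<mu> n) {..b}" for n
  proof -
    interpret real_distribution "\<mu> n" by (rule rd)
    have "eventually (\<lambda>x. 1 - \<epsilon> < cdf (\<mu> n) x) at_top"
      using cdf_lim_at_top_prob \<epsilon> by (intro order_tendstoD(1)) auto
    then show ?thesis unfolding cdf_def by (metis eventually_at_top_linorder order_refl)
  qed
  then obtain f where f: "\<And>n. 1 - \<epsilon> < measure (\<mu> n) {..f n}" by metis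
  define b where "b = Max (insert 0 (insert b0 (f ` {..<N})))"
  have b: "1 - \<epsilon> < measure (\<mu> n) {..b}" for n
  proof -
    interpret real_distribution "\<mu> n" by (rule rd)
    obtain b' where b': "b' \<le> b" "1 - \<epsilon> < measure (\<mu> n) {..b'}"
    proof (cases "N \<le> n")
      case True
      have "b0 \<le> b" unfolding b_def by (intro Max_ge) auto
      then show thesis using that b0[OF True] by blast
    next
      case False
      then have "f n \<le> b" unfolding b_def by (intro Max_ge) auto
      then show thesis using that f[of n] by blast
    qed
    have "measure (\<mu> n) {..b'} \<le> measure (\<mu> n) {..b}" using b'(1) by (intro finite_measure_mono) auto
    then show ?thesis using b'(2) by simp
  qed
  have "(0::real) \<le> b" unfolding b_def by (intro Max_ge) auto
  moreover have "1 - \<epsilon> < measure (\<mu> n) {-1<..b}" for n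
  proof -
    interpret real_distribution "\<mu> n" by (rule rd)
    have "{..b} = {..-1} \<union> {-1<..b}" using \<open>0 \<le> b\<close> by auto
    moreover have "measure (\<mu> n) ({..-1} \<union> {-1<..b}) = measure (\<mu> n) {..-1} + measure (\<mu> n) {-1<..b}"
      by (rule finite_measure_Union) auto
    ultimately have "measure (\<mu> n) {..b} = measure (\<mu> n) {..-1} + measure (\<mu> n) {-1<..b}" by simp
    then show ?thesis using b[of n] pos[of n] by simp
  qed
  ultimately show "\<exists>a b. a < b \<and> (\<forall>n. 1 - \<epsilon> < measure (\<mu> n) {a<..b})"
    by (intro exI[of _ "-1"] exI[of _ b]) auto
qed

theorem theorem1p1:
  fixes d :: nat
  assumes "d \<ge> 2"
    and "7 * (2 / (real d + 1) + (1 - 2 / (real d + 1)) * return_prob (d - 1)) < 1"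
  shows "((\<lambda>\<gamma> :: real. liminf (\<lambda>N. ereal (measure (cyl_walk d N)
             {\<omega>. ereal (\<gamma> * real N ^ (2 * d)) \<le> ereal_of_enat (disconnection_time d N \<omega>)})))
           \<longlongrightarrow> 1) (at_right 0)
       \<and> tight (\<lambda>n. distr (cyl_walk d (n + 2)) borel (time_ratio d (n + 2)))"
proof
  let ?f = "\<lambda>\<gamma> N. measure (cyl_walk d N) {\<omega>. ereal (\<gamma> * real N ^ (2 * d)) \<le> ereal_of_enat (disconnection_time d N \<omega>)}"
  have f1: "?f \<gamma> N \<le> 1" for \<gamma> N using prob_space.prob_le_1[OF prob_space_cyl_walk] .
  have le1: "liminf (\<lambda>N. ereal (?f \<gamma> N)) \<le> 1" for \<gamma>
  proof -
    have "liminf (\<lambda>N. ereal (?f \<gamma> N)) \<le> limsup (\<lambda>N. ereal (?f \<gamma> N))" by (rule Liminf_le_Limsup) simp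
    also have "\<dots> \<le> 1" using f1 by (intro Limsup_bounded always_eventually) (auto simp: one_ereal_def)
    finally show ?thesis .
  qed
  show "((\<lambda>\<gamma> :: real. liminf (\<lambda>N. ereal (?f \<gamma> N))) \<longlongrightarrow> 1) (at_right 0)"
  proof (rule order_tendstoI)
    fix a :: ereal assume "a < 1"
    then obtain r where r: "a < ereal r" "ereal r < 1" using ereal_dense2 by blast
    then have "0 < 1 - r" by (simp add: one_ereal_def)
    then obtain \<gamma>0 N1 where g: "0 < \<gamma>0" "\<And>N \<gamma>. N1 \<le> N \<Longrightarrow> 0 < \<gamma> \<Longrightarrow> \<gamma> \<le> \<gamma>0 \<Longrightarrow> 1 - (1 - r) \<le> ?f \<gamma> N"
      using disconnection_unlikely[OF assms] by metis
    have "a < liminf (\<lambda>N. ereal (?f \<gamma> N))" if "0 < \<gamma>" "\<gamma> < \<gamma>0" for \<gamma>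
    proof -
      have "ereal r \<le> liminf (\<lambda>N. ereal (?f \<gamma> N))"
        using g(2)[of _ \<gamma>] that by (intro Liminf_bounded) (auto simp: eventually_sequentially intro!: exI[of _ N1])
      then show ?thesis using r(1) by simp
    qed
    then show "eventually (\<lambda>\<gamma>. a < liminf (\<lambda>N. ereal (?f \<gamma> N))) (at_right 0)"
      unfolding eventually_at_right_field using g(1) by blast
  next
    fix a :: ereal assume "1 < a"
    then show "eventually (\<lambda>\<gamma>. liminf (\<lambda>N. ereal (?f \<gamma> N)) < a) (at_right 0)"
      using le1 by (intro always_eventually) (auto intro: le_less_trans)
  qed
  show "tight (\<lambda>n. distr (cyl_walk d (n + 2)) borel (time_ratio d (n + 2)))"
  proof (rule tight_of_eventually_uniform)
    fix n
    interpret prob_space "cyl_walk d (n + 2)" by (rule prob_space_cyl_walk)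
    show "real_distribution (distr (cyl_walk d (n + 2)) borel (time_ratio d (n + 2)))"
      by (intro real_distribution_distr measurable_time_ratio)
    have "0 \<le> time_ratio d (n + 2) \<omega>" for \<omega> by (simp add: time_ratio_def split: enat.split)
    then have "\<not> time_ratio d (n + 2) \<omega> \<le> -1" for \<omega> by (smt (verit))
    then have "time_ratio d (n + 2) -` {..-1} \<inter> space (cyl_walk d (n + 2)) = {}" by auto
    then show "measure (distr (cyl_walk d (n + 2)) borel (time_ratio d (n + 2))) {..-1} = 0"
      by (subst measure_distr[OF measurable_time_ratio]) auto
  next
    fix \<epsilon> :: real assume "0 < \<epsilon>"
    then have "0 < \<epsilon> / 2" by simp
    then obtain \<gamma>0 N1 where g: "0 < \<gamma>0" "\<And>N \<gamma>. N1 \<le> N \<Longrightarrow> 0 < \<gamma> \<Longrightarrow> \<gamma> \<le> \<gamma>0 \<Longrightarrow> 1 - \<epsilon> / 2 \<le> ?f \<gamma> N"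
      using disconnection_unlikely[OF assms] by metis
    have "1 - \<epsilon> < measure (distr (cyl_walk d (n + 2)) borel (time_ratio d (n + 2))) {..1 / \<gamma>0}" if n: "N1 \<le> n" for n
    proof -
      interpret prob_space "cyl_walk d (n + 2)" by (rule prob_space_cyl_walk)
      have "time_ratio d (n + 2) \<omega> \<le> 1 / \<gamma>0" if "ereal (\<gamma>0 * real (n + 2) ^ (2 * d)) \<le> ereal_of_enat (disconnection_time d (n + 2) \<omega>)" for \<omega>
      proof (cases "disconnection_time d (n + 2) \<omega>")
        case (enat t)
        have le: "\<gamma>0 * real (n + 2) ^ (2 * d) \<le> real t" using that enat by simp
        moreover have "0 < \<gamma>0 * real (n + 2) ^ (2 * d)" using g(1) by simp
        ultimately have "0 < real t" by linarith
        then have "real (n + 2) ^ (2 * d) / real t \<le> 1 / \<gamma>0" using le g(1) by (simp add: field_simps)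
        then show ?thesis using enat by (simp add: time_ratio_def)
      qed (use g(1) in \<open>simp add: time_ratio_def\<close>)
      then have sub: "{\<omega>. ereal (\<gamma>0 * real (n + 2) ^ (2 * d)) \<le> ereal_of_enat (disconnection_time d (n + 2) \<omega>)} \<subseteq> time_ratio d (n + 2) -` {..1 / \<gamma>0} \<inter> space (cyl_walk d (n + 2))" by auto
      have "1 - \<epsilon> < 1 - \<epsilon> / 2" using \<open>0 < \<epsilon>\<close> by simp
      also have "\<dots> \<le> ?f \<gamma>0 (n + 2)" using n g by (intro g(2)) auto
      also have "\<dots> \<le> measure (cyl_walk d (n + 2)) (time_ratio d (n + 2) -` {..1 / \<gamma>0} \<inter> space (cyl_walk d (n + 2)))"
        using sub measurable_sets[OF measurable_time_ratio[of d "n + 2"], of "{..1 / \<gamma>0}"] by (intro finite_measure_mono) auto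
      also have "\<dots> = measure (distr (cyl_walk d (n + 2)) borel (time_ratio d (n + 2))) {..1 / \<gamma>0}"
        by (subst measure_distr[OF measurable_time_ratio]) auto
      finally show ?thesis .
    qed
    then show "\<exists>b N. \<forall>n\<ge>N. 1 - \<epsilon> < measure (distr (cyl_walk d (n + 2)) borel (time_ratio d (n + 2))) {..b}" by blast
  qed
qed

end
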